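(* Let $1 < \gamma < 2^*/2$, $a, b > 0$, and $0 < \lambda \le a \lambda_1$. Let $t_0$ be the unique positive solution of the equation $a + b t^{\gamma-1} = S^{-2^*/2}\, t^{2^*/2-1}$ and set \[ c^* = \frac{1}{N}\, a t_0 + \left(\frac{1}{2\gamma} - \frac{1}{2^*}\right) b t_0^\gamma . \] Then the functional \[ J(u) = \frac{a}{2} \int_\Omega |\nabla u|^2\, dx + \frac{b}{2\gamma} \left(\int_\Omega |\nabla u|^2\, dx\right)^\gamma - \frac{\lambda}{2} \int_\Omega u^2\, dx - \frac{1}{2^*} \int_\Omega |u|^{2^*} dx, \quad u \in H^1_0(\Omega), \] satisfies the $(\mathrm{PS})_c$ condition for all $c < c^*$.
   Context: $\Omega$ is a bounded domain in $\mathbb{R}^N$, $N \ge 3$, and $2^* = 2N/(N-2)$. $H^1_0(\Omega)$ is normed by $\|u\|^2 = \int_\Omega |\nabla u|^2\, dx$. $\lambda_1 > 0$ is the first Dirichlet eigenvalue of $-\Delta$ in $\Omega$. The best Sobolev constant is $S = \inf_{u \in H^1_0(\Omega) \setminus \{0\}} \int_\Omega |\nabla u|^2\, dx \big/ \left(\int_\Omega |u|^{2^*} dx\right)^{2/2^*}$. A $C^1$-functional $J$ on $H^1_0(\Omega)$ satisfies the $(\mathrm{PS})_c$ condition ($c \in \mathbb{R}$) if every sequence $(u_j)$ in $H^1_0(\Omega)$ with $J(u_j) \to c$ and $J'(u_j) \to 0$ has a strongly convergent subsequence. *)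

theory Defs
  imports "HOL-Analysis.Analysis"
begin

text \<open>
  \<open>'a :: euclidean_space\<close> plays the role of $R^N$ with $N = DIM('a)$. Elements of function spaces
  on \<open>\<Omega>\<close> are represented by functions on all of \<open>'a\<close>, whose values outside \<open>\<Omega>\<close> are
  irrelevant; two functions represent the same element iff they agree a.e. on \<open>\<Omega>\<close>.
\<close>

section \<open>The Sobolev space of square integrable functions with zero boundary values\<close>

fun Ck :: "nat \<Rightarrow> ('a::euclidean_space \<Rightarrow> real) \<Rightarrow> bool" where
  "Ck 0 f \<longleftrightarrow> continuous_on UNIV f"
| "Ck (Suc k) f \<longleftrightarrow> (\<forall>x. f differentiable (at x)) \<and>
     (\<forall>i\<in>Basis. Ck k (\<lambda>x. frechet_derivative f (at x) i))"

definition test_functions :: "'a::euclidean_space set \<Rightarrow> ('a \<Rightarrow> real) set" where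
  "test_functions \<Omega> = {\<phi>. (\<forall>k. Ck k \<phi>) \<and>
     compact (closure {x. \<phi> x \<noteq> 0}) \<and> closure {x. \<phi> x \<noteq> 0} \<subseteq> \<Omega>}"

definition L2 :: "'a::euclidean_space set \<Rightarrow> ('a \<Rightarrow> 'b::euclidean_space) set" where
  "L2 \<Omega> = {f \<in> borel_measurable (lebesgue_on \<Omega>).
     integrable (lebesgue_on \<Omega>) (\<lambda>x. (norm (f x))\<^sup>2)}"

definition is_weak_gradient ::
    "'a::euclidean_space set \<Rightarrow> ('a \<Rightarrow> real) \<Rightarrow> ('a \<Rightarrow> 'a) \<Rightarrow> bool" where
  "is_weak_gradient \<Omega> u g \<longleftrightarrow> g \<in> L2 \<Omega> \<and>
     (\<forall>\<phi>\<in>test_functions \<Omega>. \<forall>i\<in>Basis.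
        (LINT x|lebesgue_on \<Omega>. u x * frechet_derivative \<phi> (at x) i)
        = - (LINT x|lebesgue_on \<Omega>. (g x \<bullet> i) * \<phi> x))"

text \<open>The weak gradient is unique up to null sets, so the choice does not affect any integral.\<close>

definition weak_grad :: "'a::euclidean_space set \<Rightarrow> ('a \<Rightarrow> real) \<Rightarrow> 'a \<Rightarrow> 'a" where
  "weak_grad \<Omega> u = (SOME g. is_weak_gradient \<Omega> u g)"

definition H1 :: "'a::euclidean_space set \<Rightarrow> ('a \<Rightarrow> real) set" where
  "H1 \<Omega> = {u \<in> L2 \<Omega>. \<exists>g. is_weak_gradient \<Omega> u g}"

definition dirichlet_integral :: "'a::euclidean_space set \<Rightarrow> ('a \<Rightarrow> real) \<Rightarrow> real" where
  "dirichlet_integral \<Omega> u = (LINT x|lebesgue_on \<Omega>. (norm (weak_grad \<Omega> u x))\<^sup>2)"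

definition H1_norm :: "'a::euclidean_space set \<Rightarrow> ('a \<Rightarrow> real) \<Rightarrow> real" where
  "H1_norm \<Omega> u = sqrt ((LINT x|lebesgue_on \<Omega>. (u x)\<^sup>2) + dirichlet_integral \<Omega> u)"

text \<open>The closure of the test functions in \<open>H1\<close>.\<close>

definition H10 :: "'a::euclidean_space set \<Rightarrow> ('a \<Rightarrow> real) set" where
  "H10 \<Omega> = {u \<in> H1 \<Omega>. \<exists>\<phi>::nat \<Rightarrow> 'a \<Rightarrow> real. (\<forall>k. \<phi> k \<in> test_functions \<Omega>) \<and>
     (\<lambda>k. H1_norm \<Omega> (\<lambda>x. u x - \<phi> k x)) \<longlonglongrightarrow> 0}"

definition H10_norm :: "'a::euclidean_space set \<Rightarrow> ('a \<Rightarrow> real) \<Rightarrow> real" where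
  "H10_norm \<Omega> u = sqrt (dirichlet_integral \<Omega> u)"

definition H10_nonzero :: "'a::euclidean_space set \<Rightarrow> ('a \<Rightarrow> real) set" where
  "H10_nonzero \<Omega> = {u \<in> H10 \<Omega>. \<not> (AE x in lebesgue_on \<Omega>. u x = 0)}"

section \<open>Best Sobolev constant and first Dirichlet eigenvalue\<close>

definition two_star :: "nat \<Rightarrow> real" where
  "two_star N = 2 * real N / (real N - 2)"

definition sobolev_const :: "'a::euclidean_space set \<Rightarrow> real" where
  "sobolev_const \<Omega> = (INF u\<in>H10_nonzero \<Omega>. dirichlet_integral \<Omega> u /
     (LINT x|lebesgue_on \<Omega>. \<bar>u x\<bar> powr two_star DIM('a)) powr (2 / two_star DIM('a)))"

definition dirichlet_eigenvalue :: "'a::euclidean_space set \<Rightarrow> real \<Rightarrow> bool" where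
  "dirichlet_eigenvalue \<Omega> \<mu> \<longleftrightarrow> (\<exists>u\<in>H10_nonzero \<Omega>. \<forall>v\<in>H10 \<Omega>.
     (LINT x|lebesgue_on \<Omega>. weak_grad \<Omega> u x \<bullet> weak_grad \<Omega> v x)
     = \<mu> * (LINT x|lebesgue_on \<Omega>. u x * v x))"

definition first_dirichlet_eigenvalue :: "'a::euclidean_space set \<Rightarrow> real" where
  "first_dirichlet_eigenvalue \<Omega> = (LEAST \<mu>. dirichlet_eigenvalue \<Omega> \<mu>)"

section \<open>Continuously differentiable functionals and the Palais-Smale condition\<close>

definition H10_dual :: "'a::euclidean_space set \<Rightarrow> (('a \<Rightarrow> real) \<Rightarrow> real) set" where
  "H10_dual \<Omega> = {L.
     (\<forall>v\<in>H10 \<Omega>. \<forall>w\<in>H10 \<Omega>. L (\<lambda>x. v x + w x) = L v + L w) \<and>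
     (\<forall>r. \<forall>v\<in>H10 \<Omega>. L (\<lambda>x. r * v x) = r * L v) \<and>
     (\<exists>C. \<forall>v\<in>H10 \<Omega>. \<bar>L v\<bar> \<le> C * H10_norm \<Omega> v)}"

definition H10_dual_norm ::
    "'a::euclidean_space set \<Rightarrow> (('a \<Rightarrow> real) \<Rightarrow> real) \<Rightarrow> real" where
  "H10_dual_norm \<Omega> L = (SUP v\<in>{v \<in> H10 \<Omega>. H10_norm \<Omega> v \<le> 1}. \<bar>L v\<bar>)"

definition has_H10_derivative :: "'a::euclidean_space set \<Rightarrow> (('a \<Rightarrow> real) \<Rightarrow> real) \<Rightarrow>
    ('a \<Rightarrow> real) \<Rightarrow> (('a \<Rightarrow> real) \<Rightarrow> real) \<Rightarrow> bool" where
  "has_H10_derivative \<Omega> J u L \<longleftrightarrow> L \<in> H10_dual \<Omega> \<and>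
     (\<forall>\<epsilon>>0. \<exists>\<delta>>0. \<forall>v\<in>H10 \<Omega>. H10_norm \<Omega> v < \<delta> \<longrightarrow>
        \<bar>J (\<lambda>x. u x + v x) - J u - L v\<bar> \<le> \<epsilon> * H10_norm \<Omega> v)"

text \<open>The Frechet derivative is unique as a functional on \<open>H10 \<Omega>\<close>; only its values outside
  \<open>H10 \<Omega>\<close>, which are never used, depend on the choice.\<close>

definition H10_deriv :: "'a::euclidean_space set \<Rightarrow> (('a \<Rightarrow> real) \<Rightarrow> real) \<Rightarrow>
    ('a \<Rightarrow> real) \<Rightarrow> ('a \<Rightarrow> real) \<Rightarrow> real" where
  "H10_deriv \<Omega> J u = (SOME L. has_H10_derivative \<Omega> J u L)"

definition C1_functional ::
    "'a::euclidean_space set \<Rightarrow> (('a \<Rightarrow> real) \<Rightarrow> real) \<Rightarrow> bool" where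
  "C1_functional \<Omega> J \<longleftrightarrow>
     (\<forall>u\<in>H10 \<Omega>. \<exists>L. has_H10_derivative \<Omega> J u L) \<and>
     (\<forall>u\<in>H10 \<Omega>. \<forall>\<epsilon>>0. \<exists>\<delta>>0. \<forall>w\<in>H10 \<Omega>. H10_norm \<Omega> (\<lambda>x. w x - u x) < \<delta> \<longrightarrow>
        H10_dual_norm \<Omega> (\<lambda>v. H10_deriv \<Omega> J w v - H10_deriv \<Omega> J u v) < \<epsilon>)"

text \<open>The condition is a property of continuously differentiable functionals, so being one is
  part of it.\<close>

definition palais_smale ::
    "'a::euclidean_space set \<Rightarrow> (('a \<Rightarrow> real) \<Rightarrow> real) \<Rightarrow> real \<Rightarrow> bool" where
  "palais_smale \<Omega> J c \<longleftrightarrow> C1_functional \<Omega> J \<and>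
     (\<forall>u :: nat \<Rightarrow> 'a \<Rightarrow> real.
        (\<forall>j. u j \<in> H10 \<Omega>) \<and>
        (\<lambda>j. J (u j)) \<longlonglongrightarrow> c \<and>
        (\<lambda>j. H10_dual_norm \<Omega> (H10_deriv \<Omega> J (u j))) \<longlonglongrightarrow> 0 \<longrightarrow>
        (\<exists>r w. strict_mono (r :: nat \<Rightarrow> nat) \<and> w \<in> H10 \<Omega> \<and>
           (\<lambda>j. H10_norm \<Omega> (\<lambda>x. u (r j) x - w x)) \<longlonglongrightarrow> 0))"

definition kirchhoff_functional :: "'a::euclidean_space set \<Rightarrow> real \<Rightarrow> real \<Rightarrow> real \<Rightarrow> real \<Rightarrow>
    ('a \<Rightarrow> real) \<Rightarrow> real" where
  "kirchhoff_functional \<Omega> a b \<gamma> lam u =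
     a / 2 * dirichlet_integral \<Omega> u
     + b / (2 * \<gamma>) * dirichlet_integral \<Omega> u powr \<gamma>
     - lam / 2 * (LINT x|lebesgue_on \<Omega>. (u x)\<^sup>2)
     - 1 / two_star DIM('a) * (LINT x|lebesgue_on \<Omega>. \<bar>u x\<bar> powr two_star DIM('a))"

end

theory Submission
  imports Defs "HOL-Complex_Analysis.Great_Picard"
begin

text \<open>
  Write \<open>|u|\<close> for the norm of $H^1_0$ and \<open>|u|_q\<close> for that of $L^q$. Since \<open>lam \<le> a \<lambda>_1\<close>, the identity
  \<open>J(u) - J'(u)u / 2* = (a |u|^2 - lam |u|_2^2) / N + (1/(2 \<gamma>) - 1/2*) b |u|^(2 \<gamma>)\<close> bounds every
  Palais-Smale sequence. Along a subsequence \<open>u_j\<close> converges weakly to some \<open>w\<close>, strongly in $L^2$ and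
  almost everywhere, with \<open>|u_j|^2\<close> tending to \<open>t\<close> and \<open>|u_j - w|^2\<close> to \<open>s = t - |w|^2\<close>. Testing
  \<open>J'(u_j)\<close> with \<open>u_j - w\<close>, the Brezis--Lieb argument and the definition of \<open>S\<close> give
  \<open>(a + b t^(\<gamma> - 1)) s \<le> S^(-2*/2) s^(2*/2)\<close>. Hence \<open>s = 0\<close>, which is strong convergence, or
  \<open>s \<ge> t0\<close>, and then the identity yields \<open>c \<ge> c*\<close>.

  The Poincare, Sobolev and Rellich theorems all come from the estimate of \<open>v(x + h) - v(x)\<close> in $L^2$
  by \<open>|h|\<close> times the norm of the gradient: for Poincare \<open>h\<close> is larger than the diameter, for the other two
  one averages over \<open>h\<close> in a ball, in the case of Sobolev's inequality for dyadic truncations of \<open>v\<close>.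
  The space $H^1_0$ is identified, through a function and its weak gradient, with a closed subspace of
  a product of two $L^2$ spaces.
\<close>


section \<open>Weak sequential compactness in Hilbert spaces\<close>

text \<open>The embedding of $H^1_0$ into the space with the critical exponent is not compact, so
  part of the gradient energy may concentrate and be lost in the weak limit; \<open>s\<close> is the
  amount lost. The coefficient is nonlocal: along the sequence it tends to
  \<open>a + b t^(\<gamma> - 1)\<close>, not to its value at \<open>w\<close>, and this is why the
  differences \<open>u_j - w\<close> are tested. Since \<open>s \<le> t\<close>, the factor
  \<open>t^(\<gamma> - 1)\<close> may be lowered to \<open>s^(\<gamma> - 1)\<close>. As
  \<open>\<gamma> < 2*/2\<close>, the quotient of \<open>a + b s^(\<gamma> - 1)\<close> by
  \<open>s^(2*/2 - 1)\<close> is strictly decreasing, so \<open>t0\<close> is the least positive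
  amount that can be lost. In the limit of the energy identity, \<open>a t - lam |w|_2^2\<close>
  equals \<open>a s\<close> plus \<open>a |w|^2 - lam |w|_2^2\<close>, which is nonnegative, and
  \<open>t \<ge> s \<ge> t0\<close>. This is how c* arises. As \<open>lam = a \<lambda>_1\<close> is
  allowed, the quadratic part of the identity is only nonnegative and need not control the norm; the
  bound on the sequence comes from the power \<open>2 \<gamma>\<close>, which exceeds 2.\<close>

lemma tendsto_if_subseq_tendsto:
  fixes X :: "nat \<Rightarrow> 'b::topological_space"
  assumes "\<And>s::nat \<Rightarrow> nat. strict_mono s \<Longrightarrow> \<exists>t::nat \<Rightarrow> nat. strict_mono t \<and> (\<lambda>n. X (s (t n))) \<longlonglongrightarrow> L"
  shows "X \<longlonglongrightarrow> L"
proof (rule ccontr)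
  assume "\<not> X \<longlonglongrightarrow> L"
  then obtain S where S: "open S" "L \<in> S" "\<not> eventually (\<lambda>n. X n \<in> S) sequentially"
    unfolding tendsto_def by blast
  then have "infinite {n. X n \<notin> S}"
    by (simp add: cofinite_eq_sequentially[symmetric] eventually_cofinite)
  then obtain s :: "nat \<Rightarrow> nat" where s: "strict_mono s" "\<And>n. X (s n) \<notin> S"
    using infinite_enumerate by blast
  obtain t :: "nat \<Rightarrow> nat" where t: "strict_mono t" "(\<lambda>n. X (s (t n))) \<longlonglongrightarrow> L"
    using assms[OF s(1)] by blast
  then have "eventually (\<lambda>n. X (s (t n)) \<in> S) sequentially"
    using S unfolding tendsto_def by blast
  with s(2) show False by (simp add: eventually_False)
qed

text \<open>Elements of almost minimal norm in the hulls of the tails form a Cauchy sequence, by the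
  parallelogram law.\<close>

lemma bounded_tail_hulls:
  fixes x :: "nat \<Rightarrow> 'h::{real_inner,complete_space}"
  assumes bd: "\<And>n. norm (x n) \<le> B"
  obtains w where "\<And>n. w \<in> closure (convex hull (x ` {n..}))"
proof -
  define K where "K n = convex hull (x ` {n..})" for n
  define d where "d n = infdist 0 (K n)" for n
  have ne: "K n \<noteq> {}" for n unfolding K_def by auto
  have mono: "K m \<subseteq> K n" if "n \<le> m" for m n
    unfolding K_def using that by (intro hull_mono image_mono) auto
  have dmono: "d n \<le> d m" if "n \<le> m" for m n
    unfolding d_def using infdist_mono[OF mono[OF that] ne] .
  have dB: "d n \<le> B" for n
  proof -
    have "x n \<in> K n" unfolding K_def by (intro hull_inc) auto
    then have "d n \<le> dist 0 (x n)" unfolding d_def by (rule infdist_le)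
    with bd[of n] show ?thesis by simp
  qed
  have d0: "d n \<ge> 0" for n unfolding d_def by (rule infdist_nonneg)
  obtain D where D: "d \<longlonglongrightarrow> D" "\<And>n. d n \<le> D"
    using incseq_convergent[of d B] dmono dB by (auto simp: incseq_def)
  have "\<exists>w\<in>K n. norm w < d n + 1 / (real n + 1)" for n
  proof (rule ccontr)
    assume "\<not> ?thesis"
    then have "d n + 1 / (real n + 1) \<le> (INF a\<in>K n. dist 0 a)"
      using ne by (intro cINF_greatest) (auto simp: not_less)
    then show False using infdist_notempty[OF ne, of 0 n] unfolding d_def by (simp add: field_simps)
  qed
  then obtain w where w: "\<And>n. w n \<in> K n" "\<And>n. norm (w n) < d n + 1 / (real n + 1)" by metis
  \<comment> \<open>Midpoints of \<open>w m\<close> and \<open>w n\<close> lie in \<open>K n\<close>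
    and have norm at least \<open>d n\<close>, while both vectors have norm at most
    \<open>D + 1 / (n + 1)\<close>. This is what the parallelogram law then leaves for the squared
    distance; it tends to \<open>4 D^2 - 4 D^2\<close>.\<close>
  define e where "e n = 4 * (D + 1 / (real n + 1))\<^sup>2 - 4 * (d n)\<^sup>2" for n
  have key: "(norm (w m - w n))\<^sup>2 \<le> e n" if "n \<le> m" for m n
  proof -
    have "(1/2) *\<^sub>R w m + (1/2) *\<^sub>R w n \<in> K n"
      using w(1)[of n] subsetD[OF mono[OF that] w(1)[of m]] convexD[OF convex_convex_hull, of "w m" "x `
          {n..}" "w n" "1/2" "1/2"]
      unfolding K_def by auto
    then have "d n \<le> dist 0 ((1/2) *\<^sub>R w m + (1/2) *\<^sub>R w n)" unfolding d_def by (rule infdist_le)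
    also have "\<dots> = norm ((1/2) *\<^sub>R (w m + w n))" by (simp add: scaleR_add_right)
    also have "\<dots> = norm (w m + w n) / 2" by simp
    finally have 1: "(2 * d n)\<^sup>2 \<le> (norm (w m + w n))\<^sup>2"
      using d0[of n] by (intro power_mono) auto
    have b: "norm (w n) \<le> D + 1 / (real n + 1)" using w(2)[of n] D(2)[of n] by linarith
    have "norm (w m) \<le> D + 1 / (real m + 1)" using w(2)[of m] D(2)[of m] by linarith
    also have "\<dots> \<le> D + 1 / (real n + 1)" using that by (intro add_left_mono frac_le) auto
    finally have "norm (w m) \<le> D + 1 / (real n + 1)" .
    with b have "(norm (w m))\<^sup>2 \<le> (D + 1 / (real n + 1))\<^sup>2" "(norm (w n))\<^sup>2 \<le> (D + 1 / (real n + 1))\<^sup>2"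
      by (intro power_mono; simp)+
    moreover have "(norm (w m - w n))\<^sup>2 = 2 * (norm (w m))\<^sup>2 + 2 * (norm (w n))\<^sup>2 - (norm (w m + w n))\<^sup>2"
      by (simp add: power2_norm_eq_inner inner_diff inner_add inner_commute algebra_simps)
    ultimately show ?thesis using 1 unfolding e_def by (simp add: power_mult_distrib)
  qed
  have "e \<longlonglongrightarrow> 4 * (D + 0)\<^sup>2 - 4 * D\<^sup>2"
    unfolding e_def
    by (intro tendsto_intros D lim_1_over_n) (use LIMSEQ_inverse_real_of_nat in \<open>simp add: inverse_eq_divide
        add.commute\<close>)
  then have e0: "e \<longlonglongrightarrow> 0" by simp
  have "Cauchy w"
  proof (rule metric_CauchyI)
    fix \<epsilon> :: real assume "\<epsilon> > 0"
    then have "eventually (\<lambda>n. e n < (\<epsilon>/2)\<^sup>2) sequentially" using e0 order_tendstoD(2) by fastforce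
    then obtain M where M: "e M < (\<epsilon>/2)\<^sup>2" by (auto simp: eventually_sequentially)
    have "dist (w m) (w M) < \<epsilon>/2" if "m \<ge> M" for m
    proof -
      have "(norm (w m - w M))\<^sup>2 < (\<epsilon>/2)\<^sup>2" using key[OF that] M by linarith
      then have "norm (w m - w M) < \<epsilon>/2"
        by (rule power2_less_imp_less) (use \<open>\<epsilon> > 0\<close> in simp)
      then show ?thesis by (simp add: dist_norm)
    qed
    then have "\<forall>m\<ge>M. \<forall>n\<ge>M. dist (w m) (w n) < \<epsilon>"
      using dist_triangle_half_l by blast
    then show "\<exists>M. \<forall>m\<ge>M. \<forall>n\<ge>M. dist (w m) (w n) < \<epsilon>" ..
  qed
  then obtain v where v: "w \<longlonglongrightarrow> v" using Cauchy_convergent convergent_def by blast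
  have "v \<in> closure (K n)" for n
  proof (rule closed_sequentially)
    show "closed (closure (K n))" by simp
    show "(\<lambda>k. w (k + n)) \<longlonglongrightarrow> v" using v by (rule LIMSEQ_ignore_initial_segment)
    show "\<And>k. w (k + n) \<in> closure (K n)" using w(1) mono closure_subset by (meson le_add2 subsetD)
  qed
  then show thesis using that unfolding K_def by blast
qed

text \<open>A tail of the sequence lies in the slab of all \<open>y\<close> with
  \<open>y \<bullet> v\<close> within \<epsilon> of \<open>l\<close>. The slab is closed and convex,
  so it contains the closed hull of that tail.\<close>

lemma inner_tail_hull_eq_limit:
  fixes z :: "nat \<Rightarrow> 'h::real_inner"
  assumes w: "\<And>n. w \<in> closure (convex hull (z ` {n..}))" and l: "(\<lambda>n. z n \<bullet> v) \<longlonglongrightarrow> l"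
  shows "w \<bullet> v = l"
proof -
  have "\<bar>w \<bullet> v - l\<bar> \<le> \<epsilon>" if "\<epsilon> > 0" for \<epsilon>
  proof -
    let ?C = "{y. v \<bullet> y \<le> l + \<epsilon>} \<inter> {y. v \<bullet> y \<ge> l - \<epsilon>}"
    have "eventually (\<lambda>n. \<bar>z n \<bullet> v - l\<bar> < \<epsilon>) sequentially"
      using l that by (simp add: tendsto_iff dist_real_def)
    then obtain M where "\<And>n. n \<ge> M \<Longrightarrow> \<bar>z n \<bullet> v - l\<bar> < \<epsilon>" by (auto simp: eventually_sequentially)
    then have "z ` {M..} \<subseteq> ?C" by (force simp: inner_commute abs_less_iff)
    then have "closure (convex hull (z ` {M..})) \<subseteq> ?C"
      by (intro closure_minimal hull_minimal closed_Int closed_halfspace_le closed_halfspace_ge convex_Int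
          convex_halfspace_le convex_halfspace_ge)
    with w[of M] show ?thesis by (auto simp: inner_commute abs_le_iff)
  qed
  then have "\<bar>w \<bullet> v - l\<bar> \<le> 0" using field_le_epsilon[of "\<bar>w \<bullet> v - l\<bar>" 0] by fastforce
  then show ?thesis by simp
qed

text \<open>A diagonal sequence converges against every \<open>x k\<close>. Separability is not needed to reach all other
  vectors: the weak limits of two subsequences lie in the closed span of the \<open>x k\<close> and their
  difference is orthogonal to it.\<close>

theorem weakly_convergent_subsequence:
  fixes x :: "nat \<Rightarrow> 'h::{real_inner,complete_space}"
  assumes bd: "\<And>n. norm (x n) \<le> B"
  obtains r w where "strict_mono (r::nat \<Rightarrow> nat)" "w \<in> closure (convex hull (range x))"
    "\<And>v. (\<lambda>n. x (r n) \<bullet> v) \<longlonglongrightarrow> w \<bullet> v"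
proof -
  have ib: "\<bar>x n \<bullet> v\<bar> \<le> B * norm v" for n v
    by (rule order_trans[OF Cauchy_Schwarz_ineq2 mult_right_mono[OF bd]]) simp
  have B0: "0 \<le> B" using bd[of 0] norm_ge_zero order_trans by blast
  have ibx: "norm (x n \<bullet> x k) \<le> B * B" for n k
    using ib[of n "x k"] mult_left_mono[OF bd[of k] B0] by simp
  \<comment> \<open>The diagonal argument: the uniformly bounded functions
    \<open>k \<mapsto> x n \<bullet> x k\<close> on the countable set of indices converge pointwise
    along a subsequence.\<close>
  obtain r where r: "strict_mono (r::nat \<Rightarrow> nat)" "\<And>k. \<exists>l. (\<lambda>n. x (r n) \<bullet> x k) \<longlonglongrightarrow> l"
    using function_convergent_subsequence[of UNIV "\<lambda>n k. x n \<bullet> x k" "B * B"] ibx by auto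
  obtain w where w: "\<And>n. w \<in> closure (convex hull ((\<lambda>n. x (r n)) ` {n..}))"
    using bounded_tail_hulls[of "\<lambda>n. x (r n)" B] bd by blast
  have sub: "closure (convex hull (A::'h set)) \<subseteq> closure (convex hull (range x))" if "A \<subseteq> range x" for A
    using that by (intro closure_mono hull_mono)
  have wr: "w \<in> closure (convex hull (range x))" using w[of 0] by (rule subsetD[OF sub, rotated]) auto
  \<comment> \<open>Any subsequence has a further one along which the products with \<open>v\<close>
    converge, and the limit is the product with a common point \<open>w'\<close> of its tail hulls;
    it remains to see that \<open>w' = w\<close>.\<close>
  have lim: "(\<lambda>n. x (r n) \<bullet> v) \<longlonglongrightarrow> w \<bullet> v" for v
  proof (rule tendsto_if_subseq_tendsto)
    fix s :: "nat \<Rightarrow> nat" assume s: "strict_mono s"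
    have "bounded (range (\<lambda>n. x (r (s n)) \<bullet> v))" using ib by (auto simp: bounded_iff)
    then obtain l t where t: "strict_mono (t::nat\<Rightarrow>nat)" "((\<lambda>n. x (r (s n)) \<bullet> v) \<circ> t) \<longlonglongrightarrow> l"
      using bounded_imp_convergent_subsequence by metis
    define y where "y n = x (r (s (t n)))" for n
    obtain w' where w': "\<And>n. w' \<in> closure (convex hull (y ` {n..}))"
      using bounded_tail_hulls[of y B] bd unfolding y_def by blast
    have wr': "w' \<in> closure (convex hull (range x))"
      using w'[of 0] by (rule subsetD[OF sub, rotated]) (auto simp: y_def)
    have "(w - w') \<bullet> x k = 0" for k
    proof -
      obtain m where m: "(\<lambda>n. x (r n) \<bullet> x k) \<longlonglongrightarrow> m" using r by blast
      have "(\<lambda>n. y n \<bullet> x k) \<longlonglongrightarrow> m"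
        using LIMSEQ_subseq_LIMSEQ[OF m strict_mono_o[OF s t(1)]] by (simp add: o_def y_def)
      then have "w' \<bullet> x k = m" using inner_tail_hull_eq_limit[OF w'] by blast
      moreover have "w \<bullet> x k = m" using inner_tail_hull_eq_limit[OF w m] .
      ultimately show ?thesis by (simp add: inner_diff_left)
    qed
    then have "closure (convex hull (range x)) \<subseteq> {v. (w - w') \<bullet> v = 0}"
      by (intro closure_minimal hull_minimal closed_hyperplane convex_hyperplane) auto
    then have "(w - w') \<bullet> w = 0" "(w - w') \<bullet> w' = 0" using wr wr' by auto
    then have "(w - w') \<bullet> (w - w') = 0" by (simp only: inner_diff_right[of "w - w'" w w'])
    then have "w = w'" by simp
    moreover have "w' \<bullet> v = l" using inner_tail_hull_eq_limit[OF w', of v l] t(2) by (simp add: o_def y_def)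
    ultimately show "\<exists>t::nat\<Rightarrow>nat. strict_mono t \<and> (\<lambda>n. x (r (s (t n))) \<bullet> v) \<longlonglongrightarrow> w \<bullet> v"
      using t by (auto simp: o_def)
  qed
  show thesis using that[OF r(1) wr lim] .
qed


section \<open>The Hilbert space of square integrable functions\<close>

text \<open>Fatou's lemma in the form that also yields integrability of the limit. It serves where
  only a bound on the integrals is known: for the completeness of the Hilbert space and for
  Sobolev's inequality beyond test functions.\<close>

lemma integrable_fatou:
  fixes f :: "nat \<Rightarrow> 'x \<Rightarrow> real"
  assumes f: "\<And>n. integrable M (f n)" and nn: "\<And>n x. 0 \<le> f n x"
    and lim: "AE x in M. (\<lambda>n. f n x) \<longlonglongrightarrow> F x" and F[measurable]: "F \<in> borel_measurable M"
    and C: "\<And>n. (LINT x|M. f n x) \<le> C"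
  shows "integrable M F" "(LINT x|M. F x) \<le> C"
proof -
  have [measurable]: "f n \<in> borel_measurable M" for n using f by auto
  have C0: "0 \<le> C" by (rule order_trans[OF Bochner_Integration.integral_nonneg C[of 0]]) (rule nn)
  have F0: "AE x in M. 0 \<le> F x"
    using lim by eventually_elim (blast intro: LIMSEQ_le_const nn)
  have "(\<integral>\<^sup>+x. ennreal (F x) \<partial>M) = (\<integral>\<^sup>+x. liminf (\<lambda>n. ennreal (f n x)) \<partial>M)"
    by (rule nn_integral_cong_AE, use lim in eventually_elim)
      (rule lim_imp_Liminf[symmetric], auto intro: tendsto_ennrealI)
  also have "\<dots> \<le> liminf (\<lambda>n. \<integral>\<^sup>+x. ennreal (f n x) \<partial>M)"
    by (rule nn_integral_liminf) simp
  also have "\<dots> \<le> ennreal C"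
  proof (rule order_trans[OF Liminf_le_Limsup Limsup_bounded])
    show "\<forall>\<^sub>F n in sequentially. (\<integral>\<^sup>+x. ennreal (f n x) \<partial>M) \<le> ennreal C"
      using C f nn by (intro always_eventually allI) (simp add: nn_integral_eq_integral ennreal_leI)
  qed simp
  finally have le: "(\<integral>\<^sup>+x. ennreal (F x) \<partial>M) \<le> ennreal C" .
  show "integrable M F"
    using le F0 by (intro integrableI_nonneg) (auto simp: order.strict_trans1)
  show "(LINT x|M. F x) \<le> C" using C0 le by (rule integral_real_bounded)
qed

definition l2_fun :: "('a::euclidean_space \<Rightarrow> 'b::euclidean_space) set" where
  "l2_fun = {f \<in> borel_measurable lebesgue. integrable lebesgue (\<lambda>x. (norm (f x))\<^sup>2)}"

lemma l2_fun_measurable [measurable_dest]: "f \<in> l2_fun \<Longrightarrow> f \<in> borel_measurable lebesgue"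
  by (simp add: l2_fun_def)

lemma l2_fun_integrable: "f \<in> l2_fun \<Longrightarrow> integrable lebesgue (\<lambda>x. (norm (f x))\<^sup>2)"
  by (simp add: l2_fun_def)

lemma l2_fun_zero: "(\<lambda>x. 0) \<in> l2_fun" by (simp add: l2_fun_def)

lemma l2_fun_bound:
  assumes "integrable lebesgue h" "f \<in> borel_measurable lebesgue" "\<And>x. (norm (f x))\<^sup>2 \<le> h x"
  shows "f \<in> l2_fun"
proof -
  have "norm ((norm (f x))\<^sup>2) \<le> norm (h x)" for x
    using assms(3)[of x] zero_le_power2[of "norm (f x)"] by simp
  then have "integrable lebesgue (\<lambda>x. (norm (f x))\<^sup>2)"
    using assms(1,2) by (intro Bochner_Integration.integrable_bound[OF assms(1)]) auto
  with assms(2) show ?thesis by (simp add: l2_fun_def)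
qed

lemma l2_fun_scaleR: "f \<in> l2_fun \<Longrightarrow> (\<lambda>x. c *\<^sub>R f x) \<in> l2_fun"
  by (auto simp: l2_fun_def power_mult_distrib)

lemma power2_norm_add_le:
  fixes a b :: "'b::real_inner"
  shows "(norm (a + b))\<^sup>2 \<le> 2 * (norm a)\<^sup>2 + 2 * (norm b)\<^sup>2"
proof -
  have "0 \<le> (norm (a - b))\<^sup>2" by simp
  then show ?thesis by (simp add: power2_norm_eq_inner inner_diff_left inner_diff_right inner_add_left
      inner_add_right inner_commute)
qed

lemma l2_fun_add:
  assumes "f \<in> l2_fun" "g \<in> l2_fun"
  shows "(\<lambda>x. f x + g x) \<in> l2_fun"
proof (rule l2_fun_bound)
  show "integrable lebesgue (\<lambda>x. 2 * (norm (f x))\<^sup>2 + 2 * (norm (g x))\<^sup>2)"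
    using assms by (auto simp: l2_fun_def)
  show "(\<lambda>x. f x + g x) \<in> borel_measurable lebesgue" using assms by (auto simp: l2_fun_def)
qed (rule power2_norm_add_le)

lemma l2_fun_uminus: "f \<in> l2_fun \<Longrightarrow> (\<lambda>x. - f x) \<in> l2_fun"
  using l2_fun_scaleR[of f "-1"] by simp

lemma l2_fun_diff: "f \<in> l2_fun \<Longrightarrow> g \<in> l2_fun \<Longrightarrow> (\<lambda>x. f x - g x) \<in> l2_fun"
  using l2_fun_add[OF _ l2_fun_uminus, of f g] by simp

lemma l2_fun_inner_integrable:
  assumes "f \<in> l2_fun" "g \<in> l2_fun"
  shows "integrable lebesgue (\<lambda>x. f x \<bullet> g x)"
proof (rule Bochner_Integration.integrable_bound)
  show "integrable lebesgue (\<lambda>x. (norm (f x))\<^sup>2 + (norm (g x))\<^sup>2)"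
    using assms by (auto simp: l2_fun_def)
  show "(\<lambda>x. f x \<bullet> g x) \<in> borel_measurable lebesgue"
    using assms by (auto simp: l2_fun_def)
  have "norm (f x \<bullet> g x) \<le> norm ((norm (f x))\<^sup>2 + (norm (g x))\<^sup>2)" for x
  proof -
    have "\<bar>f x \<bullet> g x\<bar> \<le> norm (f x) * norm (g x)" by (rule Cauchy_Schwarz_ineq2)
    moreover have "2 * (norm (f x) * norm (g x)) \<le> (norm (f x))\<^sup>2 + (norm (g x))\<^sup>2"
      using sum_squares_bound[of "norm (f x)" "norm (g x)"] by simp
    moreover have "0 \<le> norm (f x) * norm (g x)" by simp
    ultimately show ?thesis by simp
  qed
  then show "AE x in lebesgue. norm (f x \<bullet> g x) \<le> norm ((norm (f x))\<^sup>2 + (norm (g x))\<^sup>2)" by simp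
qed

definition l2_rel :: "('a::euclidean_space \<Rightarrow> 'b::euclidean_space) \<Rightarrow> ('a \<Rightarrow> 'b) \<Rightarrow> bool" where
  "l2_rel f g \<longleftrightarrow> f \<in> l2_fun \<and> g \<in> l2_fun \<and> (AE x in lebesgue. f x = g x)"

\<comment> \<open>A type cannot depend on the domain \<Omega>, so the Hilbert space consists of
  functions on the whole space, and those on \<Omega> enter it through extension by zero. The range
  is a parameter because both functions and gradients are needed.\<close>
quotient_type (overloaded) ('a, 'b) l2 = "'a::euclidean_space \<Rightarrow> 'b::euclidean_space" / partial: l2_rel
proof (rule part_equivpI)
  show "\<exists>x::'a\<Rightarrow>'b. l2_rel x x" using l2_fun_zero by (intro exI[of _ "\<lambda>x. 0"]) (simp add: l2_rel_def)
  show "symp (l2_rel :: ('a\<Rightarrow>'b) \<Rightarrow> _)" by (rule sympI) (auto simp: l2_rel_def)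
  show "transp (l2_rel :: ('a\<Rightarrow>'b) \<Rightarrow> _)"
    by (rule transpI) (auto simp: l2_rel_def elim: AE_mp)
qed

lemma l2_rel_refl: "l2_rel f f \<longleftrightarrow> f \<in> l2_fun" by (simp add: l2_rel_def)

instantiation l2 :: (euclidean_space, euclidean_space) real_vector
begin

lift_definition zero_l2 :: "('a, 'b) l2" is "\<lambda>_. 0" by (simp add: l2_rel_def l2_fun_zero)

lift_definition plus_l2 :: "('a, 'b) l2 \<Rightarrow> ('a, 'b) l2 \<Rightarrow> ('a, 'b) l2" is "\<lambda>f g x. f x + g x"
  by (auto simp: l2_rel_def l2_fun_add)

lift_definition minus_l2 :: "('a, 'b) l2 \<Rightarrow> ('a, 'b) l2 \<Rightarrow> ('a, 'b) l2" is "\<lambda>f g x. f x - g x"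
  by (auto simp: l2_rel_def l2_fun_diff)

lift_definition uminus_l2 :: "('a, 'b) l2 \<Rightarrow> ('a, 'b) l2" is "\<lambda>f x. - f x"
  by (auto simp: l2_rel_def l2_fun_uminus)

lift_definition scaleR_l2 :: "real \<Rightarrow> ('a, 'b) l2 \<Rightarrow> ('a, 'b) l2" is "\<lambda>c f x. c *\<^sub>R f x"
  by (auto simp: l2_rel_def l2_fun_scaleR)

lemma l2_rep: obtains f where "f \<in> l2_fun" "x = abs_l2 f"
proof -
  have "l2_rel (rep_l2 x) (rep_l2 x)" by (rule Quotient_rep_reflp[OF Quotient_l2])
  moreover have "x = abs_l2 (rep_l2 x)" by (rule Quotient_abs_rep[OF Quotient_l2, symmetric])
  ultimately show thesis using that by (auto simp: l2_rel_refl)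
qed

lemma abs_l2_eq_iff:
  assumes "f \<in> l2_fun" "g \<in> l2_fun"
  shows "abs_l2 f = abs_l2 g \<longleftrightarrow> (AE x in lebesgue. f x = g x)"
  using Quotient_rel[OF Quotient_l2, of f g] assms by (auto simp: l2_rel_def)

lemma plus_abs_l2:
  "f \<in> l2_fun \<Longrightarrow> g \<in> l2_fun \<Longrightarrow> abs_l2 f + abs_l2 g = abs_l2 (\<lambda>x. f x + g x)"
  by (intro plus_l2.abs_eq) (simp_all add: l2_rel_refl)

lemma minus_abs_l2:
  "f \<in> l2_fun \<Longrightarrow> g \<in> l2_fun \<Longrightarrow> abs_l2 f - abs_l2 g = abs_l2 (\<lambda>x. f x - g x)"
  by (intro minus_l2.abs_eq) (simp_all add: l2_rel_refl)

lemma uminus_abs_l2: "f \<in> l2_fun \<Longrightarrow> - abs_l2 f = abs_l2 (\<lambda>x. - f x)"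
  by (intro uminus_l2.abs_eq) (simp_all add: l2_rel_refl)

lemma scaleR_abs_l2: "f \<in> l2_fun \<Longrightarrow> c *\<^sub>R abs_l2 f = abs_l2 (\<lambda>x. c *\<^sub>R f x)"
  by (intro scaleR_l2.abs_eq) (simp_all add: l2_rel_refl)

lemmas abs_l2_simps = plus_abs_l2 minus_abs_l2 uminus_abs_l2 scaleR_abs_l2 zero_l2_def
  l2_fun_add l2_fun_diff l2_fun_uminus l2_fun_scaleR l2_fun_zero

instance
proof
  fix x y z :: "('a, 'b) l2" and r s :: real
  obtain f where f: "f \<in> l2_fun" "x = abs_l2 f" by (rule l2_rep)
  obtain g where g: "g \<in> l2_fun" "y = abs_l2 g" by (rule l2_rep)
  obtain h where h: "h \<in> l2_fun" "z = abs_l2 h" by (rule l2_rep)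
  show "x + y + z = x + (y + z)" by (simp add: f g h abs_l2_simps add.assoc)
  show "x + y = y + x" by (simp add: f g abs_l2_simps add.commute)
  show "0 + x = x" by (simp add: f abs_l2_simps)
  show "- x + x = 0" by (simp add: f abs_l2_simps)
  show "x - y = x + - y" by (simp add: f g abs_l2_simps)
  show "r *\<^sub>R (x + y) = r *\<^sub>R x + r *\<^sub>R y" by (simp add: f g abs_l2_simps scaleR_add_right)
  show "(r + s) *\<^sub>R x = r *\<^sub>R x + s *\<^sub>R x" by (simp add: f g abs_l2_simps scaleR_add_left)
  show "r *\<^sub>R s *\<^sub>R x = (r * s) *\<^sub>R x" by (simp add: f g abs_l2_simps)
  show "1 *\<^sub>R x = x" by (simp add: f abs_l2_simps)
qed

end

instantiation l2 :: (euclidean_space, euclidean_space) real_inner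
begin

lift_definition inner_l2 :: "('a, 'b) l2 \<Rightarrow> ('a, 'b) l2 \<Rightarrow> real" is "\<lambda>f g. LINT x|lebesgue. f x \<bullet> g x"
  unfolding l2_rel_def by (intro integral_cong_AE) (auto simp: l2_fun_def)

definition norm_l2 :: "('a, 'b) l2 \<Rightarrow> real" where "norm_l2 x = sqrt (inner x x)"
definition dist_l2 :: "('a, 'b) l2 \<Rightarrow> ('a, 'b) l2 \<Rightarrow> real" where "dist_l2 x y = norm (x - y)"
definition sgn_l2 :: "('a, 'b) l2 \<Rightarrow> ('a, 'b) l2" where "sgn_l2 x = x /\<^sub>R norm x"
definition uniformity_l2 :: "(('a, 'b) l2 \<times> ('a, 'b) l2) filter" where
  "uniformity_l2 = (INF e\<in>{0<..}. principal {(x, y). dist x y < e})"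
definition open_l2 :: "('a, 'b) l2 set \<Rightarrow> bool" where
  "open_l2 S \<longleftrightarrow> (\<forall>x\<in>S. \<forall>\<^sub>F (x', y) in uniformity. x' = x \<longrightarrow> y \<in> S)"

lemma inner_abs_l2:
  "f \<in> l2_fun \<Longrightarrow> g \<in> l2_fun \<Longrightarrow> inner (abs_l2 f) (abs_l2 g) = (LINT x|lebesgue. f x \<bullet> g x)"
  by (intro inner_l2.abs_eq) (simp_all add: l2_rel_refl)

instance
proof
  fix x y z :: "('a, 'b) l2" and r s :: real and S :: "('a, 'b) l2 set"
  obtain f where f: "f \<in> l2_fun" "x = abs_l2 f" by (rule l2_rep)
  obtain g where g: "g \<in> l2_fun" "y = abs_l2 g" by (rule l2_rep)
  obtain h where h: "h \<in> l2_fun" "z = abs_l2 h" by (rule l2_rep)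
  show "dist x y = norm (x - y)" by (simp add: dist_l2_def)
  show "sgn x = x /\<^sub>R norm x" by (simp add: sgn_l2_def)
  show "uniformity = (INF e\<in>{0<..}. principal {(x::('a, 'b) l2, y). dist x y < e})"
    by (simp add: uniformity_l2_def)
  show "open S \<longleftrightarrow> (\<forall>x\<in>S. \<forall>\<^sub>F (x', y) in uniformity. x' = x \<longrightarrow> y \<in> S)"
    by (simp add: open_l2_def)
  show "inner x y = inner y x" by (simp add: f g inner_abs_l2 abs_l2_simps inner_commute)
  show "inner (x + y) z = inner x z + inner y z"
    by (simp add: f g h inner_abs_l2 abs_l2_simps inner_add_left l2_fun_inner_integrable)
  show "inner (r *\<^sub>R x) y = r * inner x y" by (simp add: f g inner_abs_l2 abs_l2_simps)
  show "0 \<le> inner x x" by (simp add: f inner_abs_l2 abs_l2_simps)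
  show "inner x x = 0 \<longleftrightarrow> x = 0"
    using integral_nonneg_eq_0_iff_AE[OF l2_fun_inner_integrable[OF f(1) f(1)]]
    by (simp add: f inner_abs_l2 abs_l2_simps abs_l2_eq_iff)
  show "norm x = sqrt (inner x x)" by (simp add: norm_l2_def)
qed

end

lemma norm_abs_l2: "f \<in> l2_fun \<Longrightarrow> (norm (abs_l2 f))\<^sup>2 = (LINT x|lebesgue. (norm (f x))\<^sup>2)"
  by (simp add: power2_norm_eq_inner inner_abs_l2)

lemma abs_l2_tendsto_AE_subseq:
  assumes f: "\<And>n. f n \<in> l2_fun" and g: "g \<in> l2_fun" and lim: "(\<lambda>n. abs_l2 (f n)) \<longlonglongrightarrow> abs_l2 g"
  obtains r where "strict_mono (r::nat\<Rightarrow>nat)" "AE x in lebesgue. (\<lambda>n. f (r n) x) \<longlonglongrightarrow> g x"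
proof -
  have "(\<lambda>n. (norm (abs_l2 (f n) - abs_l2 g))\<^sup>2) \<longlonglongrightarrow> 0\<^sup>2"
    using lim by (intro tendsto_power) (metis LIM_zero tendsto_norm_zero)
  then have *: "(\<lambda>n. LINT x|lebesgue. norm ((norm (f n x - g x))\<^sup>2)) \<longlonglongrightarrow> 0"
    by (simp add: f g minus_abs_l2 norm_abs_l2 l2_fun_diff)
  obtain r where r: "strict_mono (r::nat\<Rightarrow>nat)" "AE x in lebesgue. (\<lambda>n. (norm (f (r n) x - g x))\<^sup>2) \<longlonglongrightarrow> 0"
    using tendsto_L1_AE_subseq[OF _ *] l2_fun_integrable[OF l2_fun_diff[OF f g]] by blast
  have "AE x in lebesgue. (\<lambda>n. f (r n) x) \<longlonglongrightarrow> g x"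
    using r(2)
  proof eventually_elim
    case (elim x)
    then have "(\<lambda>n. sqrt ((norm (f (r n) x - g x))\<^sup>2)) \<longlonglongrightarrow> sqrt 0" by (rule tendsto_real_sqrt)
    then show ?case by (simp add: tendsto_norm_zero_iff LIM_zero_iff)
  qed
  with r that show thesis by blast
qed

text \<open>Squares are summed because the differences themselves need not be integrable. The
  integral of \<open>d n\<close> is at most \<open>4^(-n)\<close>, so the sum of
  \<open>2^n * d n\<close> is integrable and hence finite almost everywhere; there the increments
  decay like \<open>2^(-n/2)\<close>, which is summable.\<close>

lemma geometric_l2_Cauchy_AE_convergent:
  fixes f :: "nat \<Rightarrow> 'a::euclidean_space \<Rightarrow> 'b::euclidean_space"
  assumes f: "\<And>n. f n \<in> l2_fun"
    and cau: "\<And>n. norm (abs_l2 (f (Suc n)) - abs_l2 (f n)) \<le> (1/2)^n"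
  shows "AE x in lebesgue. convergent (\<lambda>n. f n x)"
proof -
  define d where "d n x = (norm (f (Suc n) x - f n x))\<^sup>2" for n x
  have [measurable]: "f n \<in> borel_measurable lebesgue" for n using f by (auto simp: l2_fun_def)
  have di: "integrable lebesgue (d n)" for n
    unfolding d_def by (intro l2_fun_integrable l2_fun_diff f)
  have d0: "0 \<le> d n x" for n x by (simp add: d_def)
  have dm[measurable]: "d n \<in> borel_measurable lebesgue" for n using di by auto
  have dI: "(LINT x|lebesgue. d n x) \<le> (1/4)^n" for n
  proof -
    have "(LINT x|lebesgue. d n x) = (norm (abs_l2 (f (Suc n)) - abs_l2 (f n)))\<^sup>2"
      by (simp add: d_def minus_abs_l2 f norm_abs_l2 l2_fun_diff)
    also have "\<dots> \<le> ((1/2)^n)\<^sup>2" using cau by (intro power_mono) auto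
    also have "\<dots> = (1/4::real)^n" by (simp add: power2_eq_square power_mult_distrib[symmetric])
    finally show ?thesis .
  qed
  have "(\<integral>\<^sup>+x. (\<Sum>n. ennreal (2^n * d n x)) \<partial>lebesgue) = (\<Sum>n. \<integral>\<^sup>+x. ennreal (2^n * d n x) \<partial>lebesgue)"
    by (rule nn_integral_suminf) simp
  also have "\<dots> = (\<Sum>n. ennreal (2^n * (LINT x|lebesgue. d n x)))"
    using di by (simp add: nn_integral_eq_integral d0)
  also have "\<dots> \<le> (\<Sum>n. ennreal ((1/2)^n))"
  proof (rule suminf_le[OF ennreal_leI])
    fix n
    have "2^n * (LINT x|lebesgue. d n x) \<le> 2^n * (1/4)^n" using dI by (intro mult_left_mono) auto
    also have "\<dots> = (1/2::real)^n" by (simp add: power_mult_distrib[symmetric])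
    finally show "2^n * (LINT x|lebesgue. d n x) \<le> (1/2)^n" .
  qed simp_all
  also have "\<dots> = ennreal (\<Sum>n. (1/2)^n)" by (intro suminf_ennreal2) (auto simp: summable_geometric)
  finally have "(\<integral>\<^sup>+x. (\<Sum>n. ennreal (2^n * d n x)) \<partial>lebesgue) \<noteq> \<infinity>" by (auto simp: top_unique)
  then have "AE x in lebesgue. (\<Sum>n. ennreal (2^n * d n x)) \<noteq> \<infinity>"
    by (intro nn_integral_PInf_AE) auto
  then show ?thesis
  proof eventually_elim
    case (elim x)
    have s: "summable (\<lambda>n. 2^n * d n x)"
      by (rule summable_suminf_not_top) (use elim d0 in auto)
    then have "bounded (range (\<lambda>n. 2^n * d n x))"
      using summable_LIMSEQ_zero convergent_imp_bounded by blast
    then obtain C where C: "\<And>n. 2^n * d n x \<le> C" unfolding bounded_iff by (auto simp: abs_le_iff)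
    have "norm (f (Suc n) x - f n x) \<le> sqrt C * (1 / sqrt 2)^n" for n
    proof -
      have "d n x \<le> C * (1/2)^n" using C[of n] by (simp add: field_simps)
      then have "sqrt (d n x) \<le> sqrt (C * (1/2)^n)" by simp
      also have "\<dots> = sqrt C * (1 / sqrt 2)^n" by (simp add: real_sqrt_mult real_sqrt_power real_sqrt_divide)
      finally show ?thesis by (simp add: d_def)
    qed
    moreover have "summable (\<lambda>n. sqrt C * (1 / sqrt 2)^n)"
      by (intro summable_mult summable_geometric) auto
    ultimately have "summable (\<lambda>n. f (Suc n) x - f n x)"
        by (rule summable_comparison_test'[where N=0, rotated])
    then have "convergent (\<lambda>n. \<Sum>i<n. f (Suc i) x - f i x)" by (simp add: summable_iff_convergent)
    moreover have "(\<Sum>i<n. f (Suc i) x - f i x) = f n x - f 0 x" for n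
      by (rule sum_lessThan_telescope)
    ultimately have "convergent (\<lambda>n. f n x - f 0 x)" by (simp only:)
    then have "convergent (\<lambda>n. f n x - f 0 x + f 0 x)" by (intro convergent_add convergent_const)
    then show ?case by simp
  qed
qed

instance l2 :: (euclidean_space, euclidean_space) complete_space
proof
  fix X :: "nat \<Rightarrow> ('a, 'b) l2" assume X: "Cauchy X"
  have "\<exists>M. \<forall>m\<ge>M. \<forall>n\<ge>M. norm (X m - X n) < (1/2)^k" for k
    using CauchyD[OF X, of "(1/2)^k"] by simp
  then obtain M where M: "\<And>k m n. m \<ge> M k \<Longrightarrow> n \<ge> M k \<Longrightarrow> norm (X m - X n) < (1/2)^k" by metis
  \<comment> \<open>Adding \<open>k\<close> makes the sequence strictly increasing, and the partial
    sums dominate each \<open>M k\<close>.\<close>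
  define s where "s k = k + (\<Sum>i\<le>k. M i)" for k
  have sM: "M k \<le> s k" for k unfolding s_def by (simp add: member_le_sum trans_le_add2)
  have s: "strict_mono s" unfolding s_def strict_mono_Suc_iff by simp
  have "\<exists>f. f \<in> l2_fun \<and> X n = abs_l2 f" for n using l2_rep by metis
  then obtain g where g: "\<And>n. g n \<in> l2_fun" "\<And>n. X n = abs_l2 (g n)" by metis
  define f where "f n = g (s n)" for n
  have f: "f n \<in> l2_fun" for n by (simp add: f_def g)
  have [measurable]: "f n \<in> borel_measurable lebesgue" for n using f by (auto simp: l2_fun_def)
  have Xs: "X (s n) = abs_l2 (f n)" for n by (simp add: f_def g)
  have c: "norm (abs_l2 (f m) - abs_l2 (f n)) \<le> (1/2)^k" if "k \<le> m" "k \<le> n" for m n k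
  proof -
    have "M k \<le> s m" "M k \<le> s n"
      using sM[of k] that strict_mono_less_eq[OF s] order_trans by blast+
    from M[OF this] show ?thesis by (simp add: Xs)
  qed
  have conv: "AE x in lebesgue. convergent (\<lambda>n. f n x)"
    by (rule geometric_l2_Cauchy_AE_convergent[OF f]) (rule c, auto)
  define F where "F x = lim (\<lambda>n. f n x)" for x
  have Fm[measurable]: "F \<in> borel_measurable lebesgue" unfolding F_def
      by (rule borel_measurable_lim_metric) simp
  have lim: "AE x in lebesgue. (\<lambda>n. f n x) \<longlonglongrightarrow> F x"
    using conv by eventually_elim (simp add: F_def convergent_LIMSEQ_iff)
  \<comment> \<open>Fatou's lemma in the later index with \<open>m\<close> fixed turns the Cauchy
    estimate into an estimate of the distance to the pointwise limit.\<close>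
  have *: "integrable lebesgue (\<lambda>x. (norm (F x - f m x))\<^sup>2)"
    "(LINT x|lebesgue. (norm (F x - f m x))\<^sup>2) \<le> ((1/2)^m)\<^sup>2" for m
  proof -
    have 1: "integrable lebesgue (\<lambda>x. (norm (f (m + n) x - f m x))\<^sup>2)" for n
      by (intro l2_fun_integrable l2_fun_diff f)
    have 2: "AE x in lebesgue. (\<lambda>n. (norm (f (m + n) x - f m x))\<^sup>2) \<longlonglongrightarrow> (norm (F x - f m x))\<^sup>2"
      using lim
    proof eventually_elim
      case (elim x)
      from LIMSEQ_ignore_initial_segment[OF this, of m] show ?case
        by (intro tendsto_intros) (simp add: add.commute)
    qed
    have 3: "(LINT x|lebesgue. (norm (f (m + n) x - f m x))\<^sup>2) \<le> ((1/2)^m)\<^sup>2" for n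
    proof -
      have "(LINT x|lebesgue. (norm (f (m + n) x - f m x))\<^sup>2) = (norm (abs_l2 (f (m+n)) - abs_l2 (f m)))\<^sup>2"
        by (simp add: minus_abs_l2 f norm_abs_l2 l2_fun_diff)
      also have "\<dots> \<le> ((1/2)^m)\<^sup>2" by (intro power_mono c) auto
      finally show ?thesis .
    qed
    show "integrable lebesgue (\<lambda>x. (norm (F x - f m x))\<^sup>2)"
      "(LINT x|lebesgue. (norm (F x - f m x))\<^sup>2) \<le> ((1/2)^m)\<^sup>2"
      by (rule integrable_fatou[OF 1 _ 2 _ 3]; simp)+
  qed
  have "(\<lambda>x. F x - f 0 x) \<in> l2_fun" using *(1)[of 0] by (simp add: l2_fun_def)
  from l2_fun_add[OF this f[of 0]] have F: "F \<in> l2_fun" by simp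
  have "norm (abs_l2 F - abs_l2 (f m)) \<le> (1/2)^m" for m
  proof -
    have "(norm (abs_l2 F - abs_l2 (f m)))\<^sup>2 \<le> ((1/2)^m)\<^sup>2"
      using *(2)[of m] by (simp add: minus_abs_l2 f F norm_abs_l2 l2_fun_diff)
    then show ?thesis by (rule power2_le_imp_le) simp
  qed
  then have "(\<lambda>m. abs_l2 (f m) - abs_l2 F) \<longlonglongrightarrow> 0"
    by (intro Lim_null_comparison[OF _ LIMSEQ_power_zero[of "1/2::real"]]) (auto simp: norm_minus_commute)
  then have "(X \<circ> s) \<longlonglongrightarrow> abs_l2 F" by (simp add: o_def Xs LIM_zero_iff)
  then have "X \<longlonglongrightarrow> abs_l2 F" using Cauchy_converges_subseq[OF X s] by blast
  then show "convergent X" by (auto simp: convergent_def)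
qed


section \<open>Test functions\<close>

lemma frechet_derivative_eqI: "(f has_derivative f') (at x) \<Longrightarrow> frechet_derivative f (at x) = f'"
  by (rule frechet_derivative_at[symmetric])

lemma frechet_derivative_worksD:
  "f differentiable (at x) \<Longrightarrow> (f has_derivative frechet_derivative f (at x)) (at x)"
  by (simp add: frechet_derivative_works)

lemma Ck_SucD: "Ck (Suc k) f \<Longrightarrow> Ck k f"
proof (induction k arbitrary: f)
  case 0
  then have "f differentiable_on UNIV" by (simp add: differentiable_on_def)
  then show ?case by (simp add: differentiable_imp_continuous_on)
next
  case (Suc k)
  from Suc.prems have "\<And>x. f differentiable at x"
    and "\<And>i. i \<in> Basis \<Longrightarrow> Ck (Suc k) (\<lambda>x. frechet_derivative f (at x) i)"
    by (simp_all only: Ck.simps(2)[of "Suc k"] simp_thms Ball_def)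
  with Suc.IH show ?case by simp
qed

lemma Ck_const: "Ck k (\<lambda>x. c)"
  by (induction k arbitrary: c) (auto simp: frechet_derivative_const)

lemma Ck_add: "Ck k f \<Longrightarrow> Ck k g \<Longrightarrow> Ck k (\<lambda>x. f x + g x)"
proof (induction k arbitrary: f g)
  case (Suc k)
  have "frechet_derivative (\<lambda>x. f x + g x) (at x) =
    (\<lambda>h. frechet_derivative f (at x) h + frechet_derivative g (at x) h)" for x
    using Suc.prems by (intro frechet_derivative_eqI has_derivative_add frechet_derivative_worksD) auto
  with Suc show ?case by (auto intro: differentiable_add)
qed (auto intro: continuous_intros)

lemma Ck_mult: "Ck k f \<Longrightarrow> Ck k g \<Longrightarrow> Ck k (\<lambda>x. f x * g x)"
proof (induction k arbitrary: f g)
  case (Suc k)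
  have "frechet_derivative (\<lambda>x. f x * g x) (at x) =
    (\<lambda>h. f x * frechet_derivative g (at x) h + frechet_derivative f (at x) h * g x)" for x
    using Suc.prems by (intro frechet_derivative_eqI has_derivative_mult frechet_derivative_worksD) auto
  moreover have "Ck k f" "Ck k g" using Suc.prems by (blast intro: Ck_SucD)+
  ultimately show ?case using Suc by (auto intro!: differentiable_mult Ck_add)
qed (auto intro: continuous_intros)

lemma Ck_prod: "finite I \<Longrightarrow> (\<And>i. i \<in> I \<Longrightarrow> Ck k (f i)) \<Longrightarrow> Ck k (\<lambda>x. \<Prod>i\<in>I. f i x)"
  by (induction I rule: finite_induct) (auto intro: Ck_const Ck_mult)

lemma poly_exp_minus_tendsto_0: "((\<lambda>y::real. poly q y * exp (- y)) \<longlongrightarrow> 0) at_top"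
proof -
  have "((\<lambda>y. \<Sum>i\<le>degree q. coeff q i * (y ^ i / exp y)) \<longlongrightarrow> (\<Sum>i\<le>degree q. coeff q i * 0)) at_top"
    by (intro tendsto_sum tendsto_mult tendsto_const tendsto_power_div_exp_0)
  then show ?thesis by (simp add: poly_altdef sum_distrib_right exp_minus divide_inverse mult.assoc)
qed

text \<open>The family is closed under differentiation, so every member is smooth.\<close>

definition bump :: "real poly \<Rightarrow> real \<Rightarrow> real" where
  "bump p x = (if x > 0 then poly p (1/x) * exp (- (1/x)) else 0)"

text \<open>With \<open>y = 1/x\<close>, whose derivative is \<open>- y^2\<close>, the function
  \<open>p(y) exp(-y)\<close> has derivative \<open>y^2 (p(y) - p'(y)) exp(-y)\<close>; the
  polynomial \<open>[:0,0,1:]\<close> is \<open>y^2\<close>.\<close>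

lemma bump_deriv: "(bump p has_real_derivative bump ([:0,0,1:] * (p - pderiv p)) x) (at x)"
proof -
  consider "x > 0" | "x < 0" | "x = 0" by linarith
  then show ?thesis
  proof cases
    case 1
    have "((\<lambda>x. poly p (1/x) * exp (- (1/x))) has_real_derivative
        bump ([:0,0,1:] * (p - pderiv p)) x) (at x)"
      using 1 by (auto intro!: derivative_eq_intros DERIV_chain2[OF poly_DERIV]
          simp: bump_def field_simps power2_eq_square)
    then show ?thesis
      by (rule has_field_derivative_transform_within_open[of _ _ _ "{0<..}"]) (use 1 in \<open>auto simp: bump_def\<close>)
  next
    case 2
    have "((\<lambda>x. 0) has_real_derivative bump ([:0,0,1:] * (p - pderiv p)) x) (at x)"
      using 2 by (simp add: bump_def)
    then show ?thesis
      by (rule has_field_derivative_transform_within_open[of _ _ _ "{..<0}"]) (use 2 in \<open>auto simp: bump_def\<close>)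
  next
    case 3
    \<comment> \<open>Dividing by \<open>h\<close> multiplies by \<open>y = 1/h\<close>, so the
      quotient is again of the form polynomial times \<open>exp(-y)\<close>, now with
      \<open>pCons 0 p\<close>.\<close>
    have r: "((\<lambda>h. bump p h / h) \<longlongrightarrow> 0) (at_right 0)"
    proof -
      have "((\<lambda>h::real. poly (pCons 0 p) (inverse h) * exp (- inverse h)) \<longlongrightarrow> 0) (at_right 0)"
        by (rule filterlim_compose[OF poly_exp_minus_tendsto_0 filterlim_inverse_at_top_right])
      moreover have "\<forall>\<^sub>F h in at_right 0. bump p h / h = poly (pCons 0 p) (inverse h) * exp (- inverse h)"
        by (auto simp: eventually_at_filter bump_def divide_inverse)
      ultimately show ?thesis by (simp add: tendsto_cong)
    qed
    have l: "((\<lambda>h. bump p h / h) \<longlongrightarrow> 0) (at_left 0)"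
    proof -
      have "\<forall>\<^sub>F h in at_left 0. bump p h / h = 0"
        by (auto simp: eventually_at_filter bump_def)
      then show ?thesis by (rule tendsto_eventually)
    qed
    have "((\<lambda>h. bump p h / h) \<longlongrightarrow> 0) (at 0)" using l r by (rule filterlim_split_at)
    then show ?thesis using 3 by (simp add: DERIV_def bump_def)
  qed
qed

text \<open>Only affine inner functions occur, so the derivative is a constant multiple of another
  bump. The induction works because \<open>p\<close> is arbitrary in the hypothesis.\<close>

lemma Ck_bump: "Ck k (\<lambda>x::'a::euclidean_space. bump p (c * (x \<bullet> e) + d))"
proof (induction k arbitrary: p)
  case 0
  have "continuous_on UNIV (bump p)"
    using bump_deriv DERIV_isCont continuous_at_imp_continuous_on by blast
  then show ?case by (auto intro!: continuous_on_compose2[of UNIV "bump p"] continuous_intros)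
next
  case (Suc k)
  let ?q = "[:0,0,1:] * (p - pderiv p)"
  have "((\<lambda>x. bump p (c * (x \<bullet> e) + d)) has_derivative
      (\<lambda>h. bump ?q (c * (x \<bullet> e) + d) * (c * (h \<bullet> e)))) (at x)" for x :: 'a
  proof -
    have "((\<lambda>x. c * (x \<bullet> e) + d) has_derivative (\<lambda>h. c * (h \<bullet> e))) (at x)"
      by (auto intro!: derivative_eq_intros)
    moreover have "(bump p has_derivative (*) (bump ?q (c * (x \<bullet> e) + d))) (at (c * (x \<bullet> e) + d))"
      using bump_deriv[of p "c * (x \<bullet> e) + d"] unfolding has_field_derivative_def .
    ultimately show ?thesis by (rule has_derivative_compose)
  qed
  note d = this
  then have "frechet_derivative (\<lambda>x. bump p (c * (x \<bullet> e) + d)) (at x) =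
      (\<lambda>h. bump ?q (c * (x \<bullet> e) + d) * (c * (h \<bullet> e)))" for x
    by (rule frechet_derivative_eqI)
  moreover have "(\<lambda>x. bump p (c * (x \<bullet> e) + d)) differentiable at x" for x :: 'a
    using d unfolding differentiable_def by blast
  ultimately show ?case using Suc by (auto intro: Ck_mult Ck_const)
qed

text \<open>With the constant polynomial 1, a factor is \<open>exp(-1/s)\<close> for
  \<open>s > 0\<close>; scaling by \<open>Suc n\<close> lets it increase to 1. The functions thus
  stay below 1, vanish exactly outside the open box and converge pointwise to its indicator. The
  arguments are written in the shape that \<open>Ck_bump\<close> expects.\<close>

definition box_bump :: "'a::euclidean_space \<Rightarrow> 'a \<Rightarrow> nat \<Rightarrow> 'a \<Rightarrow> real" where
  "box_bump a b n x = (\<Prod>i\<in>Basis. bump 1 (real (Suc n) * (x \<bullet> i) + - real (Suc n) * (a \<bullet> i)) *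
      bump 1 (- real (Suc n) * (x \<bullet> i) + real (Suc n) * (b \<bullet> i)))"

lemma box_bump_eq: "box_bump a b n x = (\<Prod>i\<in>Basis. bump 1 (real (Suc n) * (x \<bullet> i - a \<bullet> i)) *
      bump 1 (real (Suc n) * (b \<bullet> i - x \<bullet> i)))"
  by (simp add: box_bump_def algebra_simps)

lemma Ck_box_bump: "Ck k (box_bump a b n)"
  unfolding box_bump_def[abs_def] by (intro Ck_prod Ck_mult Ck_bump) auto

lemma bump_1_range: "0 \<le> bump 1 x" "bump 1 x \<le> 1" by (auto simp: bump_def)

lemma bump_1_zero_iff: "bump 1 x = 0 \<longleftrightarrow> x \<le> 0" by (auto simp: bump_def)

lemma box_bump_range: "0 \<le> box_bump a b n x" "box_bump a b n x \<le> 1"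
proof -
  show "0 \<le> box_bump a b n x" unfolding box_bump_def by (intro prod_nonneg) (simp add: bump_1_range)
  show "box_bump a b n x \<le> 1" unfolding box_bump_def by (intro prod_le_1) (simp add: bump_1_range mult_le_one)
qed

lemma box_bump_zero_iff: "box_bump a b n x = 0 \<longleftrightarrow> x \<notin> box a b"
proof -
  have "real (Suc n) * s \<le> 0 \<longleftrightarrow> s \<le> 0" for s by (simp add: mult_le_0_iff)
  then show ?thesis unfolding box_bump_eq
    by (auto simp: prod_zero_iff bump_1_zero_iff mem_box not_less)
qed

lemma bump_1_scaled_tendsto: "(\<lambda>n. bump 1 (real (Suc n) * s)) \<longlonglongrightarrow> (if s > 0 then 1 else 0)"
proof (cases "s > 0")
  case True
  have "(\<lambda>n. exp (- (inverse (real (Suc n)) * (1/s)))) \<longlonglongrightarrow> exp (- (0 * (1/s)))"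
    by (intro tendsto_intros LIMSEQ_inverse_real_of_nat)
  moreover have "bump 1 (real (Suc n) * s) = exp (- (inverse (real (Suc n)) * (1/s)))" for n
    using True by (simp add: bump_def divide_inverse del: of_nat_Suc)
  ultimately show ?thesis using True by simp
next
  case False
  then have "bump 1 (real (Suc n) * s) = 0" for n by (simp add: bump_1_zero_iff mult_le_0_iff)
  with False show ?thesis by simp
qed

lemma box_bump_tendsto: "(\<lambda>n. box_bump a b n x) \<longlonglongrightarrow> indicator (box a b) x"
proof -
  have "(\<lambda>n. box_bump a b n x) \<longlonglongrightarrow>
     (\<Prod>i\<in>Basis. (if x \<bullet> i - a \<bullet> i > 0 then 1 else 0) * (if b \<bullet> i - x \<bullet> i > 0 then 1 else 0))"
    unfolding box_bump_eq by (intro tendsto_prod tendsto_mult bump_1_scaled_tendsto)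
  moreover have "(\<Prod>i\<in>Basis. (if x \<bullet> i - a \<bullet> i > 0 then 1 else 0) * (if b \<bullet> i - x \<bullet> i > 0 then 1 else 0))
      = indicat_real (box a b) x"
  proof (cases "x \<in> box a b")
    case False
    then obtain i where "i \<in> Basis" "\<not> (x \<bullet> i - a \<bullet> i > 0 \<and> b \<bullet> i - x \<bullet> i > 0)" by (auto simp: mem_box)
    with False show ?thesis by (auto intro!: prod_zero bexI[of _ i])
  qed (auto simp: mem_box intro!: prod.neutral)
  ultimately show ?thesis by simp
qed

lemma test_functionsI:
  assumes "\<And>k. Ck k \<phi>" "compact K" "K \<subseteq> \<Omega>" "\<And>x. x \<notin> K \<Longrightarrow> \<phi> x = 0"
  shows "\<phi> \<in> test_functions \<Omega>"
proof -
  have "closure {x. \<phi> x \<noteq> 0} \<subseteq> K"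
    using assms(4) by (intro closure_minimal compact_imp_closed assms) auto
  moreover from this have "compact (closure {x. \<phi> x \<noteq> 0})"
    using assms(2) by (metis closed_closure closed_Int_compact inf.absorb1)
  ultimately show ?thesis using assms unfolding test_functions_def by auto
qed

lemma test_functionsD:
  assumes "\<phi> \<in> test_functions \<Omega>"
  obtains K where "compact K" "K \<subseteq> \<Omega>" "\<And>x. x \<notin> K \<Longrightarrow> \<phi> x = 0"
proof (rule that[of "closure {x. \<phi> x \<noteq> 0}"])
  show "\<phi> x = 0" if "x \<notin> closure {x. \<phi> x \<noteq> 0}" for x
    using that closure_subset[of "{x. \<phi> x \<noteq> 0}"] by blast
qed (use assms in \<open>auto simp: test_functions_def\<close>)

lemma box_bump_test:
  assumes "cbox a b \<subseteq> \<Omega>" shows "box_bump a b n \<in> test_functions \<Omega>"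
  by (rule test_functionsI[OF Ck_box_bump compact_cbox assms])
    (use box_bump_zero_iff box_subset_cbox in blast)

lemma test_functions_lincomb:
  assumes "\<phi> \<in> test_functions \<Omega>" "\<psi> \<in> test_functions \<Omega>"
  shows "(\<lambda>x. c * \<phi> x + d * \<psi> x) \<in> test_functions \<Omega>"
proof -
  obtain K where K: "compact K" "K \<subseteq> \<Omega>" "\<And>x. x \<notin> K \<Longrightarrow> \<phi> x = 0" using test_functionsD[OF assms(1)] by metis
  obtain L where L: "compact L" "L \<subseteq> \<Omega>" "\<And>x. x \<notin> L \<Longrightarrow> \<psi> x = 0" using test_functionsD[OF assms(2)] by metis
  show ?thesis
  proof (rule test_functionsI)
    show "Ck k (\<lambda>x. c * \<phi> x + d * \<psi> x)" for k
      using assms by (intro Ck_add Ck_mult Ck_const) (auto simp: test_functions_def)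
    show "compact (K \<union> L)" using K L by blast
  qed (use K L in auto)
qed

section \<open>Integration by parts and uniqueness of weak gradients\<close>

definition grad :: "('a::euclidean_space \<Rightarrow> real) \<Rightarrow> 'a \<Rightarrow> 'a" where
  "grad f x = (\<Sum>i\<in>Basis. frechet_derivative f (at x) i *\<^sub>R i)"

text \<open>Pairs of a continuously differentiable function with bounded support and its gradient.
  The class is larger than that of the test functions because the truncations in the proof of
  Sobolev's inequality are only once continuously differentiable.\<close>

definition C1c :: "('a::euclidean_space \<Rightarrow> real) \<Rightarrow> ('a \<Rightarrow> 'a) \<Rightarrow> bool" where
  "C1c v g \<longleftrightarrow> (\<forall>x. (v has_derivative (\<lambda>h. g x \<bullet> h)) (at x)) \<and> continuous_on UNIV g \<and>
     (\<exists>R. \<forall>x. R < norm x \<longrightarrow> v x = 0)"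

lemma has_derivative_grad:
  assumes "f differentiable at x" shows "(f has_derivative (\<lambda>h. grad f x \<bullet> h)) (at x)"
proof -
  have d: "(f has_derivative frechet_derivative f (at x)) (at x)"
      using assms by (rule frechet_derivative_worksD)
  have "frechet_derivative f (at x) h = grad f x \<bullet> h" for h
  proof -
    interpret linear "frechet_derivative f (at x)" using d by (rule has_derivative_linear)
    have "frechet_derivative f (at x) h = frechet_derivative f (at x) (\<Sum>i\<in>Basis. (h \<bullet> i) *\<^sub>R i)"
      by (simp add: euclidean_representation)
    also have "\<dots> = grad f x \<bullet> h" unfolding grad_def
      by (simp add: sum scale inner_sum_left inner_commute[of h] mult.commute)
    finally show ?thesis .
  qed
  then have "frechet_derivative f (at x) = (\<lambda>h. grad f x \<bullet> h)" by auto
  with d show ?thesis by simp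
qed

lemma test_function_C1c:
  assumes "\<phi> \<in> test_functions \<Omega>" shows "C1c \<phi> (grad \<phi>)"
proof -
  have C: "Ck (Suc 0) \<phi>" using assms unfolding test_functions_def by blast
  obtain K where K: "compact K" "\<And>x. x \<notin> K \<Longrightarrow> \<phi> x = 0" using test_functionsD[OF assms] by metis
  obtain R where "\<And>x. x \<in> K \<Longrightarrow> norm x \<le> R" using compact_imp_bounded[OF K(1)] by (auto simp: bounded_iff)
  with K(2) have "\<forall>x. R < norm x \<longrightarrow> \<phi> x = 0" by fastforce
  moreover have "continuous_on UNIV (grad \<phi>)"
    unfolding grad_def[abs_def] using C by (intro continuous_intros) auto
  ultimately show ?thesis unfolding C1c_def using C has_derivative_grad by auto
qed

lemma frechet_derivative_eq_grad:
  assumes "\<phi> \<in> test_functions \<Omega>"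
  shows "frechet_derivative \<phi> (at x) e = grad \<phi> x \<bullet> e"
proof -
  have "(\<phi> has_derivative (\<lambda>h. grad \<phi> x \<bullet> h)) (at x)"
    using test_function_C1c[OF assms] unfolding C1c_def by blast
  from frechet_derivative_eqI[OF this] show ?thesis by simp
qed

lemma C1c_has_derivative: "C1c v g \<Longrightarrow> (v has_derivative (\<lambda>h. g x \<bullet> h)) (at x)"
  by (simp add: C1c_def)

lemma C1c_continuous: "C1c v g \<Longrightarrow> continuous_on UNIV v" "C1c v g \<Longrightarrow> continuous_on UNIV g"
  by (auto simp: C1c_def intro!: continuous_at_imp_continuous_on intro: has_derivative_continuous)

lemma has_derivative_zero_on_open:
  assumes "open S" "x \<in> S" "\<And>y. y \<in> S \<Longrightarrow> v y = 0" "(v has_derivative (\<lambda>h. g \<bullet> h)) (at x)"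
  shows "g = (0::'a::euclidean_space)"
proof -
  have "((\<lambda>_. 0::real) has_derivative (\<lambda>h. g \<bullet> h)) (at x)"
    by (rule has_derivative_transform_within_open[OF assms(4,1,2)]) (simp add: assms(3))
  then have "(\<lambda>h. g \<bullet> h) = (\<lambda>h. 0)" using has_derivative_unique[OF _ has_derivative_const] by blast
  then have "g \<bullet> g = 0" by meson
  then show ?thesis by simp
qed

lemma C1c_support:
  assumes "C1c v g"
  obtains R where "R > 0" "\<And>x. R < norm x \<Longrightarrow> v x = 0" "\<And>x. R < norm x \<Longrightarrow> g x = 0"
proof -
  obtain R where R: "\<And>x. R < norm x \<Longrightarrow> v x = 0" using assms unfolding C1c_def by blast
  have "g x = 0" if "R < norm x" for x
    by (rule has_derivative_zero_on_open[of "{x. R < norm x}" x v])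
      (use that R C1c_has_derivative[OF assms] in \<open>auto intro: open_Collect_less continuous_intros\<close>)
  with R show thesis using that[of "max R 1"] by auto
qed

text \<open>Translation invariance and Fubini's theorem are applied to \<open>lborel\<close>,
  whereas the function spaces are built on \<open>lebesgue\<close>; both forms are used.\<close>

lemma integrable_continuous_bounded_support:
  fixes f :: "'a::euclidean_space \<Rightarrow> 'b::euclidean_space"
  assumes "continuous_on UNIV f" "\<And>x. R < norm x \<Longrightarrow> f x = 0"
  shows "integrable lborel f" "integrable lebesgue f"
proof -
  have "integrable lborel (\<lambda>x. indicator (cball 0 R) x *\<^sub>R f x)"
    using assms(1) by (intro borel_integrable_compact) (auto intro: continuous_on_subset)
  moreover have "indicator (cball 0 R) x *\<^sub>R f x = f x" for x
    using assms(2)[of x] by (cases "R < norm x") (auto simp: indicator_def)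
  ultimately show i: "integrable lborel f" by simp
  have "f \<in> borel_measurable borel" using assms(1) by (rule borel_measurable_continuous_onI)
  with i show "integrable lebesgue f" by (simp add: integrable_completion)
qed

lemma bounded_continuous_bounded_support:
  fixes f :: "'a::euclidean_space \<Rightarrow> 'b::euclidean_space"
  assumes "continuous_on UNIV f" "\<And>x. R < norm x \<Longrightarrow> f x = 0"
  obtains K where "K > 0" "\<And>x. norm (f x) \<le> K"
proof -
  have "compact (f ` cball 0 R)"
    using assms(1) by (intro compact_continuous_image) (auto intro: continuous_on_subset)
  then obtain K where K: "\<And>x. norm x \<le> R \<Longrightarrow> norm (f x) \<le> K"
    using compact_imp_bounded by (force simp: bounded_iff)
  have "norm (f x) \<le> max K 1" for x
    using K[of x] assms(2)[of x] by (cases "R < norm x") auto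
  then show thesis using that[of "max K 1"] by auto
qed

lemma lborel_translate:
  fixes f :: "'a::euclidean_space \<Rightarrow> 'b::{banach,second_countable_topology}"
  assumes [measurable]: "f \<in> borel_measurable borel"
  shows "(LINT x|lborel. f (x + c)) = (LINT x|lborel. f x)"
    and "integrable lborel f \<Longrightarrow> integrable lborel (\<lambda>x. f (x + c))"
proof -
  have "(LINT x|distr lborel borel ((+) c). f x) = (LINT x|lborel. f (c + x))"
    by (rule integral_distr) auto
  then show "(LINT x|lborel. f (x + c)) = (LINT x|lborel. f x)"
    by (simp add: lborel_distr_plus add.commute)
  have "integrable (distr lborel borel ((+) c)) f \<longleftrightarrow> integrable lborel (\<lambda>x. f (c + x))"
    by (rule integrable_distr_eq) auto
  then show "integrable lborel f \<Longrightarrow> integrable lborel (\<lambda>x. f (x + c))"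
    by (simp add: lborel_distr_plus add.commute)
qed

lemma C1c_difference_bound:
  assumes v: "C1c v g" and K: "\<And>x. norm (g x) \<le> K"
  shows "\<bar>v (x + h) - v x\<bar> \<le> K * norm h"
proof -
  have "norm (v (x + h) - v x) \<le> K * norm ((x + h) - x)"
  proof (rule differentiable_bound[where S=UNIV and f'="\<lambda>x h. g x \<bullet> h"])
    show "(v has_derivative (\<lambda>h. g x \<bullet> h)) (at x within UNIV)" for x
      using C1c_has_derivative[OF v] by simp
    show "onorm ((\<bullet>) (g x)) \<le> K" for x
    proof (rule onorm_le)
      fix h
      have "norm (g x \<bullet> h) \<le> norm (g x) * norm h" by (simp add: Cauchy_Schwarz_ineq2)
      also have "\<dots> \<le> K * norm h" by (intro mult_right_mono K) simp
      finally show "norm (g x \<bullet> h) \<le> K * norm h" .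
    qed
  qed auto
  then show ?thesis by simp
qed

text \<open>Translation invariance makes every difference quotient integrate to zero.\<close>

lemma C1c_integral_derivative_zero:
  fixes v :: "'a::euclidean_space \<Rightarrow> real"
  assumes v: "C1c v g"
  shows "(LINT x|lborel. g x \<bullet> e) = 0"
proof -
  obtain R where R: "R > 0" "\<And>x. R < norm x \<Longrightarrow> v x = 0" "\<And>x. R < norm x \<Longrightarrow> g x = 0"
    using C1c_support[OF v] by blast
  obtain K where K: "K > 0" "\<And>x. norm (g x) \<le> K"
    using bounded_continuous_bounded_support[OF C1c_continuous(2)[OF v] R(3)] by blast
  have vm[measurable]: "v \<in> borel_measurable borel"
    using C1c_continuous(1)[OF v] by (rule borel_measurable_continuous_onI)
  have gm[measurable]: "g \<in> borel_measurable borel"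
    using C1c_continuous(2)[OF v] by (rule borel_measurable_continuous_onI)
  \<comment> \<open>The difference quotient in direction \<open>e\<close> with step
    \<open>1 / Suc n\<close>.\<close>
  define q where "q n x = real (Suc n) * (v (x + inverse (real (Suc n)) *\<^sub>R e) - v x)" for n x
  have vi: "integrable lborel v"
    using C1c_continuous(1)[OF v] R(2) by (rule integrable_continuous_bounded_support)
  have q0: "(LINT x|lborel. q n x) = 0" for n
    unfolding q_def using lborel_translate[OF vm] vi by simp
  have "(\<lambda>n. LINT x|lborel. q n x) \<longlonglongrightarrow> (LINT x|lborel. g x \<bullet> e)"
  proof (rule integral_dominated_convergence)
    show "(\<lambda>x. g x \<bullet> e) \<in> borel_measurable lborel" by simp
    show "q n \<in> borel_measurable lborel" for n unfolding q_def by simp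
    \<comment> \<open>The dominating function: the quotients are bounded by
      \<open>K * norm e\<close>, and since the step is at most 1 they vanish outside the enlarged
      ball.\<close>
    show "integrable lborel (\<lambda>x. indicator (cball 0 (R + norm e)) x *\<^sub>R (K * norm e))"
      by (rule borel_integrable_compact) auto
    have "(\<lambda>n. q n x) \<longlonglongrightarrow> g x \<bullet> e" for x
    proof -
      have "((\<lambda>t. v (x + t *\<^sub>R e)) has_derivative (\<lambda>t. g x \<bullet> (t *\<^sub>R e))) (at 0)"
        by (rule has_derivative_compose[where f="\<lambda>t. x + t *\<^sub>R e" and f'="\<lambda>t. t *\<^sub>R e" and g=v])
          (auto intro!: derivative_eq_intros C1c_has_derivative[OF v])
      then have "((\<lambda>t. v (x + t *\<^sub>R e)) has_real_derivative (g x \<bullet> e)) (at 0)"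
        by (rule has_derivative_imp_has_field_derivative) simp
      then have "((\<lambda>t. (v (x + t *\<^sub>R e) - v x) / t) \<longlongrightarrow> g x \<bullet> e) (at 0)" by (simp add: DERIV_def)
      then have "(\<lambda>n. (v (x + inverse (real (Suc n)) *\<^sub>R e) - v x) / inverse (real (Suc n))) \<longlonglongrightarrow> g x \<bullet> e"
        by (rule filterlim_compose) (auto simp: filterlim_at LIMSEQ_inverse_real_of_nat intro!:
            always_eventually
          simp del: of_nat_Suc)
      then show ?thesis by (simp add: q_def divide_inverse mult.commute)
    qed
    then show "AE x in lborel. (\<lambda>n. q n x) \<longlonglongrightarrow> g x \<bullet> e" by simp
    have "norm (q n x) \<le> indicator (cball 0 (R + norm e)) x *\<^sub>R (K * norm e)" for n x
    proof (cases "norm x \<le> R + norm e")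
      case True
      have "\<bar>v (x + inverse (real (Suc n)) *\<^sub>R e) - v x\<bar> \<le> K * norm (inverse (real (Suc n)) *\<^sub>R e)"
        using v K(2) by (rule C1c_difference_bound)
      then have "real (Suc n) * \<bar>v (x + inverse (real (Suc n)) *\<^sub>R e) - v x\<bar>
          \<le> real (Suc n) * (K * norm (inverse (real (Suc n)) *\<^sub>R e))" by (intro mult_left_mono) auto
      also have "\<dots> = K * norm e" by (simp add: field_simps)
      finally show ?thesis using True by (simp add: q_def abs_mult del: of_nat_Suc)
    next
      case False
      have "norm (inverse (real (Suc n)) *\<^sub>R e) \<le> 1 * norm e"
        unfolding norm_scaleR by (intro mult_right_mono) (auto simp: field_simps)
      then have "norm (x + inverse (real (Suc n)) *\<^sub>R e) > R"
        using False norm_triangle_ineq4[of "x + inverse (real (Suc n)) *\<^sub>R e" "inverse (real (Suc n)) *\<^sub>R e"]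
            by simp
      moreover have "norm x > R" using False norm_ge_zero[of e] by linarith
      ultimately show ?thesis using False by (simp add: q_def R(2))
    qed
    then show "AE x in lborel. norm (q n x) \<le> indicator (cball 0 (R + norm e)) x *\<^sub>R (K * norm e)" for n
        by simp
  qed
  then show ?thesis by (simp add: q0 LIMSEQ_const_iff)
qed

lemma C1c_mult:
  assumes v: "C1c v g" and w: "C1c w k"
  shows "C1c (\<lambda>x. v x * w x) (\<lambda>x. v x *\<^sub>R k x + w x *\<^sub>R g x)"
proof -
  have "((\<lambda>x. v x * w x) has_derivative (\<lambda>h. (v x *\<^sub>R k x + w x *\<^sub>R g x) \<bullet> h)) (at x)" for x
    using has_derivative_mult[OF C1c_has_derivative[OF v] C1c_has_derivative[OF w], of x]
    by (simp add: inner_add_left mult.commute)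
  moreover have "continuous_on UNIV (\<lambda>x. v x *\<^sub>R k x + w x *\<^sub>R g x)"
    using C1c_continuous v w by (intro continuous_intros) blast+
  ultimately show ?thesis using v unfolding C1c_def by auto
qed

lemma C1c_integration_by_parts:
  assumes v: "C1c v g" and w: "C1c w k"
  shows "(LINT x|lborel. v x * (k x \<bullet> e)) = - (LINT x|lborel. (g x \<bullet> e) * w x)"
proof -
  obtain R where R: "R > 0" "\<And>x. R < norm x \<Longrightarrow> v x = 0" "\<And>x. R < norm x \<Longrightarrow> g x = 0"
    using C1c_support[OF v] by blast
  have 1: "integrable lborel (\<lambda>x. v x * (k x \<bullet> e))"
    by (rule integrable_continuous_bounded_support[where R=R])
      (use C1c_continuous v w R in \<open>auto intro!: continuous_intros\<close>)
  have 2: "integrable lborel (\<lambda>x. (g x \<bullet> e) * w x)"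
    by (rule integrable_continuous_bounded_support[where R=R])
      (use C1c_continuous v w R in \<open>auto intro!: continuous_intros\<close>)
  have "0 = (LINT x|lborel. (v x *\<^sub>R k x + w x *\<^sub>R g x) \<bullet> e)"
    using C1c_integral_derivative_zero[OF C1c_mult[OF v w]] by simp
  also have "\<dots> = (LINT x|lborel. v x * (k x \<bullet> e) + (g x \<bullet> e) * w x)"
    by (simp add: inner_add_left mult.commute)
  also have "\<dots> = (LINT x|lborel. v x * (k x \<bullet> e)) + (LINT x|lborel. (g x \<bullet> e) * w x)"
    using 1 2 by simp
  finally show ?thesis by simp
qed

text \<open>The integral over the set where \<open>s * h\<close> is positive vanishes although the
  integrand is positive there, so that set is null; take \<open>s = 1\<close> and
  \<open>s = -1\<close>.\<close>

lemma AE_zero_if_set_integrals_zero: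
  fixes h :: "'x \<Rightarrow> real"
  assumes h: "integrable M h" and z: "\<And>B. B \<in> sets M \<Longrightarrow> (LINT x:B|M. h x) = 0"
  shows "AE x in M. h x = 0"
proof -
  have [measurable]: "h \<in> borel_measurable M" using h by simp
  have *: "AE x in M. \<not> s * h x > 0" for s :: real
  proof -
    let ?B = "{x\<in>space M. s * h x > 0}"
    have B: "?B \<in> sets M" by measurable
    have i: "integrable M (\<lambda>x. s * (indicator ?B x *\<^sub>R h x))"
      using h B by (intro integrable_mult_right integrable_mult_indicator)
    have nn: "AE x in M. 0 \<le> s * (indicator ?B x *\<^sub>R h x)" by (auto simp: indicator_def)
    have "(LINT x|M. s * (indicator ?B x *\<^sub>R h x)) = 0"
      using z[OF B] by (simp add: set_lebesgue_integral_def)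
    with integral_nonneg_eq_0_iff_AE[OF i nn] have ae: "AE x in M. s * (indicator ?B x *\<^sub>R h x) = 0" by blast
    show ?thesis using ae AE_space by eventually_elim (auto simp: indicator_def split: if_splits)
  qed
  show ?thesis using *[of 1] *[of "-1"] by eventually_elim auto
qed

text \<open>Boxes are an intersection-stable generator of the Borel sets, so the vanishing of the
  integrals spreads by a Dynkin argument. The support in one box gives the integral over the whole
  space, which the step for complements requires.\<close>

lemma AE_zero_if_box_integrals_zero:
  fixes h :: "'a::euclidean_space \<Rightarrow> real"
  assumes h: "integrable lborel h" and z: "\<And>a b. (LINT x:box a b|lborel. h x) = 0"
    and supp: "\<And>x. x \<notin> box a0 b0 \<Longrightarrow> h x = 0"
  shows "AE x in lborel. h x = 0"
proof (rule AE_zero_if_set_integrals_zero[OF h])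
  let ?G = "range (\<lambda>(a, b). box a b :: 'a set)"
  have seti: "set_integrable lborel A h" if "A \<in> sets borel" for A
    unfolding set_integrable_def using h that by (intro integrable_mult_indicator) auto
  have UN: "(LINT x:UNIV|lborel. h x) = 0"
  proof -
    have "(LINT x:UNIV|lborel. h x) = (LINT x:box a0 b0|lborel. h x)"
      unfolding set_lebesgue_integral_def using supp
          by (intro Bochner_Integration.integral_cong) (auto simp: indicator_def)
    then show ?thesis by (simp add: z)
  qed
  fix B :: "'a set" assume "B \<in> sets lborel"
  then have B: "B \<in> sigma_sets UNIV ?G" by (simp add: borel_eq_box)
  have sb: "A \<in> sets borel" if "A \<in> sigma_sets UNIV ?G" for A :: "'a set"
    using that by (simp add: borel_eq_box)
  have "Int_stable ?G" by (auto simp: Int_stable_def box_Int_box)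
  moreover have "?G \<subseteq> Pow UNIV" by simp
  ultimately show "(LINT x:B|lborel. h x) = 0" using B
  proof (induction rule: sigma_sets_induct_disjoint)
    case (basic A)
    then show ?case using z by auto
  next
    case empty
    show ?case by (simp add: set_lebesgue_integral_def)
  next
    case (compl A)
    have "(LINT x:A \<union> (UNIV - A)|lborel. h x) = (LINT x:A|lborel. h x) + (LINT x:UNIV - A|lborel. h x)"
      using sb[OF compl(1)] by (intro set_integral_Un seti) auto
    then show ?case using compl(2) UN by simp
  next
    case (union A)
    have "(LINT x:(\<Union>i. A i)|lborel. h x) = (\<Sum>i. (LINT x:(A i)|lborel. h x))"
    proof (rule lebesgue_integral_countable_add)
      show "\<And>i. A i \<in> sets lborel" using union(2) sb by auto
      show "\<And>i j. i \<noteq> j \<Longrightarrow> A i \<inter> A j = {}" using union(1) by (auto simp: disjoint_family_on_def)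
      show "set_integrable lborel (\<Union>i. A i) h" using union(2) sb by (intro seti) auto
    qed
    then show ?case using union(3) by simp
  qed
qed

text \<open>Box bumps are test functions that converge boundedly to indicators, so the integral over
  every box inside \<Omega> is zero. As boxes generate only the Borel sets, \<open>f\<close> is
  first replaced by a Borel function equal to it almost everywhere. The box lemma is applied on each
  of countably many closed boxes that exhaust \<Omega>, whose boundaries are null sets.\<close>

lemma fundamental_lemma:
  fixes f :: "'a::euclidean_space \<Rightarrow> real"
  assumes f: "integrable lebesgue f" and \<Omega>: "open \<Omega>"
    and z: "\<And>\<phi>. \<phi> \<in> test_functions \<Omega> \<Longrightarrow> (LINT x|lebesgue. f x * \<phi> x) = 0"
  shows "AE x in lebesgue. x \<in> \<Omega> \<longrightarrow> f x = 0"
proof -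
  obtain f' where f'[measurable]: "f' \<in> borel_measurable lborel" and ff': "AE x in lborel. f x = f' x"
    using completion_ex_borel_measurable_real[of f lborel] f by auto
  have ff'': "AE x in lebesgue. f x = f' x" using ff' by (rule AE_completion)
  have i': "integrable lborel f'"
  proof -
    have "integrable lebesgue f'"
      using f ff'' by (subst integrable_cong_AE[of f' _ f]) (auto simp: measurable_completion)
    then show ?thesis by (simp add: integrable_completion)
  qed
  have z': "(LINT x|lborel. f' x * \<phi> x) = 0" if "\<phi> \<in> test_functions \<Omega>" for \<phi>
  proof -
    have [measurable]: "\<phi> \<in> borel_measurable borel"
      using C1c_continuous(1)[OF test_function_C1c[OF that]] by (rule borel_measurable_continuous_onI)
    have "(LINT x|lborel. f' x * \<phi> x) = (LINT x|lebesgue. f' x * \<phi> x)"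
      by (rule integral_completion[symmetric]) simp
    also have "\<dots> = (LINT x|lebesgue. f x * \<phi> x)"
    proof (rule integral_cong_AE)
      show "(\<lambda>x. f' x * \<phi> x) \<in> borel_measurable lebesgue" by (rule measurable_completion) simp
      have "\<phi> \<in> borel_measurable lebesgue" by (rule measurable_completion) simp
      then show "(\<lambda>x. f x * \<phi> x) \<in> borel_measurable lebesgue" using f by (intro borel_measurable_times) auto
    qed (use ff'' in \<open>auto elim: AE_mp\<close>)
    finally show ?thesis using z[OF that] by simp
  qed
  have box0: "(LINT x:box a b|lborel. f' x) = 0" if "cbox a b \<subseteq> \<Omega>" for a b
  proof -
    have "(\<lambda>n. LINT x|lborel. f' x * box_bump a b n x) \<longlonglongrightarrow> (LINT x|lborel. f' x * indicator (box a b) x)"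
    proof (rule integral_dominated_convergence)
      show "integrable lborel (\<lambda>x. \<bar>f' x\<bar>)" using i' by simp
      show "(\<lambda>x. f' x * box_bump a b n x) \<in> borel_measurable lborel" for n
      proof -
        have "continuous_on UNIV (box_bump a b n)" using Ck_box_bump[of 0 a b n] by simp
        then have [measurable]: "box_bump a b n \<in> borel_measurable borel"
            by (rule borel_measurable_continuous_onI)
        show ?thesis by simp
      qed
      show "AE x in lborel. (\<lambda>n. f' x * box_bump a b n x) \<longlonglongrightarrow> f' x * indicator (box a b) x"
        by (intro AE_I2 tendsto_mult tendsto_const box_bump_tendsto)
      show "AE x in lborel. norm (f' x * box_bump a b n x) \<le> \<bar>f' x\<bar>" for n
        using box_bump_range[of a b n] by (auto simp: abs_mult mult_left_le)
    qed (auto)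
    then have "(LINT x|lborel. f' x * indicator (box a b) x) = 0"
      using z'[OF box_bump_test[OF that]] by (simp add: LIMSEQ_const_iff)
    then show ?thesis by (simp add: set_lebesgue_integral_def mult.commute)
  qed
  have cb: "AE x in lborel. x \<in> cbox c d \<longrightarrow> f' x = 0" if cd: "cbox c d \<subseteq> \<Omega>" for c d
  proof -
    let ?h = "\<lambda>x. indicator (box c d) x *\<^sub>R f' x"
    have "AE x in lborel. ?h x = 0"
    proof (rule AE_zero_if_box_integrals_zero)
      show "integrable lborel ?h" using i' by (intro integrable_mult_indicator) auto
      show "?h x = 0" if "x \<notin> box c d" for x using that by simp
      fix a b
      obtain a' b' where ab: "box a b \<inter> box c d = box a' b'" "cbox a' b' \<subseteq> cbox c d"
        by (rule that[OF box_Int_box]) (auto simp: mem_box)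
      have "(LINT x:box a b|lborel. ?h x) = (LINT x:box a b \<inter> box c d|lborel. f' x)"
        unfolding set_lebesgue_integral_def by (simp add: indicator_inter_arith mult.assoc)
      also have "\<dots> = 0" unfolding ab(1) using ab(2) cd by (intro box0) auto
      finally show "(LINT x:box a b|lborel. ?h x) = 0" .
    qed
    moreover have "AE x in lborel. x \<notin> cbox c d - box c d"
      using negligible_frontier_interval[of c d]
      by (intro AE_not_in) (simp add: negligible_iff_null_sets null_sets_completion_iff)
    ultimately show ?thesis by eventually_elim (auto simp: indicator_def split: if_splits)
  qed
  obtain D where D: "countable D" "\<And>X. X \<in> D \<Longrightarrow> \<exists>a b. X = cbox a b" "D \<subseteq> Pow \<Omega>" "\<Union>D = \<Omega>"
    using open_countable_Union_open_cbox[OF \<Omega>] by metis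
  have "AE x in lborel. \<forall>X\<in>D. x \<in> X \<longrightarrow> f' x = 0"
  proof (subst AE_ball_countable[OF D(1)], rule ballI)
    fix X assume X: "X \<in> D"
    then obtain c d where "X = cbox c d" using D(2) by blast
    with X D(3) cb[of c d] show "AE x in lborel. x \<in> X \<longrightarrow> f' x = 0" by auto
  qed
  then have "AE x in lborel. x \<in> \<Omega> \<longrightarrow> f' x = 0"
    by eventually_elim (use D(4) in auto)
  then have "AE x in lebesgue. x \<in> \<Omega> \<longrightarrow> f' x = 0" by (rule AE_completion)
  with ff'' show ?thesis by eventually_elim auto
qed


section \<open>Translation estimates and their consequences\<close>

lemma C1c_borel:
  assumes "C1c v g"
  shows "v \<in> borel_measurable borel" "g \<in> borel_measurable borel"
  using C1c_continuous[OF assms] by (auto intro: borel_measurable_continuous_onI)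

lemma C1c_integrable:
  fixes v :: "'a::euclidean_space \<Rightarrow> real"
  assumes v: "C1c v g"
  shows "integrable lborel v" "integrable lborel (\<lambda>x. (v x)\<^sup>2)" "integrable lborel (\<lambda>x. (norm (g x))\<^sup>2)"
    "0 < p \<Longrightarrow> integrable lborel (\<lambda>x. \<bar>v x\<bar> powr p)"
proof -
  note C1c_continuous[OF v]
  moreover obtain R where "R > 0" "\<And>x. R < norm x \<Longrightarrow> v x = 0" "\<And>x. R < norm x \<Longrightarrow> g x = 0"
    using C1c_support[OF v] by blast
  ultimately show "integrable lborel v" "integrable lborel (\<lambda>x. (v x)\<^sup>2)" "integrable lborel (\<lambda>x. (norm (g
      x))\<^sup>2)"
    "0 < p \<Longrightarrow> integrable lborel (\<lambda>x. \<bar>v x\<bar> powr p)"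
    by (auto intro!: integrable_continuous_bounded_support(1)[where R=R] continuous_intros
        continuous_on_powr')
qed

text \<open>\<open>F 1 - F 0\<close> is the mean of \<open>f\<close> over the unit interval, and the
  variance of \<open>f\<close> is nonnegative; this is the Cauchy-Schwarz inequality for
  \<open>f\<close> and the constant 1.\<close>

lemma power2_diff_le_integral:
  fixes F :: "real \<Rightarrow> real"
  assumes d: "\<And>t. DERIV F t :> f t" and c: "continuous_on UNIV f"
  shows "(F 1 - F 0)\<^sup>2 \<le> (LINT t|lborel. (f t)\<^sup>2 * indicator {0..1} t)"
proof -
  define D where "D = F 1 - F 0"
  have ct: "isCont f t" for t using c by (simp add: continuous_on_eq_continuous_at)
  have 1: "integrable lborel (\<lambda>t. f t * indicator {0..1} t)" "(LINT t|lborel. f t * indicator {0..1} t) = D"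
    using has_bochner_integral_FTC_Icc_real[of 0 1 F f] d ct by (auto simp: has_bochner_integral_iff D_def)
  have 2: "integrable lborel (\<lambda>t. (f t)\<^sup>2 * indicator {0..1} t)"
    using borel_integrable_compact[of "{0..1::real}" "\<lambda>t. (f t)\<^sup>2"] c
    by (simp add: mult.commute continuous_on_power continuous_on_subset)
  have 3: "integrable lborel (indicat_real {0..1::real})" "(LINT t|lborel. indicat_real {0..1::real} t) = 1"
    by auto
  have "0 \<le> (LINT t|lborel. (f t - D)\<^sup>2 * indicator {0..1} t)"
    by (intro Bochner_Integration.integral_nonneg) simp
  also have "\<dots> = (LINT t|lborel. (f t)\<^sup>2 * indicator {0..1} t - 2 * D * (f t * indicator {0..1} t) +
      D\<^sup>2 * indicator {0..1} t)"
    by (intro Bochner_Integration.integral_cong) (auto simp: power2_eq_square algebra_simps)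
  also have "\<dots> = (LINT t|lborel. (f t)\<^sup>2 * indicator {0..1} t) - 2 * D * D + D\<^sup>2"
    using 1 2 3 by simp
  finally show ?thesis unfolding D_def[symmetric] by (simp add: power2_eq_square)
qed

lemma nn_lborel_translate:
  fixes f :: "'a::euclidean_space \<Rightarrow> ennreal"
  assumes [measurable]: "f \<in> borel_measurable borel"
  shows "(\<integral>\<^sup>+x. f (x + c) \<partial>lborel) = (\<integral>\<^sup>+x. f x \<partial>lborel)"
proof -
  have "(\<integral>\<^sup>+x. f x \<partial>distr lborel borel ((+) c)) = (\<integral>\<^sup>+x. f (c + x) \<partial>lborel)"
    by (rule nn_integral_distr) auto
  then show ?thesis by (simp add: lborel_distr_plus add.commute)
qed

text \<open>The one-dimensional estimate is used on the segment from \<open>x\<close> to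
  \<open>x + h\<close>. After exchanging the integrals, translation invariance makes the integral
  over \<open>x\<close> independent of the position \<open>t\<close> on the segment. Nonnegative
  integrals are used so that the exchange asks for measurability only.\<close>

lemma C1c_translation_estimate:
  fixes v :: "'a::euclidean_space \<Rightarrow> real"
  assumes v: "C1c v g"
  shows "(\<integral>\<^sup>+x. ennreal ((v (x + h) - v x)\<^sup>2) \<partial>lborel)
      \<le> ennreal ((norm h)\<^sup>2 * (LINT x|lborel. (norm (g x))\<^sup>2))"
proof -
  note [measurable] = C1c_borel[OF v]
  have gc: "continuous_on UNIV g" by (rule C1c_continuous(2)[OF v])
  let ?k = "\<lambda>x t. ennreal ((norm h)\<^sup>2 * (norm (g (x + t *\<^sub>R h)))\<^sup>2) * indicator {0..1::real} t"
  have pt: "ennreal ((v (x + h) - v x)\<^sup>2) \<le> (\<integral>\<^sup>+t. ?k x t \<partial>lborel)" for x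
  proof -
    have "((\<lambda>t. v (x + t *\<^sub>R h)) has_real_derivative g (x + t *\<^sub>R h) \<bullet> h) (at t)" for t
    proof -
      have "((\<lambda>t. v (x + t *\<^sub>R h)) has_derivative (\<lambda>s. g (x + t *\<^sub>R h) \<bullet> (s *\<^sub>R h))) (at t)"
        by (rule has_derivative_compose[where f="\<lambda>t. x + t *\<^sub>R h" and f'="\<lambda>t. t *\<^sub>R h" and g=v])
          (auto intro!: derivative_eq_intros C1c_has_derivative[OF v])
      then show ?thesis by (rule has_derivative_imp_has_field_derivative) simp
    qed
    moreover have c: "continuous_on UNIV (\<lambda>t. g (x + t *\<^sub>R h) \<bullet> h)"
      by (intro continuous_intros continuous_on_compose2[OF gc]) auto
    ultimately have "(v (x + 1 *\<^sub>R h) - v (x + 0 *\<^sub>R h))\<^sup>2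
        \<le> (LINT t|lborel. (g (x + t *\<^sub>R h) \<bullet> h)\<^sup>2 * indicator {0..1} t)"
      by (rule power2_diff_le_integral)
    then have "ennreal ((v (x + h) - v x)\<^sup>2) \<le> ennreal (LINT t|lborel. (g (x +
        t *\<^sub>R h) \<bullet> h)\<^sup>2 * indicator {0..1} t)"
      by (intro ennreal_leI) simp
    also have "\<dots> = (\<integral>\<^sup>+t. ennreal ((g (x + t *\<^sub>R h) \<bullet> h)\<^sup>2 * indicator {0..1} t) \<partial>lborel)"
    proof (rule nn_integral_eq_integral[symmetric])
      show "integrable lborel (\<lambda>t. (g (x + t *\<^sub>R h) \<bullet> h)\<^sup>2 * indicator {0..1::real} t)"
        using borel_integrable_compact[of "{0..1::real}" "\<lambda>t. (g (x + t *\<^sub>R h) \<bullet> h)\<^sup>2"] c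
        by (simp add: mult.commute continuous_on_power continuous_on_subset)
    qed simp
    also have "\<dots> \<le> (\<integral>\<^sup>+t. ?k x t \<partial>lborel)"
    proof (intro nn_integral_mono)
      fix t :: real
      have "\<bar>g (x + t *\<^sub>R h) \<bullet> h\<bar> \<le> norm (g (x + t *\<^sub>R h)) * norm h" by (rule Cauchy_Schwarz_ineq2)
      then have "\<bar>g (x + t *\<^sub>R h) \<bullet> h\<bar>\<^sup>2 \<le> (norm (g (x + t *\<^sub>R h)) * norm h)\<^sup>2" by (rule power_mono) simp
      then show "ennreal ((g (x + t *\<^sub>R h) \<bullet> h)\<^sup>2 * indicator {0..1} t) \<le> ?k x t"
        by (auto simp: power_mult_distrib mult.commute indicator_def intro!: ennreal_leI)
    qed
    finally show ?thesis .
  qed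
  have "(\<integral>\<^sup>+x. ennreal ((v (x + h) - v x)\<^sup>2) \<partial>lborel) \<le> (\<integral>\<^sup>+x. (\<integral>\<^sup>+t. ?k x t \<partial>lborel) \<partial>lborel)"
    using pt by (intro nn_integral_mono) auto
  also have "\<dots> = (\<integral>\<^sup>+t. (\<integral>\<^sup>+x. ?k x t \<partial>lborel) \<partial>lborel)"
    by (rule lborel_pair.Fubini'[symmetric]) measurable
  also have "\<dots> = (\<integral>\<^sup>+t. ennreal ((norm h)\<^sup>2 * (LINT x|lborel. (norm (g x))\<^sup>2)) *
      indicator {0..1::real} t \<partial>lborel)"
  proof (rule nn_integral_cong)
    fix t :: real
    have "(\<integral>\<^sup>+x. ?k x t \<partial>lborel) = (\<integral>\<^sup>+x. ennreal ((norm h)\<^sup>2 * (norm (g (x +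
        t *\<^sub>R h)))\<^sup>2) \<partial>lborel) * indicator {0..1::real} t"
      by (rule nn_integral_multc) measurable
    also have "(\<integral>\<^sup>+x. ennreal ((norm h)\<^sup>2 * (norm (g (x + t *\<^sub>R h)))\<^sup>2) \<partial>lborel) =
        (\<integral>\<^sup>+x. ennreal ((norm h)\<^sup>2 * (norm (g x))\<^sup>2) \<partial>lborel)"
      by (rule nn_lborel_translate[of "\<lambda>x. ennreal ((norm h)\<^sup>2 * (norm (g x))\<^sup>2)"]) measurable
    also have "\<dots> = ennreal (LINT x|lborel. (norm h)\<^sup>2 * (norm (g x))\<^sup>2)"
      using C1c_integrable(3)[OF v] by (intro nn_integral_eq_integral) auto
    finally show "(\<integral>\<^sup>+x. ?k x t \<partial>lborel) =
        ennreal ((norm h)\<^sup>2 * (LINT x|lborel. (norm (g x))\<^sup>2)) * indicator {0..1::real} t" by simp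
  qed
  also have "\<dots> = ennreal ((norm h)\<^sup>2 * (LINT x|lborel. (norm (g x))\<^sup>2))"
    by (subst nn_integral_cmult_indicator) auto
  finally show ?thesis .
qed

lemma C1c_poincare:
  fixes v :: "'a::euclidean_space \<Rightarrow> real"
  assumes v: "C1c v g" and supp: "\<And>x. R < norm x \<Longrightarrow> v x = 0" and R: "0 \<le> R"
  shows "(LINT x|lborel. (v x)\<^sup>2) \<le> (2 * R + 1)\<^sup>2 * (LINT x|lborel. (norm (g x))\<^sup>2)"
proof -
  obtain e :: 'a where e: "e \<in> Basis" using nonempty_Basis by blast
  \<comment> \<open>A shift by more than the diameter moves the ball of radius \<open>R\<close> off
    itself, so one of the two terms of the difference is always zero.\<close>
  define h where "h = (2 * R + 1) *\<^sub>R e"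
  have nh: "norm h = 2 * R + 1" using e R by (simp add: h_def)
  have "(v x)\<^sup>2 \<le> (v (x + h) - v x)\<^sup>2" for x
  proof (cases "norm x \<le> R")
    case True
    then have "R < norm (x + h)" using norm_triangle_ineq4[of "x + h" x] nh R by simp
    then show ?thesis by (simp add: supp)
  next
    case False
    then show ?thesis by (simp add: supp)
  qed
  then have "(\<integral>\<^sup>+x. ennreal ((v x)\<^sup>2) \<partial>lborel) \<le> (\<integral>\<^sup>+x. ennreal ((v (x + h) - v x)\<^sup>2) \<partial>lborel)"
    by (intro nn_integral_mono ennreal_leI) auto
  also have "\<dots> \<le> ennreal ((norm h)\<^sup>2 * (LINT x|lborel. (norm (g x))\<^sup>2))"
    by (rule C1c_translation_estimate[OF v])
  finally show ?thesis
    by (intro integral_real_bounded) (simp_all add: nh)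
qed

lemma C1c_ball_translation_estimate:
  fixes v :: "'a::euclidean_space \<Rightarrow> real"
  assumes v: "C1c v g" and r: "r > 0"
  shows "(\<integral>\<^sup>+x. (\<integral>\<^sup>+h. ennreal ((v (x + h) - v x)\<^sup>2) * indicator (ball 0 r) h \<partial>lborel) \<partial>lborel)
    \<le> ennreal (measure lborel (ball (0::'a) r) * (r\<^sup>2 * (LINT x|lborel. (norm (g x))\<^sup>2)))"
proof -
  note [measurable] = C1c_borel[OF v]
  have [measurable]: "ball (0::'a) r \<in> sets borel" by simp
  let ?G = "LINT x|lborel. (norm (g x))\<^sup>2"
  have "(\<integral>\<^sup>+x. (\<integral>\<^sup>+h. ennreal ((v (x + h) - v x)\<^sup>2) * indicator (ball 0 r) h \<partial>lborel) \<partial>lborel)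
      = (\<integral>\<^sup>+h. (\<integral>\<^sup>+x. ennreal ((v (x + h) - v x)\<^sup>2) * indicator (ball 0 r) h \<partial>lborel) \<partial>lborel)"
    by (rule lborel_pair.Fubini'[symmetric]) measurable
  also have "\<dots> \<le> (\<integral>\<^sup>+h. ennreal (r\<^sup>2 * ?G) * indicator (ball (0::'a) r) h \<partial>lborel)"
  proof (intro nn_integral_mono)
    fix h :: 'a
    have "(\<integral>\<^sup>+x. ennreal ((v (x + h) - v x)\<^sup>2) * indicator (ball 0 r) h \<partial>lborel)
        = (\<integral>\<^sup>+x. ennreal ((v (x + h) - v x)\<^sup>2) \<partial>lborel) * indicator (ball 0 r) h"
      by (rule nn_integral_multc) measurable
    also have "\<dots> \<le> ennreal (r\<^sup>2 * ?G) * indicator (ball 0 r) h"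
    proof (cases "h \<in> ball 0 r")
      case True
      then have "(norm h)\<^sup>2 * ?G \<le> r\<^sup>2 * ?G"
        by (intro mult_right_mono power_mono) auto
      then have "ennreal ((norm h)\<^sup>2 * ?G) \<le> ennreal (r\<^sup>2 * ?G)" by (rule ennreal_leI)
      with C1c_translation_estimate[OF v, of h]
      have "(\<integral>\<^sup>+x. ennreal ((v (x + h) - v x)\<^sup>2) \<partial>lborel) \<le> ennreal (r\<^sup>2 * ?G)" by (rule order_trans)
      with True show ?thesis by simp
    qed simp
    finally show "(\<integral>\<^sup>+x. ennreal ((v (x + h) - v x)\<^sup>2) * indicator (ball 0 r) h \<partial>lborel)
      \<le> ennreal (r\<^sup>2 * ?G) * indicator (ball 0 r) h" .
  qed
  also have "\<dots> = ennreal (r\<^sup>2 * ?G) * emeasure lborel (ball (0::'a) r)"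
    by (rule nn_integral_cmult_indicator) simp
  also have "\<dots> = ennreal (measure lborel (ball (0::'a) r) * (r\<^sup>2 * ?G))"
    using emeasure_lborel_ball_finite[of "0::'a" r]
    by (simp add: emeasure_eq_ennreal_measure ennreal_mult' mult.commute)
  finally show ?thesis .
qed

text \<open>For every point of \<open>B\<close> at least half of the ball is translated out of the support of \<open>v\<close>.\<close>

lemma C1c_level_estimate:
  fixes v :: "'a::euclidean_space \<Rightarrow> real"
  assumes v: "C1c v g" and A[measurable]: "A \<in> sets borel" and Af: "emeasure lborel A < \<infinity>"
    and B[measurable]: "B \<in> sets borel" and BA: "B \<subseteq> A"
    and vA: "\<And>x. x \<notin> A \<Longrightarrow> v x = 0" and vB: "\<And>x. x \<in> B \<Longrightarrow> v x = 1"
    and r: "r > 0" and mr: "measure lborel (ball (0::'a) r) = 2 * measure lborel A"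
  shows "measure lborel B \<le> 2 * r\<^sup>2 * (LINT x|lborel. (norm (g x))\<^sup>2)"
proof -
  note [measurable] = C1c_borel[OF v]
  define \<alpha> where "\<alpha> = measure lborel A"
  have "measure lborel (ball (0::'a) r) > 0" using r by (simp add: content_ball_gt_0_iff)
  then have \<alpha>: "\<alpha> > 0" using mr by (simp add: \<alpha>_def)
  have eA: "emeasure lborel A = ennreal \<alpha>" using Af by (simp add: \<alpha>_def emeasure_eq_ennreal_measure)
  have "emeasure lborel B \<le> emeasure lborel A" using BA by (intro emeasure_mono) auto
  with Af have eB: "emeasure lborel B = ennreal (measure lborel B)"
    by (intro emeasure_eq_ennreal_measure) (auto simp: top_unique)
  have eb: "emeasure lborel (ball (0::'a) r) = ennreal (2 * \<alpha>)"
    using emeasure_lborel_ball_finite[of "0::'a" r] mr by (simp add: emeasure_eq_ennreal_measure \<alpha>_def)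
  have half: "ennreal \<alpha> \<le> (\<integral>\<^sup>+h. ennreal ((v (x + h) - v x)\<^sup>2) * indicator (ball 0 r) h \<partial>lborel)"
      if x: "x \<in> B" for x
  proof -
    let ?T = "{h. h + x \<in> A}"
    have T[measurable]: "?T \<in> sets lborel" by measurable
    have "(\<integral>\<^sup>+h. indicator A (h + x) \<partial>lborel) = (\<integral>\<^sup>+h. indicator A h \<partial>lborel)"
      by (rule nn_lborel_translate) measurable
    moreover have "(\<integral>\<^sup>+h. indicator A (h + x) \<partial>lborel) = (\<integral>\<^sup>+h. indicator ?T h \<partial>lborel)"
      by (intro nn_integral_cong) (auto simp: indicator_def)
    ultimately have eT: "emeasure lborel ?T = ennreal \<alpha>" using eA T by simp
    have "ennreal (2 * \<alpha>) \<le> emeasure lborel (?T \<union> (ball 0 r - ?T))"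
      unfolding eb[symmetric] by (intro emeasure_mono) auto
    also have "\<dots> \<le> emeasure lborel ?T + emeasure lborel (ball 0 r - ?T)"
      by (intro emeasure_subadditive) auto
    finally have "ennreal \<alpha> + ennreal \<alpha> \<le> ennreal \<alpha> + emeasure lborel (ball 0 r - ?T)"
      using \<alpha> by (simp add: eT flip: ennreal_plus)
    then have "ennreal \<alpha> \<le> emeasure lborel (ball 0 r - ?T)"
      by (simp add: ennreal_add_left_cancel_le)
    also have "\<dots> = (\<integral>\<^sup>+h. indicator (ball 0 r - ?T) h \<partial>lborel)" by simp
    also have "\<dots> \<le> (\<integral>\<^sup>+h. ennreal ((v (x + h) - v x)\<^sup>2) * indicator (ball 0 r) h \<partial>lborel)"
      using vA vB[OF x] by (intro nn_integral_mono) (auto simp: indicator_def add.commute)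
    finally show ?thesis .
  qed
  have "ennreal (\<alpha> * measure lborel B) = (\<integral>\<^sup>+x. ennreal \<alpha> * indicator B x \<partial>lborel)"
    using \<alpha> eB by (subst nn_integral_cmult_indicator) (auto simp: ennreal_mult')
  also have "\<dots> \<le> (\<integral>\<^sup>+x. (\<integral>\<^sup>+h. ennreal ((v (x + h) - v x)\<^sup>2) * indicator (ball 0 r) h \<partial>lborel) \<partial>lborel)"
    using half by (intro nn_integral_mono) (auto simp: indicator_def)
  also have "\<dots> \<le> ennreal (2 * \<alpha> * (r\<^sup>2 * (LINT x|lborel. (norm (g x))\<^sup>2)))"
    using C1c_ball_translation_estimate[OF v r] mr by (simp add: \<alpha>_def)
  finally have "\<alpha> * measure lborel B \<le> 2 * \<alpha> * (r\<^sup>2 * (LINT x|lborel. (norm (g x))\<^sup>2))"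
    using \<alpha> by (subst (asm) ennreal_le_iff) auto
  then have "\<alpha> * measure lborel B \<le> \<alpha> * (2 * r\<^sup>2 * (LINT x|lborel. (norm (g x))\<^sup>2))"
      by (simp add: algebra_simps)
  with \<alpha> show ?thesis by simp
qed

text \<open>Expanding \<open>(v(x + h) - v(x))^2\<close> and dropping the term
  \<open>v(x + h)^2\<close> bounds it below by \<open>v(x)^2 - 2 v(x + h) v(x)\<close>. Integration
  over the ball of shifts turns the mixed term into \<open>v x * M x\<close>, where \<open>M\<close>
  is an unnormalised ball mean.\<close>

lemma C1c_l2_estimate_by_means:
  fixes v :: "'a::euclidean_space \<Rightarrow> real"
  assumes v: "C1c v g" and r: "r > 0"
  defines "M \<equiv> (\<lambda>x. LINT h|lborel. v (x + h) * indicator (ball 0 r) h)"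
  shows "measure lborel (ball (0::'a) r) * (LINT x|lborel. (v x)\<^sup>2) \<le>
    measure lborel (ball (0::'a) r) * (r\<^sup>2 * (LINT x|lborel. (norm (g x))\<^sup>2)) +
        2 * (LINT x|lborel. v x * M x)"
    and "integrable lborel (\<lambda>x. v x * M x)" "M \<in> borel_measurable borel"
proof -
  note [measurable] = C1c_borel[OF v]
  have [measurable]: "ball (0::'a) r \<in> sets borel" by simp
  let ?b = "measure lborel (ball (0::'a) r)"
  have bi: "integrable lborel (indicat_real (ball (0::'a) r))"
    using emeasure_lborel_ball_finite[of "0::'a" r] by simp
  obtain R where R: "R > 0" "\<And>x. R < norm x \<Longrightarrow> v x = 0" "\<And>x. R < norm x \<Longrightarrow> g x = 0"
    using C1c_support[OF v] by blast
  obtain K where K: "K > 0" "\<And>x. norm (v x) \<le> K"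
    using bounded_continuous_bounded_support[OF C1c_continuous(1)[OF v] R(2)] by blast
  have ib: "integrable lborel (\<lambda>h. f (v (x + h)) * indicator (ball 0 r) h)"
    if f: "f \<in> borel_measurable borel" and L: "\<And>y. norm y \<le> K \<Longrightarrow> \<bar>f y\<bar> \<le> L" for f :: "real \<Rightarrow> real" and L x
  proof (rule Bochner_Integration.integrable_bound)
    show "integrable lborel (\<lambda>h. L * indicat_real (ball (0::'a) r) h)" using bi by simp
    note [measurable] = f
    show "(\<lambda>h. f (v (x + h)) * indicator (ball 0 r) h) \<in> borel_measurable lborel" by measurable
    have "\<bar>f (v (x + h))\<bar> \<le> \<bar>L\<bar>" for h using L[OF K(2)[of "x + h"]] by linarith
    then show "AE h in lborel. norm (f (v (x + h)) * indicator (ball 0 r) h)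
        \<le> norm (L * indicat_real (ball 0 r) h)"
      by (auto simp: indicator_def)
  qed
  have i1: "integrable lborel (\<lambda>h. v (x + h) * indicator (ball 0 r) h)" for x
    using ib[of "\<lambda>y. y" K] by auto
  have i2: "integrable lborel (\<lambda>h. (v (x + h) - v x)\<^sup>2 * indicator (ball 0 r) h)" for x
  proof (rule ib)
    show "\<bar>(y - v x)\<^sup>2\<bar> \<le> (K + K)\<^sup>2" if "norm y \<le> K" for y
    proof -
      have "\<bar>y - v x\<bar> \<le> K + K" using that K(2)[of x] by auto
      then have "\<bar>y - v x\<bar>\<^sup>2 \<le> (K + K)\<^sup>2" by (rule power_mono) simp
      then show ?thesis by simp
    qed
  qed measurable
  have i3: "integrable lborel (\<lambda>h. (v (x + h))\<^sup>2 * indicator (ball 0 r) h)" for x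
  proof (rule ib)
    show "\<bar>y\<^sup>2\<bar> \<le> K\<^sup>2" if "norm y \<le> K" for y
      using power_mono[OF that, of 2] by simp
  qed measurable
  show Mm[measurable]: "M \<in> borel_measurable borel"
    unfolding M_def by measurable
  have Mb: "\<bar>M x\<bar> \<le> K * ?b" for x
  proof -
    have "norm (M x) \<le> (LINT h|lborel. norm (v (x + h) * indicator (ball 0 r) h))"
      unfolding M_def by (rule Bochner_Integration.integral_norm_bound)
    also have "\<dots> \<le> (LINT h|lborel. K * indicat_real (ball (0::'a) r) h)"
    proof (rule Bochner_Integration.integral_mono)
      show "integrable lborel (\<lambda>h. norm (v (x + h) * indicator (ball 0 r) h))"
          using i1 by (rule integrable_norm)
      show "integrable lborel (\<lambda>h. K * indicat_real (ball (0::'a) r) h)" using bi by simp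
      show "norm (v (x + h) * indicator (ball 0 r) h) \<le> K * indicat_real (ball 0 r) h" for h
        using K by (simp add: indicator_def)
    qed
    finally show ?thesis by simp
  qed
  show vM: "integrable lborel (\<lambda>x. v x * M x)"
  proof (rule Bochner_Integration.integrable_bound)
    show "integrable lborel (\<lambda>x. (K * ?b) * v x)" using C1c_integrable(1)[OF v] by simp
    have "\<bar>v x\<bar> * \<bar>M x\<bar> \<le> \<bar>K * ?b\<bar> * \<bar>v x\<bar>" for x
      using mult_left_mono[OF order_trans[OF Mb[of x] abs_ge_self], of "\<bar>v x\<bar>"] by (simp add: mult.commute)
    then show "AE x in lborel. norm (v x * M x) \<le> norm ((K * ?b) * v x)"
      by (simp add: abs_mult mult.assoc)
  qed measurable
  have pt: "ennreal (?b * (v x)\<^sup>2 - 2 * (v x * M x))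
      \<le> (\<integral>\<^sup>+h. ennreal ((v (x + h) - v x)\<^sup>2) * indicator (ball 0 r) h \<partial>lborel)" for x
  proof -
    have "?b * (v x)\<^sup>2 - 2 * (v x * M x) \<le> (LINT h|lborel. (v (x + h))\<^sup>2 * indicator (ball 0 r) h) +
        ?b * (v x)\<^sup>2 - 2 * (v x * M x)"
      by (simp add: Bochner_Integration.integral_nonneg)
    also have "\<dots> = (LINT h|lborel. (v (x + h))\<^sup>2 * indicator (ball 0 r) h + (v x)\<^sup>2 * indicator (ball 0 r) h
        - 2 * v x * (v (x + h) * indicator (ball 0 r) h))"
      using i1[of x] i3[of x] bi by (simp add: M_def)
    also have "\<dots> = (LINT h|lborel. (v (x + h) - v x)\<^sup>2 * indicator (ball 0 r) h)"
      by (intro Bochner_Integration.integral_cong) (auto simp: power2_eq_square algebra_simps)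
    finally have "ennreal (?b * (v x)\<^sup>2 - 2 * (v x * M x))
        \<le> ennreal (LINT h|lborel. (v (x + h) - v x)\<^sup>2 * indicator (ball 0 r) h)"
      by (rule ennreal_leI)
    also have "\<dots> = (\<integral>\<^sup>+h. ennreal ((v (x + h) - v x)\<^sup>2 * indicator (ball 0 r) h) \<partial>lborel)"
      by (rule nn_integral_eq_integral[symmetric, OF i2]) simp
    also have "\<dots> = (\<integral>\<^sup>+h. ennreal ((v (x + h) - v x)\<^sup>2) * indicator (ball 0 r) h \<partial>lborel)"
      by (intro nn_integral_cong) (auto simp: indicator_def)
    finally show ?thesis .
  qed
  have "(\<integral>\<^sup>+x. ennreal (?b * (v x)\<^sup>2 - 2 * (v x * M x)) \<partial>lborel)
      \<le> ennreal (?b * (r\<^sup>2 * (LINT x|lborel. (norm (g x))\<^sup>2)))"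
    by (rule order_trans[OF nn_integral_mono[OF pt] C1c_ball_translation_estimate[OF v r]])
  then have "(LINT x|lborel. ?b * (v x)\<^sup>2 - 2 * (v x * M x)) \<le> ?b * (r\<^sup>2 * (LINT x|lborel. (norm (g x))\<^sup>2))"
    by (intro integral_real_bounded) (simp_all add: measure_nonneg)
  moreover have "(LINT x|lborel. ?b * (v x)\<^sup>2 - 2 * (v x * M x)) =
      ?b * (LINT x|lborel. (v x)\<^sup>2) - 2 * (LINT x|lborel. v x * M x)"
    using vM C1c_integrable(2)[OF v] by simp
  ultimately show "?b * (LINT x|lborel. (v x)\<^sup>2)
      \<le> ?b * (r\<^sup>2 * (LINT x|lborel. (norm (g x))\<^sup>2)) + 2 * (LINT x|lborel. v x * M x)"
    by linarith
qed


section \<open>Rellich compactness for functions of class C1\<close>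

lemma C1c_l2_fun:
  assumes "C1c v g"
  shows "v \<in> l2_fun" "g \<in> l2_fun"
proof -
  note [measurable] = C1c_borel[OF assms]
  show "v \<in> l2_fun" "g \<in> l2_fun"
    using C1c_integrable(2,3)[OF assms] unfolding l2_fun_def
    by (auto simp: integrable_completion intro!: measurable_completion)
qed

lemma C1c_norm_abs_l2:
  assumes "C1c v g"
  shows "(norm (abs_l2 v))\<^sup>2 = (LINT x|lborel. (v x)\<^sup>2)" "(norm (abs_l2 g))\<^sup>2 =
      (LINT x|lborel. (norm (g x))\<^sup>2)"
proof -
  note [measurable] = C1c_borel[OF assms]
  show "(norm (abs_l2 v))\<^sup>2 = (LINT x|lborel. (v x)\<^sup>2)" "(norm (abs_l2 g))\<^sup>2 =
      (LINT x|lborel. (norm (g x))\<^sup>2)"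
    by (simp_all add: norm_abs_l2 C1c_l2_fun[OF assms] integral_completion)
qed

text \<open>Means over small balls converge pointwise under weak convergence, and approximate the functions
  uniformly in the mean square.\<close>

lemma C1c_rellich:
  fixes v :: "nat \<Rightarrow> 'a::euclidean_space \<Rightarrow> real"
  assumes v: "\<And>n. C1c (v n) (g n)" and supp: "\<And>n x. R < norm x \<Longrightarrow> v n x = 0" and R: "0 \<le> R"
    and C: "\<And>n. norm (abs_l2 (g n)) \<le> C"
    and weak: "\<And>w. (\<lambda>n. abs_l2 (v n) \<bullet> w) \<longlonglongrightarrow> 0"
  shows "(\<lambda>n. norm (abs_l2 (v n))) \<longlonglongrightarrow> 0"
proof -
  have C0: "0 \<le> C" using C[of 0] norm_ge_zero order_trans by blast
  define P where "P = (2 * R + 1) * C"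
  have P0: "P \<ge> 0" using R C0 by (simp add: P_def)
  have VP: "norm (abs_l2 (v n)) \<le> P" for n
  proof (rule power2_le_imp_le)
    have "(norm (abs_l2 (v n)))\<^sup>2 \<le> (2 * R + 1)\<^sup>2 * (norm (abs_l2 (g n)))\<^sup>2"
      using C1c_poincare[OF v supp R, of n] by (simp add: C1c_norm_abs_l2[OF v])
    also have "\<dots> \<le> (2 * R + 1)\<^sup>2 * C\<^sup>2" using C by (intro mult_left_mono power_mono) auto
    finally show "(norm (abs_l2 (v n)))\<^sup>2 \<le> P\<^sup>2" by (simp add: P_def power_mult_distrib)
  qed (rule P0)
  have main: "\<forall>\<^sub>F n in sequentially. (norm (abs_l2 (v n)))\<^sup>2 < \<epsilon>" if \<epsilon>: "\<epsilon> > 0" for \<epsilon>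
  proof -
    \<comment> \<open>The radius at which replacing \<open>v n\<close> by its ball means costs less
      than half of \<epsilon>, uniformly in \<open>n\<close>. The summand 1 in the denominator
      covers \<open>C = 0\<close>.\<close>
    obtain r where r: "r > 0" "r\<^sup>2 * C\<^sup>2 < \<epsilon> / 2"
    proof (rule that[of "sqrt (\<epsilon> / (4 * (C\<^sup>2 + 1)))"])
      have p: "C\<^sup>2 + 1 > 0" by (simp add: add_nonneg_pos)
      then show "sqrt (\<epsilon> / (4 * (C\<^sup>2 + 1))) > 0" using \<epsilon> by simp
      have "(sqrt (\<epsilon> / (4 * (C\<^sup>2 + 1))))\<^sup>2 * C\<^sup>2 = \<epsilon> / 4 * (C\<^sup>2 / (C\<^sup>2 + 1))"
        using p \<epsilon> by simp
      also have "\<dots> \<le> \<epsilon> / 4 * 1" using p \<epsilon> by (intro mult_left_mono) (auto simp: divide_le_eq)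
      also have "\<dots> < \<epsilon> / 2" using \<epsilon> by simp
      finally show "(sqrt (\<epsilon> / (4 * (C\<^sup>2 + 1))))\<^sup>2 * C\<^sup>2 < \<epsilon> / 2" .
    qed
    define b where "b = measure lborel (ball (0::'a) r)"
    have b: "b > 0" using r by (simp add: b_def content_ball_gt_0_iff)
    define M where "M n x = (LINT h|lborel. v n (x + h) * indicator (ball 0 r) h)" for n x
    have Mm[measurable]: "M n \<in> borel_measurable borel" for n
      using C1c_l2_estimate_by_means(3)[OF v r(1)] unfolding M_def .
    \<comment> \<open>The mean \<open>M n x\<close> is the inner product of \<open>v n\<close> with
      the indicator of the ball around \<open>x\<close>; weak convergence therefore gives pointwise
      convergence of the means.\<close>
    define I where "I x = (indicator (ball x r) :: 'a \<Rightarrow> real)" for x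
    have I: "I x \<in> l2_fun" for x
    proof -
      have "integrable lebesgue (indicat_real (ball x r))"
        using emeasure_lborel_ball_finite[of x r] by simp
      moreover have "(norm (I x y))\<^sup>2 = indicat_real (ball x r) y" for y by (simp add: I_def indicator_def)
      ultimately show ?thesis unfolding l2_fun_def by (simp add: I_def)
    qed
    have nI: "norm (abs_l2 (I x)) = sqrt b" for x
    proof -
      have "(norm (abs_l2 (I x)))\<^sup>2 = (LINT y|lebesgue. indicat_real (ball x r) y)"
        unfolding norm_abs_l2[OF I] by (intro Bochner_Integration.integral_cong) (auto simp: I_def
            indicator_def)
      also have "\<dots> = b" using r by (simp add: b_def content_ball)
      finally show ?thesis by (metis norm_ge_zero real_sqrt_unique)
    qed
    have Mi: "M n x = abs_l2 (v n) \<bullet> abs_l2 (I x)" for n x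
    proof -
      note [measurable] = C1c_borel[OF v]
      have [measurable]: "I x \<in> borel_measurable borel" for x
        unfolding I_def by (rule borel_measurable_indicator) simp
      have "abs_l2 (v n) \<bullet> abs_l2 (I x) = (LINT y|lborel. v n y * I x y)"
        by (simp add: inner_abs_l2 C1c_l2_fun[OF v] I integral_completion)
      also have "\<dots> = (LINT y|lborel. v n (y + x) * I x (y + x))"
        by (rule lborel_translate(1)[symmetric]) simp
      also have "\<dots> = M n x" unfolding M_def
        by (intro Bochner_Integration.integral_cong) (auto simp: I_def indicator_def dist_norm add.commute)
      finally show ?thesis by simp
    qed
    have Mlim: "(\<lambda>n. M n x) \<longlonglongrightarrow> 0" for x unfolding Mi by (rule weak)
    have Mb: "\<bar>M n x\<bar> \<le> P * sqrt b" for n x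
    proof -
      have "\<bar>M n x\<bar> \<le> norm (abs_l2 (v n)) * norm (abs_l2 (I x))" unfolding Mi by (rule Cauchy_Schwarz_ineq2)
      also have "\<dots> \<le> P * sqrt b" using VP b by (simp add: nI mult_right_mono)
      finally show ?thesis .
    qed
    have [measurable]: "cball (0::'a) R \<in> sets borel" by simp
    \<comment> \<open>Cutting the means off outside the common support of the \<open>v n\<close>
      leaves the products with \<open>v n\<close> unchanged and supplies an integrable bound for
      dominated convergence.\<close>
    define J where "J n x = indicat_real (cball 0 R) x * M n x" for n x
    have ib: "integrable lborel (\<lambda>x. indicat_real (cball (0::'a) R) x *\<^sub>R (P * sqrt b)\<^sup>2)"
      by (rule borel_integrable_compact) auto
    have Jb: "(norm (J n x))\<^sup>2 \<le> indicat_real (cball 0 R) x *\<^sub>R (P * sqrt b)\<^sup>2" for n x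
      using power_mono[OF Mb[of n x], of 2] by (auto simp: J_def indicator_def)
    have Jm[measurable]: "J n \<in> borel_measurable borel" for n unfolding J_def[abs_def] by simp
    have J: "J n \<in> l2_fun" for n
      by (rule l2_fun_bound[OF _ _ Jb])
        (use ib in \<open>simp_all add: integrable_completion measurable_completion\<close>)
    have "(\<lambda>n. LINT x|lborel. (norm (J n x))\<^sup>2) \<longlonglongrightarrow> integral\<^sup>L lborel (\<lambda>x::'a. 0::real)"
    proof (rule integral_dominated_convergence[OF _ _ ib])
      show "AE x in lborel. (\<lambda>n. (norm (J n x))\<^sup>2) \<longlonglongrightarrow> 0"
      proof (rule AE_I2)
        fix x
        have "(\<lambda>n. (norm (indicat_real (cball 0 R) x * M n x))\<^sup>2) \<longlonglongrightarrow> (norm (indicat_real (cball 0 R) x * 0))\<^sup>2"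
          by (intro tendsto_intros Mlim)
        then show "(\<lambda>n. (norm (J n x))\<^sup>2) \<longlonglongrightarrow> 0" by (simp add: J_def)
      qed
      show "AE x in lborel. norm ((norm (J n x))\<^sup>2) \<le> indicat_real (cball 0 R) x *\<^sub>R (P * sqrt b)\<^sup>2" for n
        using Jb by simp
    qed simp_all
    then have "(\<lambda>n. sqrt ((norm (abs_l2 (J n)))\<^sup>2)) \<longlonglongrightarrow> sqrt 0"
      by (intro tendsto_real_sqrt) (simp add: norm_abs_l2 J integral_completion)
    then have lim: "(\<lambda>n. 2 * (P * norm (abs_l2 (J n)))) \<longlonglongrightarrow> 2 * (P * 0)"
      by (intro tendsto_intros) simp
    have "2 * (P * 0) < b * (\<epsilon> / 2)" using b \<epsilon> by simp
    with lim have ev: "\<forall>\<^sub>F n in sequentially. 2 * (P * norm (abs_l2 (J n))) < b * (\<epsilon> / 2)"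
      by (rule order_tendstoD(2))
    have est: "b * (norm (abs_l2 (v n)))\<^sup>2 \<le> b * (r\<^sup>2 * C\<^sup>2) + 2 * (P * norm (abs_l2 (J n)))" for n
    proof -
      note [measurable] = C1c_borel[OF v]
      have "(LINT x|lborel. v n x * M n x) = (LINT x|lborel. v n x * J n x)"
        using supp by (intro Bochner_Integration.integral_cong) (auto simp: J_def indicator_def not_le)
      also have "\<dots> = abs_l2 (v n) \<bullet> abs_l2 (J n)"
        by (simp add: inner_abs_l2 C1c_l2_fun[OF v] J integral_completion)
      also have "\<dots> \<le> norm (abs_l2 (v n)) * norm (abs_l2 (J n))" by (rule norm_cauchy_schwarz)
      also have "\<dots> \<le> P * norm (abs_l2 (J n))" using VP by (intro mult_right_mono) auto
      finally have 1: "(LINT x|lborel. v n x * M n x) \<le> P * norm (abs_l2 (J n))" .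
      have 2: "b * (r\<^sup>2 * (norm (abs_l2 (g n)))\<^sup>2) \<le> b * (r\<^sup>2 * C\<^sup>2)"
        using b C by (intro mult_left_mono power_mono) auto
      show ?thesis
        using C1c_l2_estimate_by_means(1)[OF v r(1), of n] 1 2
        unfolding M_def[symmetric] b_def[symmetric] C1c_norm_abs_l2[OF v, symmetric] by linarith
    qed
    show ?thesis using ev
    proof eventually_elim
      case (elim n)
      have "b * (r\<^sup>2 * C\<^sup>2) < b * (\<epsilon> / 2)" using b r by simp
      then have "b * (norm (abs_l2 (v n)))\<^sup>2 < b * \<epsilon>" using est[of n] elim by (simp add: algebra_simps)
      then show ?case using b by simp
    qed
  qed
  show ?thesis
  proof (rule order_tendstoI)
    fix a :: real assume "a < 0"
    then show "\<forall>\<^sub>F n in sequentially. a < norm (abs_l2 (v n))"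
      by (intro always_eventually allI) (rule less_le_trans, auto)
  next
    fix a :: real assume a: "0 < a"
    then have "\<forall>\<^sub>F n in sequentially. (norm (abs_l2 (v n)))\<^sup>2 < a\<^sup>2" by (intro main) simp
    then show "\<forall>\<^sub>F n in sequentially. norm (abs_l2 (v n)) < a"
      by eventually_elim (rule power2_less_imp_less, use a in auto)
  qed
qed

section \<open>The Sobolev inequality\<close>

lemma DERIV_max_zero_power2: "((\<lambda>s::real. (max 0 (s - c))\<^sup>2) has_real_derivative 2 * max 0 (s - c)) (at s)"
proof -
  consider "s > c" | "s < c" | "s = c" by linarith
  then show ?thesis
  proof cases
    case 1
    have "((\<lambda>s. (s - c)\<^sup>2) has_real_derivative 2 * max 0 (s - c)) (at s)"
      using 1 by (auto intro!: derivative_eq_intros)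
    then show ?thesis
      by (rule has_field_derivative_transform_within_open[of _ _ _ "{c<..}"]) (use 1 in auto)
  next
    case 2
    have "((\<lambda>s. 0) has_real_derivative 2 * max 0 (s - c)) (at s)" using 2 by simp
    then show ?thesis
      by (rule has_field_derivative_transform_within_open[of _ _ _ "{..<c}"]) (use 2 in auto)
  next
    case 3
    have "((\<lambda>h. (max 0 h)\<^sup>2 / h) \<longlongrightarrow> 0) (at (0::real))"
    proof (rule Lim_null_comparison)
      show "\<forall>\<^sub>F h in at (0::real). norm ((max 0 h)\<^sup>2 / h) \<le> \<bar>h\<bar>"
        by (auto simp: max_def power2_eq_square)
      show "((\<lambda>h::real. \<bar>h\<bar>) \<longlongrightarrow> 0) (at 0)" by (rule tendsto_rabs_zero) simp
    qed
    then show ?thesis using 3 by (simp add: DERIV_def)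
  qed
qed

text \<open>The quadratic spline whose derivative is the tent of height 2 over the interval from 1 to 2.\<close>

definition trunc :: "real \<Rightarrow> real" where
  "trunc s = 2 * ((max 0 (s - 1))\<^sup>2 - 2 * (max 0 (s - 3/2))\<^sup>2 + (max 0 (s - 2))\<^sup>2)"

definition trunc_deriv :: "real \<Rightarrow> real" where
  "trunc_deriv s = 4 * (max 0 (s - 1) - 2 * max 0 (s - 3/2) + max 0 (s - 2))"

lemma DERIV_trunc: "DERIV trunc s :> trunc_deriv s"
  unfolding trunc_def[abs_def] trunc_deriv_def
  by (rule DERIV_cong, (rule derivative_intros DERIV_max_zero_power2)+) (simp add: algebra_simps)

lemma trunc_eq_0: "s \<le> 1 \<Longrightarrow> trunc s = 0" by (simp add: trunc_def)

lemma trunc_eq_1: "2 \<le> s \<Longrightarrow> trunc s = 1" by (simp add: trunc_def power2_eq_square algebra_simps)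

lemma trunc_deriv_bound: "\<bar>trunc_deriv s\<bar> \<le> 2" by (auto simp: trunc_deriv_def max_def)

lemma trunc_deriv_eq_0: "s \<le> 1 \<or> 2 \<le> s \<Longrightarrow> trunc_deriv s = 0" by (auto simp: trunc_deriv_def)

lemma C1c_trunc:
  fixes v :: "'a::euclidean_space \<Rightarrow> real"
  assumes v: "C1c v g" and c: "c > 0"
  shows "C1c (\<lambda>x. trunc (c * v x)) (\<lambda>x. (c * trunc_deriv (c * v x)) *\<^sub>R g x)"
proof -
  have "((\<lambda>x. trunc (c * v x)) has_derivative (\<lambda>h. ((c * trunc_deriv (c * v x)) *\<^sub>R g x) \<bullet> h)) (at x)" for x
  proof -
    have "((\<lambda>x. c * v x) has_derivative (\<lambda>h. c * (g x \<bullet> h))) (at x)"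
      by (intro has_derivative_mult_right C1c_has_derivative[OF v])
    moreover have "(trunc has_derivative (*) (trunc_deriv (c * v x))) (at (c * v x))"
      using DERIV_trunc[of "c * v x"] unfolding has_field_derivative_def .
    ultimately have "((\<lambda>x. trunc (c * v x)) has_derivative (\<lambda>h. trunc_deriv (c * v x) * (c *
        (g x \<bullet> h)))) (at x)"
      by (rule has_derivative_compose)
    then show ?thesis by (simp add: mult.commute mult.left_commute)
  qed
  moreover have "continuous_on UNIV (\<lambda>x. (c * trunc_deriv (c * v x)) *\<^sub>R g x)"
    unfolding trunc_deriv_def using C1c_continuous[OF v] by (intro continuous_intros)
  moreover have "\<exists>R. \<forall>x. R < norm x \<longrightarrow> trunc (c * v x) = 0"
    using v unfolding C1c_def by (metis mult_zero_right trunc_eq_0 zero_le_one)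
  ultimately show ?thesis unfolding C1c_def by blast
qed

text \<open>The summand of the highest level lying below \<open>s\<close> is enough:
  \<open>s\<close> is at most twice that level, which explains the shift by 1 in the
  exponent.\<close>

lemma dyadic_layer_bound:
  fixes s p :: real
  assumes p: "0 < p" and s: "2 powr (- n) < s" and sm: "s \<le> 2 powr (real m - n)"
  shows "s powr p \<le> (\<Sum>j<m. 2 powr (p * (real j - n + 1)) * (if s > 2 powr (real j - n) then 1 else 0))"
  using sm
proof (induction m)
  case 0
  with s show ?case by simp
next
  case (Suc m)
  show ?case
  proof (cases "s > 2 powr (real m - n)")
    case True
    have "s powr p \<le> (2 powr (real m - n + 1)) powr p"
    proof (rule powr_mono2)
      have "real (Suc m) - n = real m - n + 1" by simp
      with Suc.prems show "s \<le> 2 powr (real m - n + 1)" by (simp only:)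
      show "0 \<le> s" by (rule less_imp_le[OF order_le_less_trans[OF _ s]]) simp
    qed (use p in simp)
    also have "\<dots> = 2 powr (p * (real m - n + 1)) * (if s > 2 powr (real m - n) then 1 else 0)"
      using True by (simp add: powr_powr mult.commute)
    also have "\<dots> \<le> (\<Sum>j<Suc m. 2 powr (p * (real j - n + 1)) * (if s > 2 powr (real j - n) then 1 else 0))"
      by (simp add: sum_nonneg)
    finally show ?thesis .
  next
    case False
    then show ?thesis using Suc.IH by simp
  qed
qed

text \<open>The level estimate is applied to \<open>trunc (v / 2^k)\<close>, which is 0 where
  \<open>v \<le> 2^k\<close> and 1 where \<open>v > 2^(k + 1)\<close>, so its gradient lives on the
  layer between. The radius is chosen so that the ball has volume \<open>2 * \<alpha> k\<close>,
  whence the powers with exponent \<open>2/N\<close>. The factor 8 is the 2 of the level estimate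
  times the squared bound 2 on the slope of \<open>trunc\<close>, and \<open>2^(-2k)\<close> is the
  squared scaling factor.\<close>

lemma C1c_sobolev_step:
  fixes v :: "'a::euclidean_space \<Rightarrow> real" and k :: real
  assumes v: "C1c v g"
  defines "\<alpha> \<equiv> (\<lambda>t::real. measure lborel {x. v x > 2 powr t})"
  shows "\<alpha> (k + 1) \<le> 8 * (2 / unit_ball_vol DIM('a)) powr (2 / DIM('a)) * \<alpha> k powr (2 / DIM('a)) *
      2 powr (- 2 * k) *
    (LINT x|lborel. (norm (g x))\<^sup>2 * (if 2 powr k < v x \<and> v x \<le> 2 powr (k + 1) then 1 else 0))"
    (is "_ \<le> 8 * _ * _ * _ * ?G")
proof -
  let ?N = "real DIM('a)" and ?\<omega> = "unit_ball_vol DIM('a)"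
  note [measurable] = C1c_borel[OF v]
  have N: "?N > 0" by simp
  have \<omega>: "?\<omega> > 0" by (simp add: unit_ball_vol_pos)
  from \<omega> have \<omega>': "?\<omega> \<noteq> 0" by linarith
  obtain R where R: "R > 0" "\<And>x. R < norm x \<Longrightarrow> v x = 0" "\<And>x. R < norm x \<Longrightarrow> g x = 0"
    using C1c_support[OF v] by blast
  have fin: "emeasure lborel {x. v x > 2 powr t} < \<infinity>" for t
  proof -
    have "{x. v x > 2 powr t} \<subseteq> cball 0 R" using R(2)
        by (auto simp: not_le[symmetric]) (metis not_le powr_ge_zero)
    then have "emeasure lborel {x. v x > 2 powr t} \<le> emeasure lborel (cball (0::'a) R)"
      by (intro emeasure_mono) auto
    also have "\<dots> < \<infinity>" by (rule emeasure_lborel_cball_finite)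
    finally show ?thesis .
  qed
  have sub: "{x. v x > 2 powr (k + 1)} \<subseteq> {x. v x > 2 powr k}"
    using less_trans[of "2 powr k" "2 powr (k + 1)"] by auto
  have G0: "0 \<le> ?G" by (intro Bochner_Integration.integral_nonneg) simp
  have \<alpha>0: "\<alpha> t \<ge> 0" for t by (simp add: \<alpha>_def)
  show ?thesis
  proof (cases "\<alpha> k = 0")
    case True
    have "\<alpha> (k + 1) \<le> \<alpha> k" unfolding \<alpha>_def
      using sub fin[of k] by (intro measure_mono_fmeasurable) (auto simp: fmeasurable_def)
    with True show ?thesis by simp
  next
    case False
    with \<alpha>0[of k] have ak: "\<alpha> k > 0" by simp
    define r where "r = (2 * \<alpha> k / ?\<omega>) powr (1 / ?N)"
    have q: "2 * \<alpha> k / ?\<omega> > 0" using ak \<omega> by simp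
    have r: "r > 0" using ak \<omega>' by (simp add: r_def)
    have rN: "r ^ DIM('a) = 2 * \<alpha> k / ?\<omega>"
    proof -
      have "r ^ DIM('a) = r powr ?N" using r by (simp add: powr_realpow)
      also have "\<dots> = 2 * \<alpha> k / ?\<omega>" unfolding r_def powr_powr using ak \<omega>' N by simp
      finally show ?thesis .
    qed
    have r2: "r\<^sup>2 = (2 / ?\<omega>) powr (2 / ?N) * \<alpha> k powr (2 / ?N)"
    proof -
      have "r\<^sup>2 = r powr 2" using r by (simp add: powr_numeral)
      also have "\<dots> = ((2 / ?\<omega>) * \<alpha> k) powr (2 / ?N)" unfolding r_def powr_powr by simp
      also have "\<dots> = (2 / ?\<omega>) powr (2 / ?N) * \<alpha> k powr (2 / ?N)" by (rule powr_mult)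
      finally show ?thesis .
    qed
    define c where "c = 2 powr (- k)"
    have c: "c > 0" by (simp add: c_def)
    have cv: "c * s \<le> 1 \<longleftrightarrow> s \<le> 2 powr k" "2 \<le> c * s \<longleftrightarrow> 2 powr (k + 1) \<le> s" for s
      by (auto simp: c_def powr_minus powr_add field_simps)
    let ?w = "\<lambda>x. trunc (c * v x)" and ?gw = "\<lambda>x. (c * trunc_deriv (c * v x)) *\<^sub>R g x"
    have w: "C1c ?w ?gw" using v c by (rule C1c_trunc)
    have 1: "\<alpha> (k + 1) \<le> 2 * r\<^sup>2 * (LINT x|lborel. (norm (?gw x))\<^sup>2)"
      unfolding \<alpha>_def
    proof (rule C1c_level_estimate[OF w])
      show "emeasure lborel {x. v x > 2 powr k} < \<infinity>" by (rule fin)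
      show "{x. 2 powr (k + 1) < v x} \<subseteq> {x. 2 powr k < v x}" by (rule sub)
      show "trunc (c * v x) = 0" if "x \<notin> {x. 2 powr k < v x}" for x
        using that by (intro trunc_eq_0) (simp add: cv)
      show "trunc (c * v x) = 1" if "x \<in> {x. 2 powr (k + 1) < v x}" for x
        using that by (intro trunc_eq_1) (simp add: cv)
      show "measure lborel (ball (0::'a) r) = 2 * measure lborel {x. 2 powr k < v x}"
        using r \<omega>' by (simp add: content_ball rN \<alpha>_def)
    qed (use r in auto)
    have "(LINT x|lborel. (norm (?gw x))\<^sup>2) \<le>
      (LINT x|lborel. 4 * c\<^sup>2 * ((norm (g x))\<^sup>2 * (if 2 powr k < v x \<and> v x \<le> 2 powr (k + 1) then 1 else 0)))"
    proof (rule Bochner_Integration.integral_mono)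
      show "integrable lborel (\<lambda>x. (norm (?gw x))\<^sup>2)" using C1c_integrable(3)[OF w] .
      have "integrable lborel (\<lambda>x. (norm (g x))\<^sup>2 * (if 2 powr k < v x \<and> v x \<le> 2 powr (k + 1) then 1 else 0))"
        by (rule Bochner_Integration.integrable_bound[OF C1c_integrable(3)[OF v]]) auto
      then show "integrable lborel (\<lambda>x. 4 * c\<^sup>2 * ((norm (g x))\<^sup>2 * (if 2 powr k < v x \<and> v x
          \<le> 2 powr (k + 1) then 1 else 0)))"
        by simp
      fix x
      show "(norm (?gw x))\<^sup>2 \<le> 4 * c\<^sup>2 * ((norm (g x))\<^sup>2 * (if 2 powr k < v x \<and> v x
          \<le> 2 powr (k + 1) then 1 else 0))"
      proof (cases "2 powr k < v x \<and> v x \<le> 2 powr (k + 1)")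
        case True
        have "(trunc_deriv (c * v x))\<^sup>2 \<le> 2\<^sup>2"
          using power_mono[OF trunc_deriv_bound[of "c * v x"], of 2] by simp
        then have "c\<^sup>2 * (norm (g x))\<^sup>2 * (trunc_deriv (c * v x))\<^sup>2 \<le> c\<^sup>2 * (norm (g x))\<^sup>2 * 2\<^sup>2"
          by (intro mult_left_mono) auto
        with True show ?thesis by (simp add: power_mult_distrib mult_ac)
      next
        case False
        then have "trunc_deriv (c * v x) = 0" by (intro trunc_deriv_eq_0) (auto simp: cv)
        then show ?thesis by simp
      qed
    qed
    also have "\<dots> = 4 * c\<^sup>2 * ?G" by simp
    finally have "2 * r\<^sup>2 * (LINT x|lborel. (norm (?gw x))\<^sup>2) \<le> 2 * r\<^sup>2 * (4 * c\<^sup>2 * ?G)"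
      by (intro mult_left_mono) auto
    with 1 have "\<alpha> (k + 1) \<le> 2 * r\<^sup>2 * (4 * c\<^sup>2 * ?G)" by (rule order_trans)
    also have "\<dots> = 8 * r\<^sup>2 * c\<^sup>2 * ?G" by simp
    finally have "\<alpha> (k + 1) \<le> 8 * r\<^sup>2 * c\<^sup>2 * ?G" .
    moreover have "c\<^sup>2 = 2 powr (- 2 * k)" by (simp add: c_def power2_eq_square flip: powr_add)
    ultimately show ?thesis by (simp add: r2 mult.assoc)
  qed
qed

text \<open>By Chebyshev's inequality the measure of each level set is bounded by the integral to be
  estimated. Summing over dyadic levels, that integral appears on both sides, on the right with an
  exponent smaller than one.\<close>

lemma C1c_sobolev_pos:
  fixes v :: "'a::euclidean_space \<Rightarrow> real"
  assumes v: "C1c v g" and N3: "3 \<le> DIM('a)"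
  defines "p \<equiv> two_star DIM('a)"
  defines "C0 \<equiv> 4 powr p * (8 * (2 / unit_ball_vol DIM('a)) powr (2 / DIM('a)))"
  shows "(LINT x|lborel. (max 0 (v x)) powr p) \<le> C0 powr (p/2) * (LINT x|lborel. (norm (g x))\<^sup>2) powr (p/2)"
proof -
  let ?N = "real DIM('a)"
  have N: "?N \<ge> 3" using N3 by linarith
  \<comment> \<open>The last two are forms of \<open>p (1 - 2/N) = 2\<close>. The second cancels the
    dependence on the dyadic level, the third makes the final exponent of \<open>I\<close> equal to
    1.\<close>
  have p: "p > 0" "p - p * (2 / ?N) - 2 = 0" "(1 - 2 / ?N) * (p / 2) = 1"
  proof -
    show "p > 0" using N by (simp add: p_def two_star_def)
    have "p * ((?N - 2) / ?N) = 2" using N by (simp add: p_def two_star_def)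
    moreover have "(?N - 2) / ?N = 1 - 2 / ?N" using N by (simp add: diff_divide_distrib)
    ultimately have e: "p * (1 - 2 / ?N) = 2" by (simp only:)
    then show "p - p * (2 / ?N) - 2 = 0" by (simp add: right_diff_distrib)
    show "(1 - 2 / ?N) * (p / 2) = 1" using e by (simp add: mult.commute)
  qed
  note [measurable] = C1c_borel[OF v]
  obtain R where R: "R > 0" "\<And>x. R < norm x \<Longrightarrow> v x = 0" "\<And>x. R < norm x \<Longrightarrow> g x = 0"
    using C1c_support[OF v] by blast
  obtain K where K: "K > 0" "\<And>x. norm (v x) \<le> K"
    using bounded_continuous_bounded_support[OF C1c_continuous(1)[OF v] R(2)] by blast
  define I where "I = (LINT x|lborel. (max 0 (v x)) powr p)"
  define G where "G = (LINT x|lborel. (norm (g x))\<^sup>2)"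
  define \<alpha> where "\<alpha> t = measure lborel {x. v x > 2 powr t}" for t
  define H where "H k = (LINT x|lborel. (norm (g x))\<^sup>2 * (if 2 powr k < v x \<and> v x
      \<le> 2 powr (k + 1) then 1 else 0))" for k
  define S where "S = measure lborel (cball (0::'a) R)"
  have Ii: "integrable lborel (\<lambda>x. (max 0 (v x)) powr p)"
    by (rule Bochner_Integration.integrable_bound[OF C1c_integrable(4)[OF v p(1)]])
      (use p in \<open>auto intro!: powr_mono2\<close>)
  have I0: "I \<ge> 0" unfolding I_def by (intro Bochner_Integration.integral_nonneg) simp
  have Ai: "integrable lborel (\<lambda>x. if v x > 2 powr t then 1 else 0 :: real)" for t
  proof (rule Bochner_Integration.integrable_bound)
    show "integrable lborel (indicat_real (cball (0::'a) R))"
      using emeasure_lborel_cball_finite[of "0::'a" R] by simp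
    show "AE x in lborel. norm (if v x > 2 powr t then 1 else 0 :: real) \<le> norm (indicat_real (cball 0 R) x)"
    proof (rule AE_I2)
      fix x
      show "norm (if v x > 2 powr t then 1 else 0 :: real) \<le> norm (indicat_real (cball 0 R) x)"
        using R(2)[of x] by (cases "R < norm x") (auto simp: indicator_def)
    qed
  qed simp
  have Aint: "(LINT x|lborel. (if v x > 2 powr t then 1 else 0 :: real)) = \<alpha> t" for t
  proof -
    have "(LINT x|lborel. (if v x > 2 powr t then 1 else 0 :: real)) =
        (LINT x|lborel. indicator {x. v x > 2 powr t} x)"
      by (intro Bochner_Integration.integral_cong) (auto simp: indicator_def)
    then show ?thesis by (simp add: \<alpha>_def)
  qed
  have cheb: "\<alpha> t \<le> 2 powr (- p * t) * I" for t
  proof -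
    have "\<alpha> t \<le> (LINT x|lborel. 2 powr (- p * t) * (max 0 (v x)) powr p)"
      unfolding Aint[symmetric]
    proof (rule Bochner_Integration.integral_mono[OF Ai])
      fix x
      show "(if v x > 2 powr t then 1 else 0 :: real) \<le> 2 powr (- p * t) * (max 0 (v x)) powr p"
      proof (cases "v x > 2 powr t")
        case True
        have "2 powr (- p * t) * (2 powr t) powr p \<le> 2 powr (- p * t) * (max 0 (v x)) powr p"
          using True p by (intro mult_left_mono powr_mono2) auto
        moreover have "2 powr (- p * t) * (2 powr t) powr p = 1"
          by (simp add: powr_powr mult.commute flip: powr_add)
        ultimately have "1 \<le> 2 powr (- p * t) * (max 0 (v x)) powr p" by linarith
        then show ?thesis using True by simp
      qed simp
    qed (use Ii in simp)
    then show ?thesis by (simp add: I_def)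
  qed
  have H0: "H k \<ge> 0" for k unfolding H_def by (intro Bochner_Integration.integral_nonneg) simp
  define C1 where "C1 = 8 * (2 / unit_ball_vol DIM('a)) powr (2 / ?N)"
  have C1: "C1 \<ge> 0" by (simp add: C1_def)
  have step: "2 powr (p * (t + 2)) * \<alpha> (t + 1) \<le> C0 * I powr (2 / ?N) * H t" for t
  proof -
    have "\<alpha> (t + 1) \<le> C1 * \<alpha> t powr (2 / ?N) * 2 powr (- 2 * t) * H t"
      using C1c_sobolev_step[OF v, of t] by (simp add: \<alpha>_def H_def C1_def)
    also have "\<dots> \<le> C1 * (2 powr (- p * t) * I) powr (2 / ?N) * 2 powr (- 2 * t) * H t"
      using cheb[of t] H0 C1 by (intro mult_right_mono mult_left_mono powr_mono2) (auto simp: \<alpha>_def)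
    finally have "2 powr (p * (t + 2)) * \<alpha> (t + 1)
        \<le> 2 powr (p * (t + 2)) * (C1 * (2 powr (- p * t) * I) powr (2 / ?N) * 2 powr (- 2 * t) * H t)"
      by (intro mult_left_mono) auto
    also have "\<dots> = (2 powr (p * (t + 2)) * 2 powr (- p * t * (2 / ?N)) * 2 powr (- 2 * t)) * C1 *
        I powr (2 / ?N) * H t"
      using I0 by (simp add: powr_mult powr_powr mult_ac)
    \<comment> \<open>The critical exponent enters here: the coefficient of \<open>t\<close>
      vanishes, so every level receives the same constant and the sum over the levels stays
      bounded.\<close>
    also have "2 powr (p * (t + 2)) * 2 powr (- p * t * (2 / ?N)) * 2 powr (- 2 * t) =
        2 powr (2 * p + t * (p - p * (2 / ?N) - 2))"
      unfolding powr_add[symmetric] by (simp add: algebra_simps)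
    also have "\<dots> = 4 powr p" unfolding p(2) using powr_powr[of 2 2 p] by simp
    finally show ?thesis by (simp add: C0_def C1_def mult_ac)
  qed
  \<comment> \<open>Only levels above \<open>2^(-n)\<close> are summed. Smaller values of
    \<open>v\<close> contribute at most \<open>2^(-p n)\<close> on the ball that contains the
    support, and this disappears as \<open>n\<close> grows. Boundedness of \<open>v\<close> makes
    the number \<open>m\<close> of levels finite.\<close>
  have main: "I \<le> (2 powr (- p)) ^ n * S + C0 * I powr (2 / ?N) * G" for n :: nat
  proof -
    obtain m :: nat where m: "K * 2 ^ n < 2 ^ m" using real_arch_pow[of 2 "K * 2 ^ n"] by auto
    have vm: "v x \<le> 2 powr (real m - real n)" for x
    proof -
      have "v x \<le> K" using K(2)[of x] by simp
      also have "K \<le> 2 ^ m / 2 ^ n" using m by (simp add: field_simps)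
      finally show ?thesis by (simp add: powr_diff powr_realpow)
    qed
    let ?w = "\<lambda>j. 2 powr (p * (real j - real n + 1))"
    have "I \<le> (LINT x|lborel. (2 powr (- p)) ^ n * indicat_real (cball 0 R) x +
        (\<Sum>j<m. ?w j * (if v x > 2 powr (real j - real n) then 1 else 0)))"
      unfolding I_def
    proof (rule Bochner_Integration.integral_mono[OF Ii])
      have "integrable lborel (indicat_real (cball (0::'a) R))"
        using emeasure_lborel_cball_finite[of "0::'a" R] by simp
      then show "integrable lborel (\<lambda>x. (2 powr (- p)) ^ n * indicat_real (cball 0 R) x +
          (\<Sum>j<m. ?w j * (if v x > 2 powr (real j - real n) then 1 else 0)))"
        by (intro Bochner_Integration.integrable_add Bochner_Integration.integrable_sum integrable_mult_right
            Ai)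
      fix x
      have s0: "0 \<le> (\<Sum>j<m. ?w j * (if v x > 2 powr (real j - real n) then 1 else 0))"
        by (intro sum_nonneg) auto
      have p0: "(2 powr (- p)) ^ n = (2 powr (- real n)) powr p"
        by (simp add: powr_powr powr_power mult.commute)
      consider "v x \<le> 0" | "0 < v x" "v x \<le> 2 powr (- real n)" | "2 powr (- real n) < v x" by linarith
      then show "max 0 (v x) powr p \<le> (2 powr (- p)) ^ n * indicat_real (cball 0 R) x +
          (\<Sum>j<m. ?w j * (if v x > 2 powr (real j - real n) then 1 else 0))"
      proof cases
        case 1
        then show ?thesis using s0 by simp
      next
        case 2
        then have "x \<in> cball 0 R" using R(2)[of x] by (cases "R < norm x") auto
        moreover have "max 0 (v x) powr p \<le> (2 powr (- real n)) powr p" using 2 p by (intro powr_mono2) auto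
        ultimately show ?thesis using s0 p0 by simp
      next
        case 3
        have "0 < v x" using less_trans[OF _ 3, of 0] by simp
        then have "max 0 (v x) powr p = v x powr p" by simp
        also have "\<dots> \<le> (\<Sum>j<m. ?w j * (if v x > 2 powr (real j - real n) then 1 else 0))"
          using p(1) 3 vm by (rule dyadic_layer_bound)
        finally show ?thesis by (simp add: add_increasing)
      qed
    qed
    also have "\<dots> = (2 powr (- p)) ^ n * S + (\<Sum>j<m. ?w j * \<alpha> (real j - real n))"
    proof -
      have "integrable lborel (indicat_real (cball (0::'a) R))"
        using emeasure_lborel_cball_finite[of "0::'a" R] by simp
      then show ?thesis using Ai
        by (subst Bochner_Integration.integral_add) (simp_all add: Aint S_def
            Bochner_Integration.integral_sum)
    qed
    also have "(\<Sum>j<m. ?w j * \<alpha> (real j - real n)) \<le> (\<Sum>j<m. C0 * I powr (2 / ?N) * H (real j - real n - 1))"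
    proof (rule sum_mono)
      fix j
      have "p * (real j - real n + 1) = p * ((real j - real n - 1) + 2)" "real j - real n =
          (real j - real n - 1) + 1"
        by simp_all
      then show "?w j * \<alpha> (real j - real n) \<le> C0 * I powr (2 / ?N) * H (real j - real n - 1)"
        using step[of "real j - real n - 1"] by (simp only:)
    qed
    also have "\<dots> = C0 * I powr (2 / ?N) * (\<Sum>j<m. H (real j - real n - 1))"
      by (simp add: sum_distrib_left)
    \<comment> \<open>Each point lies in at most one dyadic layer, so the gradient integrals over
      the layers add up to no more than the whole.\<close>
    also have "(\<Sum>j<m. H (real j - real n - 1)) \<le> G"
    proof -
      let ?d = "\<lambda>j x. (if 2 powr (real j - real n - 1) < v x \<and> v x
          \<le> 2 powr (real j - real n - 1 + 1) then 1 else 0 :: real)"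
      have di: "integrable lborel (\<lambda>x. (norm (g x))\<^sup>2 * ?d j x)" for j
        by (rule Bochner_Integration.integrable_bound[OF C1c_integrable(3)[OF v]]) auto
      have "(\<Sum>j<m. H (real j - real n - 1)) = (LINT x|lborel. (\<Sum>j<m. (norm (g x))\<^sup>2 * ?d j x))"
        unfolding H_def using di by (intro Bochner_Integration.integral_sum[symmetric])
      also have "\<dots> \<le> G" unfolding G_def
      proof (rule Bochner_Integration.integral_mono[OF _ C1c_integrable(3)[OF v]])
        show "integrable lborel (\<lambda>x. \<Sum>j<m. (norm (g x))\<^sup>2 * ?d j x)"
            using di by (intro Bochner_Integration.integrable_sum)
        fix x
        have "(\<Sum>j<m. ?d j x) \<le> 1"
        proof (cases "\<exists>i<m. ?d i x = 1")
          case True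
          then obtain i where i: "i < m" "?d i x = 1" by blast
          have "?d j x = 0" if "j \<noteq> i" for j
          proof -
            have i': "2 powr (real i - real n - 1) < v x" "v x \<le> 2 powr (real i - real n - 1 + 1)"
              using i(2) by (auto split: if_splits)
            consider "j < i" | "i < j" using \<open>j \<noteq> i\<close> by linarith
            then show ?thesis
            proof cases
              case 1
              then have "2 powr (real j - real n - 1 + 1) \<le> 2 powr (real i - real n - 1)"
                by (intro powr_mono) auto
              with i' have "\<not> v x \<le> 2 powr (real j - real n - 1 + 1)" by linarith
              then show ?thesis by simp
            next
              case 2
              then have "2 powr (real i - real n - 1 + 1) \<le> 2 powr (real j - real n - 1)"
                by (intro powr_mono) auto
              with i' have "\<not> 2 powr (real j - real n - 1) < v x" by linarith
              then show ?thesis by simp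
            qed
          qed
          then have "(\<Sum>j<m. ?d j x) = (\<Sum>j<m. if j = i then 1 else 0)"
            using i(2) by (intro sum.cong refl) (metis (no_types, lifting))
          also have "\<dots> \<le> 1" by simp
          finally show ?thesis .
        next
          case False
          then have "(\<Sum>j<m. ?d j x) = 0" by (intro sum.neutral) auto
          then show ?thesis by simp
        qed
        then have "(norm (g x))\<^sup>2 * (\<Sum>j<m. ?d j x) \<le> (norm (g x))\<^sup>2 * 1" by (intro mult_left_mono) auto
        then show "(\<Sum>j<m. (norm (g x))\<^sup>2 * ?d j x) \<le> (norm (g x))\<^sup>2"
            by (simp only: sum_distrib_left mult_1_right)
      qed
      finally show ?thesis .
    qed
    finally show ?thesis using C1 by (simp add: C0_def mult_left_mono)
  qed
  have "I \<le> 0 * S + C0 * I powr (2 / ?N) * G"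
  proof (rule LIMSEQ_le_const)
    have "2 powr (- p) < 2 powr 0" using p by (intro powr_less_mono) auto
    then have "norm (2 powr (- p)) < 1" by simp
    from LIMSEQ_power_zero[OF this] show "(\<lambda>n. (2 powr (- p)) ^ n * S + C0 * I powr (2 / ?N) * G)
        \<longlonglongrightarrow> 0 * S + C0 * I powr (2 / ?N) * G"
      by (intro tendsto_add tendsto_mult tendsto_const)
  qed (use main in auto)
  then have le: "I \<le> C0 * G * I powr (2 / ?N)" by (simp add: mult_ac)
  have G0: "G \<ge> 0" unfolding G_def by (intro Bochner_Integration.integral_nonneg) simp
  have C00: "C0 \<ge> 0" by (simp add: C0_def)
  show ?thesis
  proof (cases "I = 0")
    case True
    then show ?thesis unfolding I_def[symmetric] by simp
  next
    case False
    with I0 have Ip: "I > 0" by simp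
    \<comment> \<open>As \<open>I\<close> is finite and positive, its power with exponent
      \<open>2/N\<close> can be absorbed into the left-hand side.\<close>
    have "I powr (1 - 2 / ?N) = I / I powr (2 / ?N)" using Ip by (simp add: powr_diff)
    also have "\<dots> \<le> C0 * G" using le Ip by (simp add: field_simps)
    finally have "(I powr (1 - 2 / ?N)) powr (p/2) \<le> (C0 * G) powr (p/2)" using p by (intro powr_mono2) auto
    then have "I \<le> (C0 * G) powr (p/2)" unfolding powr_powr p(3) using Ip by simp
    also have "\<dots> = C0 powr (p/2) * G powr (p/2)" by (rule powr_mult)
    finally show ?thesis unfolding I_def G_def .
  qed
qed

text \<open>The bound for the positive part is applied to \<open>v\<close> and to \<open>-v\<close>,
  which accounts for the factor 2 in \<open>C\<close>. The constant depends on the dimension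
  only.\<close>

theorem C1c_sobolev:
  assumes N3: "3 \<le> DIM('a)"
  obtains C where "C > 0" "\<And>(v :: 'a::euclidean_space \<Rightarrow> real) g. C1c v g \<Longrightarrow>
    (LINT x|lborel. \<bar>v x\<bar> powr two_star DIM('a)) \<le> C *
        (LINT x|lborel. (norm (g x))\<^sup>2) powr (two_star DIM('a) / 2)"
proof -
  define p where "p = two_star DIM('a)"
  have p: "p > 0" using N3 by (simp add: p_def two_star_def)
  define C0 where "C0 = 4 powr p * (8 * (2 / unit_ball_vol DIM('a)) powr (2 / DIM('a)))"
  define C where "C = 2 * C0 powr (p/2)"
  have C: "C > 0" using less_imp_neq[OF unit_ball_vol_pos[of "real DIM('a)"]] by (auto simp: C_def C0_def)
  have "(LINT x|lborel. \<bar>v x\<bar> powr p) \<le> C * (LINT x|lborel. (norm (g x))\<^sup>2) powr (p / 2)"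
    if v: "C1c v g" for v :: "'a \<Rightarrow> real" and g
  proof -
    have v': "C1c (\<lambda>x. - v x) (\<lambda>x. - g x)"
    proof -
      have "((\<lambda>x. - v x) has_derivative (\<lambda>h. (- g x) \<bullet> h)) (at x)" for x
        using has_derivative_minus[OF C1c_has_derivative[OF v], of x] by simp
      moreover have "continuous_on UNIV (\<lambda>x. - g x)" using C1c_continuous[OF v] by (intro continuous_intros)
      moreover have "\<exists>R. \<forall>x. R < norm x \<longrightarrow> - v x = 0" using v by (auto simp: C1c_def)
      ultimately show ?thesis unfolding C1c_def by blast
    qed
    have [measurable]: "v \<in> borel_measurable borel" using C1c_borel[OF v] by simp
    have i: "integrable lborel (\<lambda>x. (max 0 (s * v x)) powr p)" if "\<bar>s\<bar> = 1" for s
      by (rule Bochner_Integration.integrable_bound[OF C1c_integrable(4)[OF v p]])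
        (use p that in \<open>auto intro!: powr_mono2 simp: abs_if max_def split: if_splits\<close>)
    have "(LINT x|lborel. \<bar>v x\<bar> powr p) = (LINT x|lborel. (max 0 (1 * v x)) powr p +
        (max 0 (-1 * v x)) powr p)"
      using p by (intro Bochner_Integration.integral_cong) (auto simp: abs_if max_def)
    also have "\<dots> = (LINT x|lborel. (max 0 (v x)) powr p) + (LINT x|lborel. (max 0 (- v x)) powr p)"
      using i[of 1] i[of "-1"] by simp
    also have "\<dots> \<le> C * (LINT x|lborel. (norm (g x))\<^sup>2) powr (p / 2)"
      using C1c_sobolev_pos[OF v N3] C1c_sobolev_pos[OF v' N3]
      unfolding p_def[symmetric] C0_def[symmetric] C_def by simp
    finally show ?thesis .
  qed
  with C show thesis using that unfolding p_def by blast
qed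


section \<open>The Sobolev space as a closed subspace of a Hilbert space\<close>

definition restr :: "'a set \<Rightarrow> ('a \<Rightarrow> 'b::real_vector) \<Rightarrow> 'a \<Rightarrow> 'b" where
  "restr \<Omega> f = (\<lambda>x. indicator \<Omega> x *\<^sub>R f x)"

definition l2_class :: "'a::euclidean_space set \<Rightarrow> ('a \<Rightarrow> 'b::euclidean_space) \<Rightarrow> ('a, 'b) l2" where
  "l2_class \<Omega> f = abs_l2 (restr \<Omega> f)"

definition grad_class :: "'a::euclidean_space set \<Rightarrow> ('a \<Rightarrow> real) \<Rightarrow> ('a, 'a) l2" where
  "grad_class \<Omega> u = l2_class \<Omega> (weak_grad \<Omega> u)"

text \<open>The norm of the pair in the product is the norm of $H^1$ (\<open>H1_norm_eq\<close>).
  The product is a complete inner product space, so weak compactness applies to it directly.\<close>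

definition h1_class :: "'a::euclidean_space set \<Rightarrow> ('a \<Rightarrow> real) \<Rightarrow> ('a, real) l2 \<times> ('a, 'a) l2" where
  "h1_class \<Omega> u = (l2_class \<Omega> u, grad_class \<Omega> u)"

lemma norm_restr_power2: "(norm (restr \<Omega> f x))\<^sup>2 = indicator \<Omega> x *\<^sub>R (norm (f x))\<^sup>2"
  by (simp add: restr_def indicator_def)

lemma restr_add: "restr \<Omega> (\<lambda>x. f x + g x) = (\<lambda>x. restr \<Omega> f x + restr \<Omega> g x)"
  by (simp add: restr_def scaleR_add_right)

lemma restr_scaleR: "restr \<Omega> (\<lambda>x. c *\<^sub>R f x) = (\<lambda>x. c *\<^sub>R restr \<Omega> f x)"
  by (simp add: restr_def mult.commute)

locale bounded_domain =
  fixes \<Omega> :: "'a::euclidean_space set"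
  assumes open_domain: "open \<Omega>" and bounded_domain: "bounded \<Omega>" and domain_nonempty: "\<Omega> \<noteq> {}"
begin

lemma domain_sets: "\<Omega> \<in> sets borel" "\<Omega> \<in> sets lebesgue" "\<Omega> \<inter> space lebesgue \<in> sets lebesgue"
  using open_domain by auto

lemma L2_iff: "f \<in> L2 \<Omega> \<longleftrightarrow> restr \<Omega> f \<in> l2_fun"
proof -
  have "f \<in> borel_measurable (lebesgue_on \<Omega>) \<longleftrightarrow> restr \<Omega> f \<in> borel_measurable lebesgue"
    unfolding restr_def by (rule borel_measurable_restrict_space_iff[OF domain_sets(3)])
  moreover have "integrable (lebesgue_on \<Omega>) (\<lambda>x. (norm (f x))\<^sup>2) \<longleftrightarrow>
      integrable lebesgue (\<lambda>x. (norm (restr \<Omega> f x))\<^sup>2)"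
    unfolding norm_restr_power2 by (rule integrable_restrict_space[OF domain_sets(3)])
  ultimately show ?thesis by (simp add: L2_def l2_fun_def)
qed

lemma l2_fun_imp_L2: "f \<in> l2_fun \<Longrightarrow> f \<in> L2 \<Omega>"
  unfolding L2_iff
proof (rule l2_fun_bound)
  assume f: "f \<in> l2_fun"
  show "integrable lebesgue (\<lambda>x. (norm (f x))\<^sup>2)" by (rule l2_fun_integrable[OF f])
  have [measurable]: "f \<in> borel_measurable lebesgue" "indicat_real \<Omega> \<in> borel_measurable lebesgue"
    using l2_fun_measurable[OF f] borel_measurable_indicator[OF domain_sets(2)] by blast+
  show "restr \<Omega> f \<in> borel_measurable lebesgue" unfolding restr_def by measurable
  show "(norm (restr \<Omega> f x))\<^sup>2 \<le> (norm (f x))\<^sup>2" for x by (simp add: norm_restr_power2 indicator_def)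
qed

lemma L2_lincomb: "f \<in> L2 \<Omega> \<Longrightarrow> g \<in> L2 \<Omega> \<Longrightarrow> (\<lambda>x. c *\<^sub>R f x + d *\<^sub>R g x) \<in> L2 \<Omega>"
  unfolding L2_iff restr_add restr_scaleR by (intro l2_fun_add l2_fun_scaleR)

lemma l2_class_lincomb:
  "f \<in> L2 \<Omega> \<Longrightarrow> g \<in> L2 \<Omega> \<Longrightarrow> l2_class \<Omega> (\<lambda>x. c *\<^sub>R f x + d *\<^sub>R g x) = c *\<^sub>R l2_class \<Omega> f + d *\<^sub>R l2_class \<Omega> g"
  unfolding L2_iff l2_class_def restr_add restr_scaleR by (simp add: abs_l2_simps)

lemma integral_domain:
  fixes f :: "'a \<Rightarrow> 'b::{banach,second_countable_topology}"
  shows "(LINT x|lebesgue_on \<Omega>. f x) = (LINT x|lebesgue. indicator \<Omega> x *\<^sub>R f x)"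
  by (rule integral_restrict_space[OF domain_sets(3)])

lemma inner_l2_class:
  "f \<in> L2 \<Omega> \<Longrightarrow> g \<in> L2 \<Omega> \<Longrightarrow> l2_class \<Omega> f \<bullet> l2_class \<Omega> g = (LINT x|lebesgue_on \<Omega>. f x \<bullet> g x)"
proof -
  have "restr \<Omega> f x \<bullet> restr \<Omega> g x = indicator \<Omega> x *\<^sub>R (f x \<bullet> g x)" for x
    by (simp add: restr_def indicator_def)
  then show "f \<in> L2 \<Omega> \<Longrightarrow> g \<in> L2 \<Omega> \<Longrightarrow> ?thesis"
    unfolding L2_iff l2_class_def integral_domain by (simp add: inner_abs_l2)
qed

lemma norm_l2_class: "f \<in> L2 \<Omega> \<Longrightarrow> (norm (l2_class \<Omega> f))\<^sup>2 = (LINT x|lebesgue_on \<Omega>. (norm (f x))\<^sup>2)"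
  by (simp add: power2_norm_eq_inner inner_l2_class)

lemma L2_inner_integrable:
  assumes "f \<in> L2 \<Omega>" "g \<in> L2 \<Omega>"
  shows "integrable (lebesgue_on \<Omega>) (\<lambda>x. f x \<bullet> g x)"
proof -
  have "integrable lebesgue (\<lambda>x. restr \<Omega> f x \<bullet> restr \<Omega> g x)"
    using assms unfolding L2_iff by (rule l2_fun_inner_integrable)
  moreover have "restr \<Omega> f x \<bullet> restr \<Omega> g x = indicator \<Omega> x *\<^sub>R (f x \<bullet> g x)" for x
    by (simp add: restr_def indicator_def)
  ultimately show ?thesis by (simp add: integrable_restrict_space[OF domain_sets(3)])
qed

lemma AE_domain: "(AE x in lebesgue_on \<Omega>. P x) \<longleftrightarrow> (AE x in lebesgue. x \<in> \<Omega> \<longrightarrow> P x)"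
  by (rule AE_restrict_space_iff[OF domain_sets(3)])

lemma l2_class_eq_iff:
  assumes "f \<in> L2 \<Omega>" "g \<in> L2 \<Omega>"
  shows "l2_class \<Omega> f = l2_class \<Omega> g \<longleftrightarrow> (AE x in lebesgue_on \<Omega>. f x = g x)"
proof -
  have "restr \<Omega> f x = restr \<Omega> g x \<longleftrightarrow> (x \<in> \<Omega> \<longrightarrow> f x = g x)" for x
    by (auto simp: restr_def indicator_def)
  then show ?thesis
    using assms unfolding AE_domain L2_iff l2_class_def by (simp add: abs_l2_eq_iff)
qed

lemma l2_class_zero: "l2_class \<Omega> (\<lambda>x. 0) = 0"
  by (simp add: l2_class_def restr_def zero_l2_def)

lemma l2_class_eq_0_iff: "f \<in> L2 \<Omega> \<Longrightarrow> l2_class \<Omega> f = 0 \<longleftrightarrow> (AE x in lebesgue_on \<Omega>. f x = 0)"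
  using l2_class_eq_iff[of f "\<lambda>x. 0"] by (simp add: l2_fun_imp_L2[OF l2_fun_zero] l2_class_zero)

lemma norm_l2_class_le: "f \<in> l2_fun \<Longrightarrow> norm (l2_class \<Omega> f) \<le> norm (abs_l2 f)"
proof (rule power2_le_imp_le)
  assume f: "f \<in> l2_fun"
  then have f': "restr \<Omega> f \<in> l2_fun" using l2_fun_imp_L2 L2_iff by blast
  show "(norm (l2_class \<Omega> f))\<^sup>2 \<le> (norm (abs_l2 f))\<^sup>2"
    unfolding l2_class_def norm_abs_l2[OF f] norm_abs_l2[OF f']
    by (intro Bochner_Integration.integral_mono l2_fun_integrable f f')
      (simp add: norm_restr_power2 indicator_def)
qed simp

text \<open>Restriction to \<Omega> does not increase norms and leaves the classes of the
  \<open>f n\<close> fixed, so these also converge to the restriction of the limit, which therefore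
  equals the limit.\<close>

lemma l2_class_limit:
  assumes f: "\<And>n. f n \<in> L2 \<Omega>" and lim: "(\<lambda>n. l2_class \<Omega> (f n)) \<longlonglongrightarrow> w"
  obtains h where "h \<in> L2 \<Omega>" "w = l2_class \<Omega> h"
proof -
  obtain h where h: "h \<in> l2_fun" "w = abs_l2 h" by (rule l2_rep)
  have hL: "h \<in> L2 \<Omega>" using l2_fun_imp_L2[OF h(1)] .
  have "norm (l2_class \<Omega> (f n) - l2_class \<Omega> h) \<le> norm (l2_class \<Omega> (f n) - w)" for n
  proof -
    have rf: "restr \<Omega> (f n) \<in> l2_fun" using f L2_iff by blast
    have d: "(\<lambda>x. restr \<Omega> (f n) x - h x) \<in> l2_fun" using rf h by (intro l2_fun_diff)
    have "l2_class \<Omega> (f n) - l2_class \<Omega> h = l2_class \<Omega> (\<lambda>x. restr \<Omega> (f n) x - h x)"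
    proof -
      have "restr \<Omega> (\<lambda>x. restr \<Omega> (f n) x - h x) = (\<lambda>x. restr \<Omega> (f n) x - restr \<Omega> h x)"
        by (auto simp: restr_def indicator_def)
      then show ?thesis using rf hL unfolding l2_class_def L2_iff by (simp add: abs_l2_simps)
    qed
    also have "norm \<dots> \<le> norm (abs_l2 (\<lambda>x. restr \<Omega> (f n) x - h x))" by (rule norm_l2_class_le[OF d])
    also have "\<dots> = norm (l2_class \<Omega> (f n) - w)" using rf h by (simp add: l2_class_def abs_l2_simps)
    finally show ?thesis .
  qed
  moreover have "(\<lambda>n. norm (l2_class \<Omega> (f n) - w)) \<longlonglongrightarrow> 0" using lim LIM_zero tendsto_norm_zero by blast
  ultimately have "(\<lambda>n. l2_class \<Omega> (f n) - l2_class \<Omega> h) \<longlonglongrightarrow> 0"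
    by (rule Lim_null_comparison[OF always_eventually[OF allI]])
  then have "(\<lambda>n. l2_class \<Omega> (f n)) \<longlonglongrightarrow> l2_class \<Omega> h" by (simp add: LIM_zero_iff)
  with lim have "w = l2_class \<Omega> h" by (rule LIMSEQ_unique)
  with hL that show thesis by blast
qed

section \<open>Test functions and weak gradients in terms of classes\<close>

lemma test_zero_outside:
  assumes "\<phi> \<in> test_functions \<Omega>" "x \<notin> \<Omega>"
  shows "\<phi> x = 0" "grad \<phi> x = 0"
proof -
  obtain K where K: "compact K" "K \<subseteq> \<Omega>" "\<And>x. x \<notin> K \<Longrightarrow> \<phi> x = 0" using test_functionsD[OF assms(1)] by metis
  show "\<phi> x = 0" using K assms by blast
  show "grad \<phi> x = 0"
  proof (rule has_derivative_zero_on_open)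
    show "open (- K)" using K by (simp add: compact_imp_closed open_Compl)
    show "(\<phi> has_derivative (\<bullet>) (grad \<phi> x)) (at x)"
      using test_function_C1c[OF assms(1)] by (rule C1c_has_derivative)
  qed (use K assms in auto)
qed

lemma test_restr:
  assumes "\<phi> \<in> test_functions \<Omega>"
  shows "restr \<Omega> \<phi> = \<phi>" "restr \<Omega> (grad \<phi>) = grad \<phi>"
proof -
  show "restr \<Omega> \<phi> = \<phi>"
  proof
    show "restr \<Omega> \<phi> x = \<phi> x" for x
      using test_zero_outside(1)[OF assms, of x] by (cases "x \<in> \<Omega>") (auto simp: restr_def)
  qed
  show "restr \<Omega> (grad \<phi>) = grad \<phi>"
  proof
    show "restr \<Omega> (grad \<phi>) x = grad \<phi> x" for x
      using test_zero_outside(2)[OF assms, of x] by (cases "x \<in> \<Omega>") (auto simp: restr_def)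
  qed
qed

lemma test_L2:
  assumes "\<phi> \<in> test_functions \<Omega>"
  shows "\<phi> \<in> L2 \<Omega>" "grad \<phi> \<in> L2 \<Omega>"
  using C1c_l2_fun[OF test_function_C1c[OF assms]] unfolding L2_iff test_restr[OF assms] by blast+

lemma test_L2_components:
  fixes i :: 'a
  assumes "\<phi> \<in> test_functions \<Omega>"
  shows "(\<lambda>x. grad \<phi> x \<bullet> i) \<in> L2 \<Omega>" "(\<lambda>x. \<phi> x *\<^sub>R i) \<in> L2 \<Omega>"
proof -
  have 1: "\<phi> \<in> l2_fun" "grad \<phi> \<in> l2_fun" using C1c_l2_fun[OF test_function_C1c[OF assms]] by auto
  have "(\<lambda>x. grad \<phi> x \<bullet> i) \<in> l2_fun"
  proof (rule l2_fun_bound)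
    show "integrable lebesgue (\<lambda>x. (norm i)\<^sup>2 * (norm (grad \<phi> x))\<^sup>2)"
      using l2_fun_integrable[OF 1(2)] by simp
    show "(norm (grad \<phi> x \<bullet> i))\<^sup>2 \<le> (norm i)\<^sup>2 * (norm (grad \<phi> x))\<^sup>2" for x
      using power_mono[OF Cauchy_Schwarz_ineq2[of "grad \<phi> x" i], of 2]
          by (simp add: power_mult_distrib mult.commute)
    show "(\<lambda>x. grad \<phi> x \<bullet> i) \<in> borel_measurable lebesgue" using 1(2) by (auto simp: l2_fun_def)
  qed
  then show "(\<lambda>x. grad \<phi> x \<bullet> i) \<in> L2 \<Omega>" by (rule l2_fun_imp_L2)
  have "(\<lambda>x. \<phi> x *\<^sub>R i) \<in> l2_fun"
  proof (rule l2_fun_bound)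
    show "integrable lebesgue (\<lambda>x. (norm i)\<^sup>2 * (norm (\<phi> x))\<^sup>2)"
      using l2_fun_integrable[OF 1(1)] by simp
    show "(norm (\<phi> x *\<^sub>R i))\<^sup>2 \<le> (norm i)\<^sup>2 * (norm (\<phi> x))\<^sup>2" for x by (simp add: power_mult_distrib)
    show "(\<lambda>x. \<phi> x *\<^sub>R i) \<in> borel_measurable lebesgue" using 1(1) by (auto simp: l2_fun_def)
  qed
  then show "(\<lambda>x. \<phi> x *\<^sub>R i) \<in> L2 \<Omega>" by (rule l2_fun_imp_L2)
qed

text \<open>The defining identities become inner products with fixed vectors, in which linearity and
  passage to the limit are immediate.\<close>

lemma is_weak_gradient_iff:
  assumes u: "u \<in> L2 \<Omega>"
  shows "is_weak_gradient \<Omega> u g \<longleftrightarrow> g \<in> L2 \<Omega> \<and> (\<forall>\<phi>\<in>test_functions \<Omega>. \<forall>i\<in>Basis.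
    l2_class \<Omega> u \<bullet> l2_class \<Omega> (\<lambda>x. grad \<phi> x \<bullet> i) = - (l2_class \<Omega> g \<bullet> l2_class \<Omega> (\<lambda>x. \<phi> x *\<^sub>R i)))"
proof -
  have "l2_class \<Omega> u \<bullet> l2_class \<Omega> (\<lambda>x. grad \<phi> x \<bullet> i) =
      (LINT x|lebesgue_on \<Omega>. u x * frechet_derivative \<phi> (at x) i)"
    if "\<phi> \<in> test_functions \<Omega>" for \<phi> i
    using u test_L2_components(1)[OF that] by (simp add: inner_l2_class frechet_derivative_eq_grad[OF that])
  moreover have "l2_class \<Omega> g \<bullet> l2_class \<Omega> (\<lambda>x. \<phi> x *\<^sub>R i) = (LINT x|lebesgue_on \<Omega>. (g x \<bullet> i) * \<phi> x)"
    if "\<phi> \<in> test_functions \<Omega>" "g \<in> L2 \<Omega>" for \<phi> i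
    using that test_L2_components(2)[OF that(1)] by (simp add: inner_l2_class mult.commute)
  ultimately show ?thesis unfolding is_weak_gradient_def by auto
qed

text \<open>Each component of the difference is orthogonal to all test functions, so the fundamental
  lemma applies; its integrability follows from boundedness of \<Omega>, by which constants are
  square integrable.\<close>

lemma is_weak_gradient_unique:
  assumes u: "u \<in> L2 \<Omega>" and g: "is_weak_gradient \<Omega> u g" and g': "is_weak_gradient \<Omega> u g'"
  shows "l2_class \<Omega> g = l2_class \<Omega> g'"
proof -
  have gL: "g \<in> L2 \<Omega>" "g' \<in> L2 \<Omega>" using g g' by (auto simp: is_weak_gradient_def)
  define d where "d x = 1 *\<^sub>R g x + (-1) *\<^sub>R g' x" for x
  have dL: "d \<in> L2 \<Omega>" unfolding d_def using gL by (rule L2_lincomb)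
  have "AE x in lebesgue. x \<in> \<Omega> \<longrightarrow> restr \<Omega> d x \<bullet> i = 0" if i: "i \<in> Basis" for i
  proof (rule fundamental_lemma[OF _ open_domain])
    have "(\<lambda>x::'a. i) \<in> L2 \<Omega>"
    proof -
      have "integrable lebesgue (\<lambda>x. indicator \<Omega> x *\<^sub>R (norm i)\<^sup>2)"
      proof -
        have "emeasure lebesgue \<Omega> < \<infinity>"
          using emeasure_bounded_finite[OF bounded_domain] open_domain by simp
        then show ?thesis using domain_sets by (auto simp: integrable_indicator_iff)
      qed
      moreover have "restr \<Omega> (\<lambda>x. i) \<in> borel_measurable lebesgue"
        unfolding restr_def by (intro borel_measurable_scaleR borel_measurable_indicator domain_sets
            borel_measurable_const)
      ultimately show ?thesis unfolding L2_iff l2_fun_def by (simp add: norm_restr_power2)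
    qed
    from L2_inner_integrable[OF dL this] show "integrable lebesgue (\<lambda>x. restr \<Omega> d x \<bullet> i)"
      unfolding integrable_restrict_space[OF domain_sets(3)] by (simp add: restr_def)
    fix \<phi> assume \<phi>: "\<phi> \<in> test_functions \<Omega>"
    have "(LINT x|lebesgue. restr \<Omega> d x \<bullet> i * \<phi> x) = (LINT x|lebesgue_on \<Omega>. d x \<bullet> (\<phi> x *\<^sub>R i))"
      unfolding integral_domain by (intro Bochner_Integration.integral_cong) (auto simp: restr_def mult_ac)
    also have "\<dots> = l2_class \<Omega> d \<bullet> l2_class \<Omega> (\<lambda>x. \<phi> x *\<^sub>R i)"
      using dL test_L2_components(2)[OF \<phi>] by (simp add: inner_l2_class)
    also have "\<dots> = l2_class \<Omega> g \<bullet> l2_class \<Omega> (\<lambda>x. \<phi> x *\<^sub>R i) - l2_class \<Omega> g' \<bullet> l2_class \<Omega> (\<lambda>x. \<phi> x *\<^sub>R i)"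
      unfolding d_def l2_class_lincomb[OF gL] by (simp add: inner_diff_left)
    also have "\<dots> = 0"
      using g g' i \<phi> unfolding is_weak_gradient_iff[OF u] by auto
    finally show "(LINT x|lebesgue. restr \<Omega> d x \<bullet> i * \<phi> x) = 0" .
  qed
  then have "AE x in lebesgue. \<forall>i\<in>Basis. x \<in> \<Omega> \<longrightarrow> restr \<Omega> d x \<bullet> i = 0"
    by (intro AE_finite_allI) auto
  then have "AE x in lebesgue. x \<in> \<Omega> \<longrightarrow> g x = g' x"
  proof eventually_elim
    case (elim x)
    show ?case
    proof
      assume "x \<in> \<Omega>"
      have "d x = 0"
      proof (rule euclidean_eqI)
        fix i :: 'a assume "i \<in> Basis"
        with elim \<open>x \<in> \<Omega>\<close> have "restr \<Omega> d x \<bullet> i = 0" by blast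
        then show "d x \<bullet> i = 0 \<bullet> i" using \<open>x \<in> \<Omega>\<close> by (simp add: restr_def)
      qed
      then show "g x = g' x" by (simp add: d_def)
    qed
  qed
  then show ?thesis using gL by (simp add: l2_class_eq_iff AE_domain)
qed

lemma H1_D:
  assumes "u \<in> H1 \<Omega>"
  shows "u \<in> L2 \<Omega>" "is_weak_gradient \<Omega> u (weak_grad \<Omega> u)" "weak_grad \<Omega> u \<in> L2 \<Omega>"
proof -
  show "u \<in> L2 \<Omega>" using assms by (simp add: H1_def)
  show "is_weak_gradient \<Omega> u (weak_grad \<Omega> u)"
    unfolding weak_grad_def by (rule someI_ex[of "is_weak_gradient \<Omega> u"]) (use assms in \<open>simp add: H1_def\<close>)
  then show "weak_grad \<Omega> u \<in> L2 \<Omega>" by (simp add: is_weak_gradient_def)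
qed

text \<open>Any weak gradient at hand may be used to compute \<open>grad_class\<close>, whichever
  one \<open>weak_grad\<close> selects.\<close>

lemma H1_I:
  assumes "u \<in> L2 \<Omega>" "is_weak_gradient \<Omega> u g"
  shows "u \<in> H1 \<Omega>" "grad_class \<Omega> u = l2_class \<Omega> g"
proof -
  show u: "u \<in> H1 \<Omega>" using assms by (auto simp: H1_def)
  show "grad_class \<Omega> u = l2_class \<Omega> g" unfolding grad_class_def
    using is_weak_gradient_unique[OF assms(1) H1_D(2)[OF u] assms(2)] .
qed

lemma dirichlet_integral_eq: "u \<in> H1 \<Omega> \<Longrightarrow> dirichlet_integral \<Omega> u = (norm (grad_class \<Omega> u))\<^sup>2"
  by (simp add: dirichlet_integral_def grad_class_def norm_l2_class H1_D)

lemma H10_norm_eq: "u \<in> H1 \<Omega> \<Longrightarrow> H10_norm \<Omega> u = norm (grad_class \<Omega> u)"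
  by (simp add: H10_norm_def dirichlet_integral_eq)

lemma H1_norm_eq: "u \<in> H1 \<Omega> \<Longrightarrow> H1_norm \<Omega> u = norm (h1_class \<Omega> u)"
  using norm_l2_class[OF H1_D(1), of u]
  by (simp add: H1_norm_def dirichlet_integral_eq h1_class_def norm_Pair)

lemma H1_lincomb:
  assumes u: "u \<in> H1 \<Omega>" and v: "v \<in> H1 \<Omega>"
  shows "(\<lambda>x. c * u x + d * v x) \<in> H1 \<Omega>"
    "h1_class \<Omega> (\<lambda>x. c * u x + d * v x) = c *\<^sub>R h1_class \<Omega> u + d *\<^sub>R h1_class \<Omega> v"
proof -
  note uv = H1_D(1)[OF u] H1_D(1)[OF v] and g = H1_D(3)[OF u] H1_D(3)[OF v]
  have w: "(\<lambda>x. c * u x + d * v x) \<in> L2 \<Omega>" using L2_lincomb[OF uv, of c d] by simp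
  have wc: "l2_class \<Omega> (\<lambda>x. c * u x + d * v x) = c *\<^sub>R l2_class \<Omega> u + d *\<^sub>R l2_class \<Omega> v"
    using l2_class_lincomb[OF uv, of c d] by simp
  have wg: "is_weak_gradient \<Omega> (\<lambda>x. c * u x + d * v x) (\<lambda>x. c *\<^sub>R weak_grad \<Omega> u x + d *\<^sub>R weak_grad \<Omega> v x)"
    using H1_D(2)[OF u] H1_D(2)[OF v]
    unfolding is_weak_gradient_iff[OF w] is_weak_gradient_iff[OF uv(1)] is_weak_gradient_iff[OF uv(2)]
      wc l2_class_lincomb[OF g]
    by (auto simp: L2_lincomb inner_add_left)
  show "(\<lambda>x. c * u x + d * v x) \<in> H1 \<Omega>" by (rule H1_I[OF w wg])
  show "h1_class \<Omega> (\<lambda>x. c * u x + d * v x) = c *\<^sub>R h1_class \<Omega> u + d *\<^sub>R h1_class \<Omega> v"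
    unfolding h1_class_def H1_I(2)[OF w wg] wc l2_class_lincomb[OF g] by (simp add: grad_class_def)
qed

lemma test_H1:
  assumes \<phi>: "\<phi> \<in> test_functions \<Omega>"
  shows "\<phi> \<in> H1 \<Omega>" "l2_class \<Omega> \<phi> = abs_l2 \<phi>" "grad_class \<Omega> \<phi> = abs_l2 (grad \<phi>)"
proof -
  have g: "is_weak_gradient \<Omega> \<phi> (grad \<phi>)"
    unfolding is_weak_gradient_iff[OF test_L2(1)[OF \<phi>]]
  proof (intro conjI ballI test_L2(2)[OF \<phi>])
    fix \<psi> and i :: 'a assume \<psi>: "\<psi> \<in> test_functions \<Omega>" and i: "i \<in> Basis"
    note [measurable] = C1c_borel[OF test_function_C1c[OF \<phi>]] C1c_borel[OF test_function_C1c[OF \<psi>]]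
    have "l2_class \<Omega> \<phi> \<bullet> l2_class \<Omega> (\<lambda>x. grad \<psi> x \<bullet> i) = (LINT x|lebesgue_on \<Omega>. \<phi> x * (grad \<psi> x \<bullet> i))"
      using test_L2(1)[OF \<phi>] test_L2_components(1)[OF \<psi>] by (simp add: inner_l2_class)
    also have "\<dots> = (LINT x|lebesgue. \<phi> x * (grad \<psi> x \<bullet> i))"
      unfolding integral_domain using test_zero_outside[OF \<phi>]
      by (intro Bochner_Integration.integral_cong) (auto simp: indicator_def)
    also have "\<dots> = (LINT x|lborel. \<phi> x * (grad \<psi> x \<bullet> i))" by (rule integral_completion) simp
    also have "\<dots> = - (LINT x|lborel. (grad \<phi> x \<bullet> i) * \<psi> x)"
      by (rule C1c_integration_by_parts[OF test_function_C1c[OF \<phi>] test_function_C1c[OF \<psi>]])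
    also have "(LINT x|lborel. (grad \<phi> x \<bullet> i) * \<psi> x) = (LINT x|lebesgue. (grad \<phi> x \<bullet> i) * \<psi> x)"
      by (rule integral_completion[symmetric]) simp
    also have "\<dots> = (LINT x|lebesgue_on \<Omega>. grad \<phi> x \<bullet> (\<psi> x *\<^sub>R i))"
      unfolding integral_domain using test_zero_outside[OF \<phi>]
      by (intro Bochner_Integration.integral_cong) (auto simp: indicator_def)
    also have "\<dots> = l2_class \<Omega> (grad \<phi>) \<bullet> l2_class \<Omega> (\<lambda>x. \<psi> x *\<^sub>R i)"
      using test_L2(2)[OF \<phi>] test_L2_components(2)[OF \<psi>] by (simp add: inner_l2_class)
    finally show "l2_class \<Omega> \<phi> \<bullet> l2_class \<Omega> (\<lambda>x. grad \<psi> x \<bullet> i) =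
        - (l2_class \<Omega> (grad \<phi>) \<bullet> l2_class \<Omega> (\<lambda>x. \<psi> x *\<^sub>R i))" .
  qed
  show "\<phi> \<in> H1 \<Omega>" using H1_I(1)[OF test_L2(1)[OF \<phi>] g] .
  show "l2_class \<Omega> \<phi> = abs_l2 \<phi>" by (simp add: l2_class_def test_restr[OF \<phi>])
  show "grad_class \<Omega> \<phi> = abs_l2 (grad \<phi>)"
    using H1_I(2)[OF test_L2(1)[OF \<phi>] g] by (simp add: l2_class_def test_restr[OF \<phi>])
qed

section \<open>The closed subspace of functions with zero boundary values\<close>

lemma H10_iff: "u \<in> H10 \<Omega> \<longleftrightarrow> u \<in> H1 \<Omega> \<and>
    (\<exists>\<phi>::nat \<Rightarrow> 'a \<Rightarrow> real. (\<forall>k. \<phi> k \<in> test_functions \<Omega>) \<and> (\<lambda>k. h1_class \<Omega> (\<phi> k)) \<longlonglongrightarrow> h1_class \<Omega> u)"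
proof -
  have "(\<lambda>k. H1_norm \<Omega> (\<lambda>x. u x - \<phi> k x)) \<longlonglongrightarrow> 0 \<longleftrightarrow> (\<lambda>k. h1_class \<Omega> (\<phi> k)) \<longlonglongrightarrow> h1_class \<Omega> u"
    if u: "u \<in> H1 \<Omega>" and \<phi>: "\<forall>k. \<phi> k \<in> test_functions \<Omega>" for \<phi> :: "nat \<Rightarrow> 'a \<Rightarrow> real"
  proof -
    have "H1_norm \<Omega> (\<lambda>x. u x - \<phi> k x) = norm (h1_class \<Omega> (\<phi> k) - h1_class \<Omega> u)" for k
    proof -
      have "\<phi> k \<in> H1 \<Omega>" using \<phi> test_H1(1) by blast
      from H1_lincomb[OF u this, of 1 "-1"] show ?thesis by (simp add: H1_norm_eq norm_minus_commute)
    qed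
    then show ?thesis by (simp add: tendsto_norm_zero_iff LIM_zero_iff)
  qed
  then show ?thesis unfolding H10_def by blast
qed

lemma H10_imp_H1: "u \<in> H10 \<Omega> \<Longrightarrow> u \<in> H1 \<Omega>" by (simp add: H10_iff)

lemma test_H10: "\<phi> \<in> test_functions \<Omega> \<Longrightarrow> \<phi> \<in> H10 \<Omega>"
  unfolding H10_iff using test_H1(1)[of \<phi>] by (intro conjI exI[of _ "\<lambda>k. \<phi>"]) simp_all

lemma H10_lincomb:
  assumes u: "u \<in> H10 \<Omega>" and v: "v \<in> H10 \<Omega>"
  shows "(\<lambda>x. c * u x + d * v x) \<in> H10 \<Omega>"
proof -
  obtain \<phi> where \<phi>: "\<And>k::nat. \<phi> k \<in> test_functions \<Omega>" "(\<lambda>k. h1_class \<Omega> (\<phi> k)) \<longlonglongrightarrow> h1_class \<Omega> u"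
    using u unfolding H10_iff by blast
  obtain \<psi> where \<psi>: "\<And>k::nat. \<psi> k \<in> test_functions \<Omega>" "(\<lambda>k. h1_class \<Omega> (\<psi> k)) \<longlonglongrightarrow> h1_class \<Omega> v"
    using v unfolding H10_iff by blast
  have t: "(\<lambda>x. c * \<phi> k x + d * \<psi> k x) \<in> test_functions \<Omega>" for k
    using \<phi> \<psi> by (intro test_functions_lincomb)
  have "(\<lambda>k. c *\<^sub>R h1_class \<Omega> (\<phi> k) + d *\<^sub>R h1_class \<Omega> (\<psi> k)) \<longlonglongrightarrow> c *\<^sub>R h1_class \<Omega> u + d *\<^sub>R h1_class \<Omega> v"
    by (intro tendsto_intros \<phi> \<psi>)
  then have "(\<lambda>k. h1_class \<Omega> (\<lambda>x. c * \<phi> k x + d * \<psi> k x)) \<longlonglongrightarrow> h1_class \<Omega> (\<lambda>x. c * u x + d * v x)"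
    by (simp add: H1_lincomb H10_imp_H1[OF u] H10_imp_H1[OF v] test_H1 \<phi> \<psi>)
  then show ?thesis unfolding H10_iff
    using t H1_lincomb(1)[OF H10_imp_H1[OF u] H10_imp_H1[OF v]]
    by (intro conjI exI[of _ "\<lambda>k x. c * \<phi> k x + d * \<psi> k x"]) auto
qed

text \<open>Both components converge separately, and each identity that defines a weak gradient is
  continuous in the pair, so the limit is again a function with its weak gradient.\<close>

lemma test_limit_H10:
  assumes \<phi>: "\<And>k::nat. \<phi> k \<in> test_functions \<Omega>" and lim: "(\<lambda>k. h1_class \<Omega> (\<phi> k)) \<longlonglongrightarrow> w"
  obtains u where "u \<in> H10 \<Omega>" "h1_class \<Omega> u = w"
proof -
  have l1: "(\<lambda>k. l2_class \<Omega> (\<phi> k)) \<longlonglongrightarrow> fst w" using tendsto_fst[OF lim] by (simp add: h1_class_def)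
  have l2: "(\<lambda>k. grad_class \<Omega> (\<phi> k)) \<longlonglongrightarrow> snd w" using tendsto_snd[OF lim] by (simp add: h1_class_def)
  obtain u where u: "u \<in> L2 \<Omega>" "fst w = l2_class \<Omega> u" using l2_class_limit[OF test_L2(1)[OF \<phi>] l1] by blast
  obtain g where g: "g \<in> L2 \<Omega>" "snd w = l2_class \<Omega> g"
    using l2_class_limit[OF H1_D(3)[OF test_H1(1)[OF \<phi>]] l2[unfolded grad_class_def]] by blast
  have wg: "is_weak_gradient \<Omega> u g"
    unfolding is_weak_gradient_iff[OF u(1)]
  proof (intro conjI ballI g(1))
    fix \<psi> and i :: 'a assume \<psi>: "\<psi> \<in> test_functions \<Omega>" and i: "i \<in> Basis"
    have "(\<lambda>k. l2_class \<Omega> (\<phi> k) \<bullet> l2_class \<Omega> (\<lambda>x. grad \<psi> x \<bullet> i))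
        \<longlonglongrightarrow> l2_class \<Omega> u \<bullet> l2_class \<Omega> (\<lambda>x. grad \<psi> x \<bullet> i)"
      using l1 unfolding u(2) by (intro tendsto_intros)
    moreover have "l2_class \<Omega> (\<phi> k) \<bullet> l2_class \<Omega> (\<lambda>x. grad \<psi> x \<bullet> i) =
        - (grad_class \<Omega> (\<phi> k) \<bullet> l2_class \<Omega> (\<lambda>x. \<psi> x *\<^sub>R i))" for k
      using H1_D(2)[OF test_H1(1)[OF \<phi>], of k] \<psi> i
      unfolding is_weak_gradient_iff[OF test_L2(1)[OF \<phi>]] grad_class_def by blast
    moreover have "(\<lambda>k. - (grad_class \<Omega> (\<phi> k) \<bullet> l2_class \<Omega> (\<lambda>x. \<psi> x *\<^sub>R i)))
        \<longlonglongrightarrow> - (l2_class \<Omega> g \<bullet> l2_class \<Omega> (\<lambda>x. \<psi> x *\<^sub>R i))"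
      using l2 unfolding g(2) by (intro tendsto_intros)
    ultimately show "l2_class \<Omega> u \<bullet> l2_class \<Omega> (\<lambda>x. grad \<psi> x \<bullet> i) =
        - (l2_class \<Omega> g \<bullet> l2_class \<Omega> (\<lambda>x. \<psi> x *\<^sub>R i))"
      using LIMSEQ_unique by simp
  qed
  have w: "h1_class \<Omega> u = w" unfolding h1_class_def H1_I(2)[OF u(1) wg] u(2)[symmetric] g(2)[symmetric]
      by simp
  have "u \<in> H10 \<Omega>" unfolding H10_iff using H1_I(1)[OF u(1) wg] \<phi> lim w by blast
  with w that show thesis by blast
qed

lemma H10_approx:
  assumes u: "u \<in> H10 \<Omega>" and e: "e > 0"
  obtains \<phi> where "\<phi> \<in> test_functions \<Omega>" "norm (h1_class \<Omega> \<phi> - h1_class \<Omega> u) < e"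
proof -
  obtain \<phi> where \<phi>: "\<And>k::nat. \<phi> k \<in> test_functions \<Omega>" "(\<lambda>k. h1_class \<Omega> (\<phi> k)) \<longlonglongrightarrow> h1_class \<Omega> u"
    using u unfolding H10_iff by blast
  obtain n where "\<And>k. k \<ge> n \<Longrightarrow> norm (h1_class \<Omega> (\<phi> k) - h1_class \<Omega> u) < e" using LIMSEQ_D[OF \<phi>(2) e] by blast
  then show thesis using that[OF \<phi>(1), of n] by blast
qed

lemma H10_approx_sequence:
  assumes u: "\<And>n::nat. u n \<in> H10 \<Omega>"
  obtains \<phi> where "\<And>n. \<phi> n \<in> test_functions \<Omega>" "(\<lambda>n. h1_class \<Omega> (\<phi> n) - h1_class \<Omega> (u n)) \<longlonglongrightarrow> 0"
proof -
  have "\<exists>\<phi>. \<phi> \<in> test_functions \<Omega> \<and> norm (h1_class \<Omega> \<phi> - h1_class \<Omega> (u n)) < inverse (real (Suc n))" for n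
    by (rule H10_approx[OF u, of "inverse (real (Suc n))"]) auto
  then obtain \<phi> where \<phi>: "\<And>n. \<phi> n \<in> test_functions \<Omega>"
    "\<And>n. norm (h1_class \<Omega> (\<phi> n) - h1_class \<Omega> (u n)) < inverse (real (Suc n))" by metis
  have "(\<lambda>n. h1_class \<Omega> (\<phi> n) - h1_class \<Omega> (u n)) \<longlonglongrightarrow> 0"
    using \<phi>(2) by (intro Lim_null_comparison[OF _ LIMSEQ_inverse_real_of_nat] always_eventually allI
        less_imp_le)
  with \<phi>(1) that show thesis by blast
qed

text \<open>The weak limit of a sequence is found in the closed convex hull of its range; these two
  properties keep it inside the space. For closedness, the members of a convergent sequence are
  replaced by test functions whose distance to them tends to zero.\<close>

lemma closed_convex_H10_classes:
  shows "closed (h1_class \<Omega> ` H10 \<Omega>)" "convex (h1_class \<Omega> ` H10 \<Omega>)"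
proof -
  show "closed (h1_class \<Omega> ` H10 \<Omega>)"
    unfolding closed_sequential_limits
  proof (intro allI impI, elim conjE)
    fix X w assume X: "\<forall>n. X n \<in> h1_class \<Omega> ` H10 \<Omega>" and lim: "X \<longlonglongrightarrow> w"
    then obtain u where u: "\<And>n. u n \<in> H10 \<Omega>" "\<And>n. X n = h1_class \<Omega> (u n)" unfolding image_iff by metis
    obtain \<phi> where \<phi>: "\<And>n. \<phi> n \<in> test_functions \<Omega>" "(\<lambda>n. h1_class \<Omega> (\<phi> n) - h1_class \<Omega> (u n)) \<longlonglongrightarrow> 0"
      using H10_approx_sequence[of u] u(1) by blast
    have "(\<lambda>n. (h1_class \<Omega> (\<phi> n) - h1_class \<Omega> (u n)) + X n) \<longlonglongrightarrow> 0 + w"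
      by (intro tendsto_add \<phi> lim)
    then have "(\<lambda>n. h1_class \<Omega> (\<phi> n)) \<longlonglongrightarrow> w" by (simp add: u(2))
    from test_limit_H10[OF \<phi>(1) this] obtain v where "v \<in> H10 \<Omega>" "h1_class \<Omega> v = w" by blast
    then show "w \<in> h1_class \<Omega> ` H10 \<Omega>" by blast
  qed
  show "convex (h1_class \<Omega> ` H10 \<Omega>)"
    unfolding convex_def
  proof (intro ballI allI impI)
    fix x y and c d :: real assume "x \<in> h1_class \<Omega> ` H10 \<Omega>" "y \<in> h1_class \<Omega> ` H10 \<Omega>"
    then obtain u v where uv: "u \<in> H10 \<Omega>" "v \<in> H10 \<Omega>" "x = h1_class \<Omega> u" "y = h1_class \<Omega> v" by blast
    have "c *\<^sub>R x + d *\<^sub>R y = h1_class \<Omega> (\<lambda>x. c * u x + d * v x)"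
      using uv by (simp add: H1_lincomb H10_imp_H1)
    then show "c *\<^sub>R x + d *\<^sub>R y \<in> h1_class \<Omega> ` H10 \<Omega>" using H10_lincomb[OF uv(1,2)] by blast
  qed
qed

lemma H10_fst_snd_lincomb:
  assumes u: "u \<in> H10 \<Omega>" and v: "v \<in> H10 \<Omega>"
  shows "l2_class \<Omega> (\<lambda>x. c * u x + d * v x) = c *\<^sub>R l2_class \<Omega> u + d *\<^sub>R l2_class \<Omega> v"
    "grad_class \<Omega> (\<lambda>x. c * u x + d * v x) = c *\<^sub>R grad_class \<Omega> u + d *\<^sub>R grad_class \<Omega> v"
  using H1_lincomb(2)[OF H10_imp_H1[OF u] H10_imp_H1[OF v], of c d] by (simp_all add: h1_class_def)

section \<open>Poincare, Sobolev and Rellich theorems for zero boundary values\<close>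

lemma H10_poincare:
  obtains P where "P > 0" "\<And>u. u \<in> H10 \<Omega> \<Longrightarrow> norm (l2_class \<Omega> u) \<le> P * norm (grad_class \<Omega> u)"
proof -
  obtain R where R: "R > 0" "\<And>x. x \<in> \<Omega> \<Longrightarrow> norm x \<le> R" using bounded_domain by (auto simp: bounded_pos)
  have "norm (l2_class \<Omega> u) \<le> (2 * R + 1) * norm (grad_class \<Omega> u)" if u: "u \<in> H10 \<Omega>" for u
  proof -
    obtain \<phi> where \<phi>: "\<And>k::nat. \<phi> k \<in> test_functions \<Omega>" "(\<lambda>k. h1_class \<Omega> (\<phi> k)) \<longlonglongrightarrow> h1_class \<Omega> u"
      using u unfolding H10_iff by blast
    have "norm (l2_class \<Omega> (\<phi> k)) \<le> (2 * R + 1) * norm (grad_class \<Omega> (\<phi> k))" for k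
    proof (rule power2_le_imp_le)
      note c = test_function_C1c[OF \<phi>(1)[of k]]
      have "(LINT x|lborel. (\<phi> k x)\<^sup>2) \<le> (2 * R + 1)\<^sup>2 * (LINT x|lborel. (norm (grad (\<phi> k) x))\<^sup>2)"
        by (rule C1c_poincare[OF c]) (use R test_zero_outside(1)[OF \<phi>(1)] in \<open>force simp: not_le[symmetric]\<close>)+
      then show "(norm (l2_class \<Omega> (\<phi> k)))\<^sup>2 \<le> ((2 * R + 1) * norm (grad_class \<Omega> (\<phi> k)))\<^sup>2"
        by (simp add: test_H1[OF \<phi>(1)] C1c_norm_abs_l2[OF c] power_mult_distrib)
    qed (use R in simp)
    moreover have "(\<lambda>k. norm (l2_class \<Omega> (\<phi> k))) \<longlonglongrightarrow> norm (l2_class \<Omega> u)"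
      "(\<lambda>k. (2 * R + 1) * norm (grad_class \<Omega> (\<phi> k))) \<longlonglongrightarrow> (2 * R + 1) * norm (grad_class \<Omega> u)"
      using tendsto_fst[OF \<phi>(2)] tendsto_snd[OF \<phi>(2)] by (auto simp: h1_class_def intro!: tendsto_intros)
    ultimately show ?thesis by (intro LIMSEQ_le) auto
  qed
  with R that[of "2 * R + 1"] show thesis by auto
qed

lemma l2_class_tendsto_AE_subseq:
  assumes f: "\<And>n::nat. f n \<in> L2 \<Omega>" and g: "g \<in> L2 \<Omega>" and lim: "(\<lambda>n. l2_class \<Omega> (f n)) \<longlonglongrightarrow> l2_class \<Omega> g"
  obtains r where "strict_mono (r::nat\<Rightarrow>nat)" "AE x in lebesgue_on \<Omega>. (\<lambda>n. f (r n) x) \<longlonglongrightarrow> g x"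
proof -
  obtain r where r: "strict_mono (r::nat\<Rightarrow>nat)" "AE x in lebesgue. (\<lambda>n. restr \<Omega> (f (r n)) x) \<longlonglongrightarrow> restr \<Omega> g x"
    using abs_l2_tendsto_AE_subseq[of "\<lambda>n. restr \<Omega> (f n)" "restr \<Omega> g"] f g lim
    unfolding L2_iff l2_class_def by blast
  have "AE x in lebesgue_on \<Omega>. (\<lambda>n. f (r n) x) \<longlonglongrightarrow> g x"
    unfolding AE_domain using r(2) by eventually_elim (auto simp: restr_def)
  with r(1) that show thesis by blast
qed

text \<open>Approximating test functions converge almost everywhere along a subsequence, so Fatou's
  lemma carries the inequality, and integrability with it, to the limit.\<close>

theorem H10_sobolev:
  assumes N3: "3 \<le> DIM('a)"
  obtains C where "C > 0"
    "\<And>u. u \<in> H10 \<Omega> \<Longrightarrow> integrable (lebesgue_on \<Omega>) (\<lambda>x. \<bar>u x\<bar> powr two_star DIM('a))"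
    "\<And>u. u \<in> H10 \<Omega> \<Longrightarrow> (LINT x|lebesgue_on \<Omega>. \<bar>u x\<bar> powr two_star DIM('a))
        \<le> C * norm (grad_class \<Omega> u) powr two_star DIM('a)"
proof -
  define p where "p = two_star DIM('a)"
  have p: "p > 0" using N3 by (simp add: p_def two_star_def)
  obtain C where C: "C > 0" "\<And>(v :: 'a \<Rightarrow> real) g. C1c v g \<Longrightarrow>
    (LINT x|lborel. \<bar>v x\<bar> powr p) \<le> C * (LINT x|lborel. (norm (g x))\<^sup>2) powr (p / 2)"
    using C1c_sobolev[OF N3] unfolding p_def by metis
  have main: "integrable (lebesgue_on \<Omega>) (\<lambda>x. \<bar>u x\<bar> powr p)"
    "(LINT x|lebesgue_on \<Omega>. \<bar>u x\<bar> powr p) \<le> C * norm (grad_class \<Omega> u) powr p" if u: "u \<in> H10 \<Omega>" for u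
  proof -
    obtain \<phi> where \<phi>: "\<And>k::nat. \<phi> k \<in> test_functions \<Omega>" "(\<lambda>k. h1_class \<Omega> (\<phi> k)) \<longlonglongrightarrow> h1_class \<Omega> u"
      using u unfolding H10_iff by blast
    have l1: "(\<lambda>k. l2_class \<Omega> (\<phi> k)) \<longlonglongrightarrow> l2_class \<Omega> u" using tendsto_fst[OF \<phi>(2)] by (simp add: h1_class_def)
    have l2: "(\<lambda>k. grad_class \<Omega> (\<phi> k)) \<longlonglongrightarrow> grad_class \<Omega> u"
        using tendsto_snd[OF \<phi>(2)] by (simp add: h1_class_def)
    obtain r where r: "strict_mono (r::nat\<Rightarrow>nat)" "AE x in lebesgue_on \<Omega>. (\<lambda>n. \<phi> (r n) x) \<longlonglongrightarrow> u x"
      using l2_class_tendsto_AE_subseq[OF test_L2(1)[OF \<phi>(1)] H1_D(1)[OF H10_imp_H1[OF u]] l1] by blast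
    have um: "u \<in> borel_measurable (lebesgue_on \<Omega>)" using H1_D(1)[OF H10_imp_H1[OF u]] by (simp add: L2_def)
    have b: "integrable (lebesgue_on \<Omega>) (\<lambda>x. \<bar>\<phi> k x\<bar> powr p)"
      "(LINT x|lebesgue_on \<Omega>. \<bar>\<phi> k x\<bar> powr p) \<le> C * norm (grad_class \<Omega> (\<phi> k)) powr p" for k
    proof -
      note c = test_function_C1c[OF \<phi>(1)[of k]]
      note [measurable] = C1c_borel[OF c]
      have e: "indicator \<Omega> x *\<^sub>R \<bar>\<phi> k x\<bar> powr p = \<bar>\<phi> k x\<bar> powr p" for x
        using test_zero_outside(1)[OF \<phi>(1), of x k] p by (cases "x \<in> \<Omega>") auto
      show "integrable (lebesgue_on \<Omega>) (\<lambda>x. \<bar>\<phi> k x\<bar> powr p)"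
        unfolding integrable_restrict_space[OF domain_sets(3)] e
        using C1c_integrable(4)[OF c p] by (simp add: integrable_completion)
      have "(LINT x|lebesgue_on \<Omega>. \<bar>\<phi> k x\<bar> powr p) = (LINT x|lborel. \<bar>\<phi> k x\<bar> powr p)"
        unfolding integral_domain e by (rule integral_completion) simp
      also have "\<dots> \<le> C * ((norm (grad_class \<Omega> (\<phi> k)))\<^sup>2) powr (p / 2)"
        using C(2)[OF c] by (simp add: test_H1[OF \<phi>(1)] C1c_norm_abs_l2[OF c])
      also have "((norm (grad_class \<Omega> (\<phi> k)))\<^sup>2) powr (p / 2) = norm (grad_class \<Omega> (\<phi> k)) powr p"
        by (cases "grad_class \<Omega> (\<phi> k) = 0") (auto simp: powr_powr simp flip: powr_numeral)
      finally show "(LINT x|lebesgue_on \<Omega>. \<bar>\<phi> k x\<bar> powr p) \<le> C * norm (grad_class \<Omega> (\<phi> k)) powr p" .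
    qed
    have ae: "AE x in lebesgue_on \<Omega>. (\<lambda>n. \<bar>\<phi> (r (n + m)) x\<bar> powr p) \<longlonglongrightarrow> \<bar>u x\<bar> powr p" for m
      using r(2)
    proof eventually_elim
      case (elim x)
      from LIMSEQ_ignore_initial_segment[OF this, of m] show ?case
        using p by (intro tendsto_powr' tendsto_rabs tendsto_const) auto
    qed
    have lim: "(\<lambda>n. C * norm (grad_class \<Omega> (\<phi> (r n))) powr p) \<longlonglongrightarrow> C * norm (grad_class \<Omega> u) powr p"
      using LIMSEQ_subseq_LIMSEQ[OF l2 r(1)] p by (intro tendsto_mult tendsto_const tendsto_powr'
          tendsto_norm) (auto simp: o_def)
    \<comment> \<open>The bounds for the approximations only converge to the desired one, so it is
      first proved with an additional \<epsilon> from the tail starting at some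
      \<open>m\<close>.\<close>
    have fin: "integrable (lebesgue_on \<Omega>) (\<lambda>x. \<bar>u x\<bar> powr p) \<and>
       (LINT x|lebesgue_on \<Omega>. \<bar>u x\<bar> powr p) \<le> C * norm (grad_class \<Omega> u) powr p + \<epsilon>" if "\<epsilon> > 0" for \<epsilon>
    proof -
      have "\<forall>\<^sub>F n in sequentially. C * norm (grad_class \<Omega> (\<phi> (r n))) powr p <
          C * norm (grad_class \<Omega> u) powr p + \<epsilon>"
        using lim that by (intro order_tendstoD(2)) auto
      then obtain m where m: "\<And>n. n \<ge> m \<Longrightarrow> C * norm (grad_class \<Omega> (\<phi> (r n))) powr p
          \<le> C * norm (grad_class \<Omega> u) powr p + \<epsilon>"
        unfolding eventually_sequentially by (meson less_imp_le)
      have bd: "(LINT x|lebesgue_on \<Omega>. \<bar>\<phi> (r (n + m)) x\<bar> powr p) \<le> C * norm (grad_class \<Omega> u) powr p + \<epsilon>" for n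
        by (rule order_trans[OF b(2) m]) simp
      have mm: "(\<lambda>x. \<bar>u x\<bar> powr p) \<in> borel_measurable (lebesgue_on \<Omega>)" using um by measurable
      show ?thesis
        using integrable_fatou[OF b(1) _ ae mm bd] by simp
    qed
    show "integrable (lebesgue_on \<Omega>) (\<lambda>x. \<bar>u x\<bar> powr p)" using fin[of 1] by simp
    show "(LINT x|lebesgue_on \<Omega>. \<bar>u x\<bar> powr p) \<le> C * norm (grad_class \<Omega> u) powr p"
    proof (rule field_le_epsilon)
      fix \<epsilon> :: real assume "0 < \<epsilon>"
      from fin[OF this] show "(LINT x|lebesgue_on \<Omega>. \<bar>u x\<bar> powr p) \<le> C * norm (grad_class \<Omega> u) powr p + \<epsilon>" ..
    qed
  qed
  show thesis by (rule that[OF C(1)]) (use main in \<open>simp_all add: p_def\<close>)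
qed

text \<open>The weak limit is taken for the pairs of function and gradient, so that both components
  converge weakly to those of one \<open>w\<close>. Rellich's argument then makes the first
  component converge strongly, and a further subsequence converges almost everywhere.\<close>

theorem H10_compactness:
  assumes u: "\<And>n::nat. u n \<in> H10 \<Omega>" and B: "\<And>n. norm (grad_class \<Omega> (u n)) \<le> B"
  obtains r w where "strict_mono (r::nat\<Rightarrow>nat)" "w \<in> H10 \<Omega>"
    "\<And>v. (\<lambda>n. grad_class \<Omega> (u (r n)) \<bullet> v) \<longlonglongrightarrow> grad_class \<Omega> w \<bullet> v"
    "(\<lambda>n. l2_class \<Omega> (u (r n))) \<longlonglongrightarrow> l2_class \<Omega> w"
    "AE x in lebesgue_on \<Omega>. (\<lambda>n. u (r n) x) \<longlonglongrightarrow> w x"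
proof -
  obtain P where P: "P > 0" "\<And>u. u \<in> H10 \<Omega> \<Longrightarrow> norm (l2_class \<Omega> u) \<le> P * norm (grad_class \<Omega> u)"
    using H10_poincare by blast
  have "norm (h1_class \<Omega> (u n)) \<le> P * B + B" for n
  proof -
    have "norm (h1_class \<Omega> (u n)) \<le> norm (l2_class \<Omega> (u n)) + norm (grad_class \<Omega> (u n))"
      unfolding h1_class_def by (rule norm_Pair_le)
    also have "\<dots> \<le> P * B + B"
      using order_trans[OF P(2)[OF u] mult_left_mono[OF B]] P(1) B by (intro add_mono) auto
    finally show ?thesis .
  qed
  then obtain r w0 where r: "strict_mono (r::nat\<Rightarrow>nat)" "w0 \<in> closure (convex hull (range (\<lambda>n. h1_class \<Omega> (u
      n))))"
    "\<And>v. (\<lambda>n. h1_class \<Omega> (u (r n)) \<bullet> v) \<longlonglongrightarrow> w0 \<bullet> v"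
    using weakly_convergent_subsequence[of "\<lambda>n. h1_class \<Omega> (u n)"] by blast
  have "closure (convex hull (range (\<lambda>n. h1_class \<Omega> (u n)))) \<subseteq> h1_class \<Omega> ` H10 \<Omega>"
    using u by (intro closure_minimal hull_minimal closed_convex_H10_classes) auto
  then obtain w where w: "w \<in> H10 \<Omega>" "w0 = h1_class \<Omega> w" using r(2) by blast
  have wk: "(\<lambda>n. grad_class \<Omega> (u (r n)) \<bullet> v) \<longlonglongrightarrow> grad_class \<Omega> w \<bullet> v" for v
    using r(3)[of "(0, v)"] by (simp add: w h1_class_def inner_Pair)
  have wk2: "(\<lambda>n. l2_class \<Omega> (u (r n)) \<bullet> v) \<longlonglongrightarrow> l2_class \<Omega> w \<bullet> v" for v
    using r(3)[of "(v, 0)"] by (simp add: w h1_class_def inner_Pair)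
  define d where "d n x = 1 * u (r n) x + (-1) * w x" for n x
  have d: "d n \<in> H10 \<Omega>" for n unfolding d_def by (rule H10_lincomb[OF u w(1)])
  have dc: "l2_class \<Omega> (d n) = l2_class \<Omega> (u (r n)) - l2_class \<Omega> w" "grad_class \<Omega> (d n) =
      grad_class \<Omega> (u (r n)) - grad_class \<Omega> w" for n
    unfolding d_def H10_fst_snd_lincomb[OF u w(1)] by simp_all
  \<comment> \<open>The Rellich lemma is about continuously differentiable functions; test functions
    that approach the differences \<open>d n\<close> in $H^1$ have the same weak limit and bounded
    gradients.\<close>
  obtain \<psi> where \<psi>: "\<And>n. \<psi> n \<in> test_functions \<Omega>" "(\<lambda>n. h1_class \<Omega> (\<psi> n) - h1_class \<Omega> (d n)) \<longlonglongrightarrow> 0"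
    using H10_approx_sequence[of d] d by blast
  have l1: "(\<lambda>n. l2_class \<Omega> (\<psi> n) - l2_class \<Omega> (d n)) \<longlonglongrightarrow> 0"
      using tendsto_fst[OF \<psi>(2)] by (simp add: h1_class_def)
  have l2: "(\<lambda>n. grad_class \<Omega> (\<psi> n) - grad_class \<Omega> (d n)) \<longlonglongrightarrow> 0"
      using tendsto_snd[OF \<psi>(2)] by (simp add: h1_class_def)
  obtain B2 where B2: "\<And>n. norm (grad_class \<Omega> (\<psi> n) - grad_class \<Omega> (d n)) \<le> B2"
    using convergent_imp_bounded[OF l2] by (auto simp: bounded_iff)
  obtain R where R: "R > 0" "\<And>x. x \<in> \<Omega> \<Longrightarrow> norm x \<le> R" using bounded_domain by (auto simp: bounded_pos)
  have "(\<lambda>n. norm (abs_l2 (\<psi> n))) \<longlonglongrightarrow> 0"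
  proof (rule C1c_rellich[OF test_function_C1c[OF \<psi>(1)]])
    show "\<psi> n x = 0" if "R < norm x" for n x
      using that R(2)[of x] by (intro test_zero_outside(1)[OF \<psi>(1)]) auto
    show "0 \<le> R" using R by simp
    show "norm (abs_l2 (grad (\<psi> n))) \<le> B2 + (B + norm (grad_class \<Omega> w))" for n
    proof -
      have "norm (grad_class \<Omega> (\<psi> n)) \<le> norm (grad_class \<Omega> (\<psi> n) - grad_class \<Omega> (d n)) +
          norm (grad_class \<Omega> (d n))"
        using norm_triangle_ineq[of "grad_class \<Omega> (\<psi> n) - grad_class \<Omega> (d n)" "grad_class \<Omega> (d n)"] by simp
      also have "norm (grad_class \<Omega> (d n)) \<le> norm (grad_class \<Omega> (u (r n))) + norm (grad_class \<Omega> w)"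
        unfolding dc by (rule norm_triangle_ineq4)
      finally show ?thesis using B2[of n] B[of "r n"] by (simp add: test_H1[OF \<psi>(1)])
    qed
    fix v
    have "(\<lambda>n. (l2_class \<Omega> (\<psi> n) - l2_class \<Omega> (d n)) \<bullet> v + (l2_class \<Omega> (u (r n)) \<bullet> v - l2_class \<Omega> w \<bullet> v))
       \<longlonglongrightarrow> 0 \<bullet> v + (l2_class \<Omega> w \<bullet> v - l2_class \<Omega> w \<bullet> v)"
      by (intro tendsto_intros l1 wk2)
    then show "(\<lambda>n. abs_l2 (\<psi> n) \<bullet> v) \<longlonglongrightarrow> 0"
      by (simp add: dc inner_diff_left test_H1[OF \<psi>(1)])
  qed
  then have "(\<lambda>n. l2_class \<Omega> (\<psi> n)) \<longlonglongrightarrow> 0" by (simp add: test_H1[OF \<psi>(1)] tendsto_norm_zero_iff)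
  from tendsto_diff[OF this l1] have "(\<lambda>n. l2_class \<Omega> (d n)) \<longlonglongrightarrow> 0" by simp
  then have st: "(\<lambda>n. l2_class \<Omega> (u (r n))) \<longlonglongrightarrow> l2_class \<Omega> w" by (simp add: dc LIM_zero_iff)
  obtain s where s: "strict_mono (s::nat\<Rightarrow>nat)" "AE x in lebesgue_on \<Omega>. (\<lambda>n. u (r (s n)) x) \<longlonglongrightarrow> w x"
    using l2_class_tendsto_AE_subseq[OF H1_D(1)[OF H10_imp_H1[OF u]] H1_D(1)[OF H10_imp_H1[OF w(1)]] st]
        by blast
  show thesis
  proof (rule that[of "r \<circ> s" w])
    show "strict_mono (r \<circ> s)" using r(1) s(1) by (rule strict_mono_o)
    show "(\<lambda>n. grad_class \<Omega> (u ((r \<circ> s) n)) \<bullet> v) \<longlonglongrightarrow> grad_class \<Omega> w \<bullet> v" for v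
      using LIMSEQ_subseq_LIMSEQ[OF wk s(1)] by (simp add: o_def)
    show "(\<lambda>n. l2_class \<Omega> (u ((r \<circ> s) n))) \<longlonglongrightarrow> l2_class \<Omega> w"
      using LIMSEQ_subseq_LIMSEQ[OF st s(1)] by (simp add: o_def)
  qed (use w s in \<open>simp_all\<close>)
qed

end


section \<open>The first eigenvalue and the best Sobolev constant\<close>

lemma linear_coefficient_zero:
  fixes B D :: real
  assumes "\<And>t. 0 \<le> 2 * t * B + t\<^sup>2 * D"
  shows "B = 0"
proof (rule ccontr)
  assume B: "B \<noteq> 0"
  \<comment> \<open>A positive bound for \<open>D\<close>: at \<open>t = - B / k\<close> the linear
    term outweighs the quadratic one.\<close>
  define k where "k = \<bar>D\<bar> + 1"
  have k: "k > 0" "D < k" by (auto simp: k_def)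
  have "0 \<le> 2 * (- B / k) * B + (- B / k)\<^sup>2 * D" by (rule assms)
  also have "\<dots> = (B\<^sup>2 / k) * (D / k - 2)" using k by (simp add: power2_eq_square field_simps)
  finally have "0 \<le> (B\<^sup>2 / k) * (D / k - 2)" .
  moreover have "(B\<^sup>2 / k) * (D / k - 2) < 0"
    by (rule mult_pos_neg) (use B k in \<open>simp_all add: field_simps\<close>)
  ultimately show False by simp
qed

context bounded_domain
begin

lemma H10_nonzero_iff: "u \<in> H10_nonzero \<Omega> \<longleftrightarrow> u \<in> H10 \<Omega> \<and> l2_class \<Omega> u \<noteq> 0"
  unfolding H10_nonzero_def using l2_class_eq_0_iff[OF H1_D(1)[OF H10_imp_H1]] by blast

lemma H10_nonzero_nonempty: "H10_nonzero \<Omega> \<noteq> {}"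
proof -
  obtain x where "x \<in> \<Omega>" using domain_nonempty by blast
  then obtain a b where ab: "x \<in> box a b" "cbox a b \<subseteq> \<Omega>"
    using open_contains_cbox[OF open_domain] by metis
  have t: "box_bump a b 0 \<in> test_functions \<Omega>" using ab(2) by (rule box_bump_test)
  have "\<not> (AE x in lebesgue_on \<Omega>. box_bump a b 0 x = 0)"
  proof
    assume "AE x in lebesgue_on \<Omega>. box_bump a b 0 x = 0"
    then have "AE x in lebesgue. x \<notin> box a b"
      unfolding AE_domain
    proof eventually_elim
      case (elim x)
      then show ?case using ab(2) box_subset_cbox[of a b] by (auto simp: box_bump_zero_iff)
    qed
    then have "box a b \<in> null_sets lebesgue" by (subst AE_iff_null_sets) auto
    then have "negligible (box a b)" by (simp add: negligible_iff_null_sets)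
    then show False using ab(1) open_not_negligible[of "box a b"] by auto
  qed
  with test_H10[OF t] show ?thesis unfolding H10_nonzero_def by blast
qed

text \<open>The first eigenvalue is defined by \<open>LEAST\<close>, which says nothing until a
  least eigenvalue is exhibited. The infimum \<open>m\<close> of the Rayleigh quotient is an
  eigenvalue because compactness provides a minimiser, and it is least because every eigenvalue is
  the quotient of its eigenfunction.\<close>

theorem first_eigenvalue_poincare:
  assumes "u \<in> H10 \<Omega>"
  shows "first_dirichlet_eigenvalue \<Omega> * (norm (l2_class \<Omega> u))\<^sup>2 \<le> (norm (grad_class \<Omega> u))\<^sup>2"
proof -
  define q where "q u = (norm (grad_class \<Omega> u))\<^sup>2 / (norm (l2_class \<Omega> u))\<^sup>2" for u
  define m where "m = (INF u\<in>H10_nonzero \<Omega>. q u)"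
  have bdd: "bdd_below (q ` H10_nonzero \<Omega>)" by (rule bdd_belowI[of _ 0]) (auto simp: q_def)
  have m0: "0 \<le> m" unfolding m_def by (rule cINF_greatest[OF H10_nonzero_nonempty]) (simp add: q_def)
  have ray: "m * (norm (l2_class \<Omega> v))\<^sup>2 \<le> (norm (grad_class \<Omega> v))\<^sup>2" if v: "v \<in> H10 \<Omega>" for v
  proof (cases "l2_class \<Omega> v = 0")
    case False
    with v have "m \<le> q v" unfolding m_def by (intro cINF_lower[OF bdd]) (simp add: H10_nonzero_iff)
    with False show ?thesis by (simp add: q_def field_simps)
  qed simp
  have "\<exists>u\<in>H10_nonzero \<Omega>. q u < m + inverse (real (Suc n))" for n
  proof (rule ccontr)
    assume "\<not> ?thesis"
    then have "m + inverse (real (Suc n)) \<le> (INF u\<in>H10_nonzero \<Omega>. q u)"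
      by (intro cINF_greatest[OF H10_nonzero_nonempty]) (auto simp: not_less)
    then have "m + inverse (real (Suc n)) \<le> m" by (simp only: m_def)
    then show False by simp
  qed
  then obtain z where z: "\<And>n. z n \<in> H10_nonzero \<Omega>" "\<And>n. q (z n) < m + inverse (real (Suc n))" by metis
  \<comment> \<open>Normalisation in the mean square; strong convergence there keeps the limit
    nonzero. The summand with factor 0 fits the form of \<open>H10_lincomb\<close>.\<close>
  define v where "v n x = (1 / norm (l2_class \<Omega> (z n))) * z n x + 0 * z n x" for n x
  have zH: "z n \<in> H10 \<Omega>" "l2_class \<Omega> (z n) \<noteq> 0" for n using z(1)[of n] by (auto simp: H10_nonzero_iff)
  have v: "v n \<in> H10 \<Omega>" for n unfolding v_def by (rule H10_lincomb[OF zH(1) zH(1)])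
  have vU: "norm (l2_class \<Omega> (v n)) = 1" for n
    unfolding v_def H10_fst_snd_lincomb[OF zH(1) zH(1)] using zH(2) by simp
  have vG: "(norm (grad_class \<Omega> (v n)))\<^sup>2 = q (z n)" for n
    unfolding v_def H10_fst_snd_lincomb[OF zH(1) zH(1)] q_def by (simp add: power_divide)
  have vGle: "norm (grad_class \<Omega> (v n)) \<le> sqrt (m + inverse (real (Suc n)))" for n
    using less_imp_le[OF z(2)[of n]] vG[of n] by (simp add: real_le_rsqrt)
  have vB: "norm (grad_class \<Omega> (v n)) \<le> sqrt (m + 1)" for n
  proof -
    have "sqrt (m + inverse (real (Suc n))) \<le> sqrt (m + 1)"
        by (intro real_sqrt_le_mono add_left_mono) (simp add: field_simps)
    with vGle[of n] show ?thesis by (rule order_trans)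
  qed
  obtain r w where r: "strict_mono (r::nat\<Rightarrow>nat)" and w: "w \<in> H10 \<Omega>"
    and wk: "\<And>y. (\<lambda>n. grad_class \<Omega> (v (r n)) \<bullet> y) \<longlonglongrightarrow> grad_class \<Omega> w \<bullet> y"
    and st: "(\<lambda>n. l2_class \<Omega> (v (r n))) \<longlonglongrightarrow> l2_class \<Omega> w"
    and "AE x in lebesgue_on \<Omega>. (\<lambda>n. v (r n) x) \<longlonglongrightarrow> w x"
    by (rule H10_compactness[of v, OF v vB]) blast
  have wU: "norm (l2_class \<Omega> w) = 1" using tendsto_norm[OF st] by (simp add: vU LIMSEQ_const_iff)
  have wG: "(norm (grad_class \<Omega> w))\<^sup>2 = m"
  proof -
    have "(\<lambda>n. sqrt (m + inverse (real (Suc n))) * norm (grad_class \<Omega> w))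
        \<longlonglongrightarrow> sqrt (m + 0) * norm (grad_class \<Omega> w)"
      by (intro tendsto_intros LIMSEQ_inverse_real_of_nat)
    from LIMSEQ_subseq_LIMSEQ[OF this r]
    have l: "(\<lambda>n. sqrt (m + inverse (real (Suc (r n)))) * norm (grad_class \<Omega> w))
        \<longlonglongrightarrow> sqrt m * norm (grad_class \<Omega> w)"
      by (simp add: o_def)
    \<comment> \<open>Weak lower semicontinuity of the norm, obtained by pairing the minimising
      sequence with its own limit.\<close>
    have "grad_class \<Omega> w \<bullet> grad_class \<Omega> w \<le> sqrt m * norm (grad_class \<Omega> w)"
    proof (rule LIMSEQ_le[OF wk l], intro exI allI impI)
      fix n
      have "grad_class \<Omega> (v (r n)) \<bullet> grad_class \<Omega> w \<le> norm (grad_class \<Omega> (v (r n))) * norm (grad_class \<Omega> w)"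
        by (rule norm_cauchy_schwarz)
      also have "\<dots> \<le> sqrt (m + inverse (real (Suc (r n)))) * norm (grad_class \<Omega> w)"
        by (intro mult_right_mono vGle) simp
      finally show "grad_class \<Omega> (v (r n)) \<bullet> grad_class \<Omega> w
          \<le> sqrt (m + inverse (real (Suc (r n)))) * norm (grad_class \<Omega> w)" .
    qed
    then have "norm (grad_class \<Omega> w) * norm (grad_class \<Omega> w) \<le> sqrt m * norm (grad_class \<Omega> w)"
      by (simp add: power2_norm_eq_inner[symmetric] power2_eq_square)
    then have "norm (grad_class \<Omega> w) \<le> sqrt m" using m0 by (cases "grad_class \<Omega> w = 0") auto
    then have "(norm (grad_class \<Omega> w))\<^sup>2 \<le> (sqrt m)\<^sup>2" by (rule power_mono) simp
    with m0 ray[OF w] wU show ?thesis by simp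
  qed
  have ev: "dirichlet_eigenvalue \<Omega> m"
    unfolding dirichlet_eigenvalue_def
  proof (intro bexI ballI)
    show "w \<in> H10_nonzero \<Omega>" using w wU by (auto simp: H10_nonzero_iff)
    fix y assume y: "y \<in> H10 \<Omega>"
    let ?B = "grad_class \<Omega> w \<bullet> grad_class \<Omega> y - m * (l2_class \<Omega> w \<bullet> l2_class \<Omega> y)"
    let ?D = "(norm (grad_class \<Omega> y))\<^sup>2 - m * (norm (l2_class \<Omega> y))\<^sup>2"
    \<comment> \<open>The Euler-Lagrange equation: the Rayleigh inequality for
      \<open>w + t y\<close> is a quadratic polynomial in \<open>t\<close> without constant term
      that is nowhere negative.\<close>
    have "?B = 0"
    proof (rule linear_coefficient_zero)
      fix t :: real
      have "m * (norm (1 *\<^sub>R l2_class \<Omega> w + t *\<^sub>R l2_class \<Omega> y))\<^sup>2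
          \<le> (norm (1 *\<^sub>R grad_class \<Omega> w + t *\<^sub>R grad_class \<Omega> y))\<^sup>2"
        unfolding H10_fst_snd_lincomb[OF w y, symmetric] by (intro ray H10_lincomb w y)
      moreover have "(norm (1 *\<^sub>R l2_class \<Omega> w + t *\<^sub>R l2_class \<Omega> y))\<^sup>2
          = 1 + 2 * t * (l2_class \<Omega> w \<bullet> l2_class \<Omega> y) + t\<^sup>2 * (norm (l2_class \<Omega> y))\<^sup>2"
        using wU unfolding power2_norm_eq_inner norm_eq_1
        by (simp add: inner_add_left inner_add_right inner_commute power2_eq_square algebra_simps)
      moreover have "(norm (1 *\<^sub>R grad_class \<Omega> w + t *\<^sub>R grad_class \<Omega> y))\<^sup>2
          = m + 2 * t * (grad_class \<Omega> w \<bullet> grad_class \<Omega> y) + t\<^sup>2 * (norm (grad_class \<Omega> y))\<^sup>2"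
        using wG unfolding power2_norm_eq_inner
        by (simp add: inner_add_left inner_add_right inner_commute power2_eq_square algebra_simps)
      ultimately show "0 \<le> 2 * t * ?B + t\<^sup>2 * ?D" by (simp add: algebra_simps)
    qed
    then have "grad_class \<Omega> w \<bullet> grad_class \<Omega> y = m * (l2_class \<Omega> w \<bullet> l2_class \<Omega> y)" by simp
    then show "(LINT x|lebesgue_on \<Omega>. weak_grad \<Omega> w x \<bullet> weak_grad \<Omega> y x) =
        m * (LINT x|lebesgue_on \<Omega>. w x * y x)"
      unfolding grad_class_def by (simp add: inner_l2_class H1_D H10_imp_H1 w y)
  qed
  have "first_dirichlet_eigenvalue \<Omega> = m"
    unfolding first_dirichlet_eigenvalue_def
  proof (rule Least_equality)
    show "dirichlet_eigenvalue \<Omega> m" by (rule ev)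
    fix \<mu> assume "dirichlet_eigenvalue \<Omega> \<mu>"
    then obtain y where y: "y \<in> H10_nonzero \<Omega>"
      "(LINT x|lebesgue_on \<Omega>. weak_grad \<Omega> y x \<bullet> weak_grad \<Omega> y x) = \<mu> * (LINT x|lebesgue_on \<Omega>. y x * y x)"
      unfolding dirichlet_eigenvalue_def H10_nonzero_def by blast
    have yH: "y \<in> H10 \<Omega>" "l2_class \<Omega> y \<noteq> 0" using y(1) by (auto simp: H10_nonzero_iff)
    have "(norm (grad_class \<Omega> y))\<^sup>2 = \<mu> * (norm (l2_class \<Omega> y))\<^sup>2"
      using y(2) unfolding power2_norm_eq_inner grad_class_def
          by (simp add: inner_l2_class H1_D H10_imp_H1 yH)
    with ray[OF yH(1)] yH(2) show "m \<le> \<mu>" by simp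
  qed
  with ray[OF assms] show ?thesis by simp
qed

text \<open>Sobolev's inequality bounds all quotients below by a positive number, so
  \<open>S\<close> is positive. The inequality is the definition of \<open>S\<close> raised to the
  power \<open>p/2\<close>; functions that vanish almost everywhere lie outside the infimum and are
  treated directly.\<close>

theorem sobolev_const_inequality:
  assumes N3: "3 \<le> DIM('a)"
  shows "0 < sobolev_const \<Omega>"
    and "\<And>u. u \<in> H10 \<Omega> \<Longrightarrow> (LINT x|lebesgue_on \<Omega>. \<bar>u x\<bar> powr two_star DIM('a))
      \<le> sobolev_const \<Omega> powr (- (two_star DIM('a) / 2)) * norm (grad_class \<Omega> u) powr two_star DIM('a)"
proof -
  define p where "p = two_star DIM('a)"
  have p: "p > 0" using N3 by (simp add: p_def two_star_def)
  obtain C where C: "C > 0" "\<And>u. u \<in> H10 \<Omega> \<Longrightarrow> integrable (lebesgue_on \<Omega>) (\<lambda>x. \<bar>u x\<bar> powr p)"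
    "\<And>u. u \<in> H10 \<Omega> \<Longrightarrow> (LINT x|lebesgue_on \<Omega>. \<bar>u x\<bar> powr p) \<le> C * norm (grad_class \<Omega> u) powr p"
    using H10_sobolev[OF N3] unfolding p_def by metis
  define I where "I u = (LINT x|lebesgue_on \<Omega>. \<bar>u x\<bar> powr p)" for u :: "'a \<Rightarrow> real"
  define q where "q u = dirichlet_integral \<Omega> u / I u powr (2 / p)" for u
  have S: "sobolev_const \<Omega> = (INF u\<in>H10_nonzero \<Omega>. q u)"
    by (simp add: sobolev_const_def q_def I_def p_def)
  have I0: "0 \<le> I u" for u unfolding I_def by (intro Bochner_Integration.integral_nonneg) simp
  have Ipos: "0 < I u" if u: "u \<in> H10_nonzero \<Omega>" for u
  proof -
    have uH: "u \<in> H10 \<Omega>" "\<not> (AE x in lebesgue_on \<Omega>. u x = 0)" using u by (auto simp: H10_nonzero_def)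
    have "I u \<noteq> 0"
      using integral_nonneg_eq_0_iff_AE[OF C(2)[OF uH(1)]] uH(2) p by (auto simp: I_def)
    with I0[of u] show ?thesis by simp
  qed
  have dq: "q u = (norm (grad_class \<Omega> u))\<^sup>2 / I u powr (2 / p)" if "u \<in> H10 \<Omega>" for u
    using that by (simp add: q_def dirichlet_integral_eq H10_imp_H1)
  have bdd: "bdd_below (q ` H10_nonzero \<Omega>)"
    by (rule bdd_belowI[of _ 0]) (auto simp: dq H10_nonzero_def)
  have lower: "C powr (- (2 / p)) \<le> q u" if u: "u \<in> H10_nonzero \<Omega>" for u
  proof -
    have uH: "u \<in> H10 \<Omega>" using u by (auto simp: H10_nonzero_def)
    have "I u powr (2 / p) \<le> (C * norm (grad_class \<Omega> u) powr p) powr (2 / p)"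
      using C(3)[OF uH] I0 p by (intro powr_mono2) (auto simp: I_def)
    also have "\<dots> = C powr (2 / p) * (norm (grad_class \<Omega> u))\<^sup>2"
      using p by (cases "grad_class \<Omega> u = 0") (auto simp: powr_mult powr_powr powr_numeral)
    finally have "I u powr (2 / p) \<le> C powr (2 / p) * (norm (grad_class \<Omega> u))\<^sup>2" .
    then show ?thesis
      using Ipos[OF u] C(1) unfolding dq[OF uH] by (simp add: powr_minus field_simps)
  qed
  have "C powr (- (2 / p)) \<le> sobolev_const \<Omega>"
    unfolding S using lower by (intro cINF_greatest[OF H10_nonzero_nonempty])
  moreover have "0 < C powr (- (2 / p))" using C(1) by simp
  ultimately show Spos: "0 < sobolev_const \<Omega>" by linarith
  fix u assume u: "u \<in> H10 \<Omega>"
  have "I u \<le> sobolev_const \<Omega> powr (- (p / 2)) * norm (grad_class \<Omega> u) powr p"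
  proof (cases "u \<in> H10_nonzero \<Omega>")
    case True
    have "sobolev_const \<Omega> \<le> q u" unfolding S by (rule cINF_lower[OF bdd True])
    then have "sobolev_const \<Omega> * I u powr (2 / p) \<le> (norm (grad_class \<Omega> u))\<^sup>2"
      using Ipos[OF True] unfolding dq[OF u] by (simp add: field_simps)
    then have "(sobolev_const \<Omega> * I u powr (2 / p)) powr (p / 2) \<le> ((norm (grad_class \<Omega> u))\<^sup>2) powr (p / 2)"
      using p Spos by (intro powr_mono2) auto
    moreover have "((norm (grad_class \<Omega> u))\<^sup>2) powr (p / 2) = norm (grad_class \<Omega> u) powr p"
      by (cases "grad_class \<Omega> u = 0") (auto simp: powr_powr simp flip: powr_numeral)
    moreover have "(sobolev_const \<Omega> * I u powr (2 / p)) powr (p / 2) = sobolev_const \<Omega> powr (p / 2) * I u"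
      using p Ipos[OF True] by (simp add: powr_mult powr_powr)
    ultimately show ?thesis using Spos by (simp add: powr_minus field_simps)
  next
    case False
    then have "AE x in lebesgue_on \<Omega>. u x = 0" using u by (auto simp: H10_nonzero_def)
    then have "I u = 0" unfolding I_def using C(2)[OF u]
      by (subst integral_nonneg_eq_0_iff_AE) auto
    then show ?thesis by simp
  qed
  then show "(LINT x|lebesgue_on \<Omega>. \<bar>u x\<bar> powr two_star DIM('a))
      \<le> sobolev_const \<Omega> powr (- (two_star DIM('a) / 2)) * norm (grad_class \<Omega> u) powr two_star DIM('a)"
    by (simp add: I_def p_def)
qed

end

text \<open>Division by \<open>t powr \<beta>\<close> turns the equation into
  \<open>h t = \<sigma>\<close> with a strictly decreasing \<open>h\<close> tending to 0, because
  both exponents \<open>- \<beta>\<close> and \<open>\<alpha> - \<beta>\<close> are negative.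
  Monotonicity yields uniqueness, and also that \<open>h s \<le> \<sigma>\<close> forces
  \<open>t0 \<le> s\<close>.\<close>

lemma critical_level_root:
  fixes a b \<sigma> \<alpha> \<beta> :: real
  assumes a: "0 < a" and b: "0 < b" and \<sigma>: "0 < \<sigma>" and \<alpha>: "0 < \<alpha>" and \<beta>: "\<alpha> < \<beta>"
  obtains t0 where "\<And>t. 0 < t \<and> a + b * t powr \<alpha> = \<sigma> * t powr \<beta> \<longleftrightarrow> t = t0" "0 < t0"
    "\<And>s. 0 < s \<Longrightarrow> a + b * s powr \<alpha> \<le> \<sigma> * s powr \<beta> \<Longrightarrow> t0 \<le> s"
proof -
  define h where "h t = a * t powr (- \<beta>) + b * t powr (\<alpha> - \<beta>)" for t
  have he: "a + b * t powr \<alpha> = h t * t powr \<beta>" if "0 < t" for t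
    using that by (simp add: h_def distrib_right mult.assoc flip: powr_add)
  have hd: "h t < h s" if "0 < s" "s < t" for s t
  proof -
    have "t powr (- \<beta>) < s powr (- \<beta>)" "t powr (\<alpha> - \<beta>) < s powr (\<alpha> - \<beta>)"
      using that \<alpha> \<beta> by (intro powr_less_mono2_neg; simp)+
    then show ?thesis unfolding h_def using a b by (intro add_strict_mono mult_strict_left_mono)
  qed
  \<comment> \<open>Chosen so that the first summand of \<open>h\<close> alone equals \<sigma>
    there; the second then makes \<open>h t1 \<ge> \<sigma>\<close>, as the intermediate value
    theorem requires.\<close>
  define t1 where "t1 = (\<sigma> / a) powr (- (1 / \<beta>))"
  have t1: "t1 > 0" using a \<sigma> by (simp add: t1_def)
  have "a * t1 powr (- \<beta>) = \<sigma>" using a \<sigma> \<alpha> \<beta> by (simp add: t1_def powr_powr)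
  then have h1: "\<sigma> \<le> h t1" using b by (simp add: h_def)
  have "(h \<longlongrightarrow> a * 0 + b * 0) at_top"
    unfolding h_def[abs_def] using \<alpha> \<beta> by (intro tendsto_intros tendsto_neg_powr filterlim_ident) auto
  then have "\<forall>\<^sub>F t in at_top. h t < \<sigma>" using \<sigma> by (intro order_tendstoD(2)) auto
  then have "\<forall>\<^sub>F t in at_top. h t < \<sigma> \<and> t1 < t" using eventually_gt_at_top by (rule eventually_conj)
  then obtain t2 where t2: "h t2 < \<sigma>" "t1 < t2" by (auto simp: eventually_at_top_linorder)
  have "continuous_on {t1..t2} h"
    unfolding h_def[abs_def] using t1 by (intro continuous_intros) auto
  then obtain t0 where t0: "t1 \<le> t0" "h t0 = \<sigma>"
    using IVT2'[of h t2 \<sigma> t1] h1 t2 by auto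
  have t0p: "0 < t0" using t0 t1 by simp
  have eq: "0 < t \<and> a + b * t powr \<alpha> = \<sigma> * t powr \<beta> \<longleftrightarrow> t = t0" for t
  proof
    assume t: "0 < t \<and> a + b * t powr \<alpha> = \<sigma> * t powr \<beta>"
    then have "h t = \<sigma>" using he[of t] by simp
    then show "t = t0" using hd[of t t0] hd[of t0 t] t t0 t0p by (cases t t0 rule: linorder_cases) auto
  next
    assume "t = t0"
    then show "0 < t \<and> a + b * t powr \<alpha> = \<sigma> * t powr \<beta>" using he[of t0] t0 t0p by simp
  qed
  have "t0 \<le> s" if s: "0 < s" "a + b * s powr \<alpha> \<le> \<sigma> * s powr \<beta>" for s
  proof (rule ccontr)
    assume "\<not> t0 \<le> s"
    then have "\<sigma> < h s" using hd[of s t0] s t0 by simp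
    then have "\<sigma> * s powr \<beta> < h s * s powr \<beta>" using s by simp
    with s he[of s] show False by simp
  qed
  with eq t0p that show thesis by blast
qed


section \<open>Elementary inequalities for powers\<close>

text \<open>The odd power, often written \<open>|s|^(q - 1) s\<close>; with \<open>q = p - 1\<close>
  it is the critical nonlinearity, the derivative of \<open>|s|^p / p\<close>.\<close>

definition spow :: "real \<Rightarrow> real \<Rightarrow> real" where
  "spow s q = sgn s * \<bar>s\<bar> powr q"

lemma abs_spow: "\<bar>spow s q\<bar> = \<bar>s\<bar> powr q"
  by (simp add: spow_def abs_mult sgn_if)

lemma spow_mult_self: "spow s q * s = \<bar>s\<bar> powr (q + 1)"
proof (cases "s = 0")
  case False
  have "spow s q * s = \<bar>s\<bar> powr q * \<bar>s\<bar> powr 1" by (simp add: spow_def sgn_if)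
  then show ?thesis by (simp only: powr_add)
qed (simp add: spow_def)

lemma DERIV_abs_powr:
  fixes s q :: real
  assumes q: "1 < q"
  shows "((\<lambda>s. \<bar>s\<bar> powr q) has_real_derivative q * spow s (q - 1)) (at s)"
    and "((\<lambda>s. spow s q) has_real_derivative q * \<bar>s\<bar> powr (q - 1)) (at s)"
proof -
  have pos: "((\<lambda>s. s powr q) has_real_derivative q * s powr (q - 1)) (at s)" if "s > 0" for s
    using that by (rule has_real_derivative_powr)
  have neg: "((\<lambda>s. (- s) powr q) has_real_derivative - (q * (- s) powr (q - 1))) (at s)" if "s < 0" for s
    using that DERIV_chain2[OF pos[of "- s"] DERIV_minus[OF DERIV_ident], of UNIV] by simp
  \<comment> \<open>Serves the derivatives of both functions at zero, since they agree in absolute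
    value.\<close>
  have zero: "((\<lambda>h. \<bar>h\<bar> powr q / \<bar>h\<bar>) \<longlongrightarrow> 0) (at (0::real))"
  proof -
    have "((\<lambda>h::real. \<bar>h\<bar> powr (q - 1)) \<longlongrightarrow> \<bar>0\<bar> powr (q - 1)) (at 0)"
      using q by (intro tendsto_powr' tendsto_rabs tendsto_ident_at tendsto_const) auto
    moreover have "\<forall>\<^sub>F h in at (0::real). \<bar>h\<bar> powr q / \<bar>h\<bar> = \<bar>h\<bar> powr (q - 1)"
      by (auto simp: eventually_at_filter powr_diff)
    ultimately show ?thesis by (simp add: tendsto_cong)
  qed
  consider "s > 0" | "s < 0" | "s = 0" by linarith
  note cases = this
  from cases show "((\<lambda>s. \<bar>s\<bar> powr q) has_real_derivative q * spow s (q - 1)) (at s)"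
  proof cases
    case 1
    then have "((\<lambda>s. s powr q) has_real_derivative q * spow s (q - 1)) (at s)"
      using pos[OF 1] by (simp add: spow_def)
    then show ?thesis
      by (rule has_field_derivative_transform_within_open[of _ _ _ "{0<..}"]) (use 1 in auto)
  next
    case 2
    then have "((\<lambda>s. (- s) powr q) has_real_derivative q * spow s (q - 1)) (at s)"
      using neg[OF 2] by (simp add: spow_def)
    then show ?thesis
      by (rule has_field_derivative_transform_within_open[of _ _ _ "{..<0}"]) (use 2 in auto)
  next
    case 3
    have "((\<lambda>h. \<bar>h\<bar> powr q / h) \<longlongrightarrow> 0) (at (0::real))"
      by (rule Lim_null_comparison[OF _ zero]) (simp add: always_eventually)
    then show ?thesis using 3 by (simp add: DERIV_def spow_def)
  qed
  from cases show "((\<lambda>s. spow s q) has_real_derivative q * \<bar>s\<bar> powr (q - 1)) (at s)"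
  proof cases
    case 1
    then have "((\<lambda>s. s powr q) has_real_derivative q * \<bar>s\<bar> powr (q - 1)) (at s)"
      using pos[OF 1] by simp
    then show ?thesis
      by (rule has_field_derivative_transform_within_open[of _ _ _ "{0<..}"]) (use 1 in \<open>auto simp: spow_def\<close>)
  next
    case 2
    then have "((\<lambda>s. - ((- s) powr q)) has_real_derivative q * \<bar>s\<bar> powr (q - 1)) (at s)"
      using DERIV_minus[OF neg[OF 2]] by simp
    then show ?thesis
      by (rule has_field_derivative_transform_within_open[of _ _ _ "{..<0}"]) (use 2 in \<open>auto simp: spow_def\<close>)
  next
    case 3
    have "((\<lambda>h. spow h q / h) \<longlongrightarrow> 0) (at (0::real))"
      by (rule Lim_null_comparison[OF _ zero]) (simp add: always_eventually abs_spow)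
    then show ?thesis using 3 q by (simp add: DERIV_def spow_def)
  qed
qed

lemma continuous_on_spow: "1 < q \<Longrightarrow> continuous_on UNIV (\<lambda>s. spow s q)"
  by (intro continuous_at_imp_continuous_on ballI DERIV_isCont[OF DERIV_abs_powr(2)])

lemma spow_diff_bound:
  fixes a b q :: real
  assumes q: "1 < q"
  shows "\<bar>spow (a + b) q - spow a q\<bar> \<le> q * (\<bar>a\<bar> + \<bar>b\<bar>) powr (q - 1) * \<bar>b\<bar>"
proof -
  have "norm (spow (a + b) q - spow a q) \<le> q * (\<bar>a\<bar> + \<bar>b\<bar>) powr (q - 1) * norm ((a + b) - a)"
  proof (rule field_differentiable_bound[of "{- (\<bar>a\<bar> + \<bar>b\<bar>)..\<bar>a\<bar> + \<bar>b\<bar>}"])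
    show "((\<lambda>s. spow s q) has_field_derivative q * \<bar>z\<bar> powr (q - 1)) (at z within {- (\<bar>a\<bar> + \<bar>b\<bar>)..\<bar>a\<bar> + \<bar>b\<bar>})"
        for z
      by (rule DERIV_subset[OF DERIV_abs_powr(2)[OF q]]) simp
    show "norm (q * \<bar>z\<bar> powr (q - 1)) \<le> q * (\<bar>a\<bar> + \<bar>b\<bar>) powr (q - 1)"
        if "z \<in> {- (\<bar>a\<bar> + \<bar>b\<bar>)..\<bar>a\<bar> + \<bar>b\<bar>}" for z
      using that q by (auto simp: abs_mult intro!: mult_left_mono powr_mono2)
  qed auto
  then show ?thesis by simp
qed

text \<open>The mean value estimate for
  \<open>\<bar>a + s\<bar> powr p - p * spow a (p - 1) * s\<close> as a function of
  \<open>s\<close>: its derivative is a difference of odd powers, which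
  \<open>spow_diff_bound\<close> controls.\<close>

lemma abs_powr_second_order_bound:
  fixes a b p :: real
  assumes p: "2 < p"
  shows "\<bar>\<bar>a + b\<bar> powr p - \<bar>a\<bar> powr p - p * spow a (p - 1) * b\<bar>
      \<le> p * (p - 1) * (\<bar>a\<bar> + \<bar>b\<bar>) powr (p - 2) * b\<^sup>2"
proof -
  let ?S = "{- \<bar>b\<bar>..\<bar>b\<bar>}"
  have "norm ((\<bar>a + b\<bar> powr p - p * spow a (p - 1) * b) - (\<bar>a + 0\<bar> powr p - p * spow a (p - 1) * 0))
      \<le> p * ((p - 1) * (\<bar>a\<bar> + \<bar>b\<bar>) powr (p - 2) * \<bar>b\<bar>) * norm (b - 0)"
  proof (rule field_differentiable_bound[of ?S "\<lambda>s. \<bar>a + s\<bar> powr p - p * spow a (p - 1) * s"])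
    fix z assume z: "z \<in> ?S"
    have d: "((\<lambda>s. \<bar>a + s\<bar> powr p) has_real_derivative p * spow (a + z) (p - 1) * 1) (at z within ?S)"
      by (rule DERIV_chain2[OF DERIV_abs_powr(1)]) (use p in \<open>auto intro!: derivative_eq_intros\<close>)
    show "((\<lambda>s. \<bar>a + s\<bar> powr p - p * spow a (p - 1) * s) has_field_derivative
        p * (spow (a + z) (p - 1) - spow a (p - 1))) (at z within ?S)"
      using DERIV_diff[OF d DERIV_cmult_Id[of "p * spow a (p - 1)"]] by (simp add: right_diff_distrib)
    have "\<bar>spow (a + z) (p - 1) - spow a (p - 1)\<bar> \<le> (p - 1) * (\<bar>a\<bar> + \<bar>z\<bar>) powr (p - 1 - 1) * \<bar>z\<bar>"
      using p by (intro spow_diff_bound) auto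
    also have "\<dots> \<le> (p - 1) * (\<bar>a\<bar> + \<bar>b\<bar>) powr (p - 2) * \<bar>b\<bar>"
      using z p by (intro mult_mono mult_left_mono) (auto intro!: powr_mono2)
    finally show "norm (p * (spow (a + z) (p - 1) - spow a (p - 1)))
        \<le> p * ((p - 1) * (\<bar>a\<bar> + \<bar>b\<bar>) powr (p - 2) * \<bar>b\<bar>)"
      using p by (simp add: abs_mult mult_left_mono)
  qed auto
  moreover have "(\<bar>a + b\<bar> powr p - p * spow a (p - 1) * b) - (\<bar>a + 0\<bar> powr p - p * spow a (p - 1) * 0)
      = \<bar>a + b\<bar> powr p - \<bar>a\<bar> powr p - p * spow a (p - 1) * b" by simp
  moreover have "p * ((p - 1) * (\<bar>a\<bar> + \<bar>b\<bar>) powr (p - 2) * \<bar>b\<bar>) * norm (b - 0) =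
      p * (p - 1) * (\<bar>a\<bar> + \<bar>b\<bar>) powr (p - 2) * b\<^sup>2"
    by (simp add: power2_eq_square mult.assoc abs_mult_self_eq)
  ultimately show ?thesis by (simp only: real_norm_def)
qed

lemma powr_add_le:
  fixes x y p :: real
  assumes "0 \<le> x" "0 \<le> y" "0 < p"
  shows "(x + y) powr p \<le> 2 powr p * (x powr p + y powr p)"
proof -
  have "(x + y) powr p \<le> (2 * max x y) powr p" using assms by (intro powr_mono2) auto
  also have "\<dots> = 2 powr p * (max x y) powr p" by (rule powr_mult)
  also have "\<dots> \<le> 2 powr p * (x powr p + y powr p)" by (intro mult_left_mono) (auto simp: max_def)
  finally show ?thesis .
qed

text \<open>The inequality behind the compactness of the nonlinear term: the factor \<open>b\<close> is either small
  compared with \<open>\<bar>a\<bar> + \<bar>b\<bar>\<close> or controls it.\<close>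

lemma spow_splitting_bound:
  fixes p \<epsilon> :: real
  assumes p: "2 < p" and \<epsilon>: "0 < \<epsilon>"
  obtains K where "0 \<le> K"
    "\<And>a b. \<bar>spow (a + b) (p - 1) * a - \<bar>a\<bar> powr p\<bar> \<le> \<epsilon> * \<bar>a\<bar> powr p + K * \<bar>b\<bar> powr p"
proof -
  \<comment> \<open>Chosen so that \<open>(p - 1) * 2 powr p * \<eta> = \<epsilon>\<close>, the
    factor left over once \<open>(\<bar>a\<bar> + \<bar>b\<bar>) powr p\<close> has been split into
    the two powers.\<close>
  define \<eta> where "\<eta> = \<epsilon> / ((p - 1) * 2 powr p)"
  have \<eta>: "\<eta> > 0" using p \<epsilon> by (simp add: \<eta>_def)
  define K where "K = \<epsilon> + (p - 1) * (1 / \<eta>) powr (p - 1)"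
  have K: "0 \<le> K" using p \<epsilon> by (simp add: K_def)
  have "\<bar>spow (a + b) (p - 1) * a - \<bar>a\<bar> powr p\<bar> \<le> \<epsilon> * \<bar>a\<bar> powr p + K * \<bar>b\<bar> powr p" for a b
  proof -
    define Y where "Y = \<bar>a\<bar> + \<bar>b\<bar>"
    have Y: "0 \<le> Y" "\<bar>a\<bar> \<le> Y" "\<bar>b\<bar> \<le> Y" by (auto simp: Y_def)
    have "\<bar>a\<bar> powr p = spow a (p - 1) * a" by (simp add: spow_mult_self)
    then have "\<bar>spow (a + b) (p - 1) * a - \<bar>a\<bar> powr p\<bar> = \<bar>spow (a + b) (p - 1) - spow a (p - 1)\<bar> * \<bar>a\<bar>"
      by (simp add: abs_mult[symmetric] left_diff_distrib)
    also have "\<dots> \<le> ((p - 1) * Y powr (p - 1 - 1) * \<bar>b\<bar>) * Y"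
      unfolding Y_def using p by (intro mult_mono spow_diff_bound) auto
    also have "\<dots> = (p - 1) * (Y powr (p - 1) * \<bar>b\<bar>)"
    proof (cases "Y = 0")
      case False
      have "Y powr (p - 1 - 1) * Y = Y powr (p - 1 - 1) * Y powr 1" using Y by simp
      also have "\<dots> = Y powr (p - 1)" unfolding powr_add[symmetric] by simp
      finally show ?thesis by (simp add: mult_ac)
    qed simp
    also have "Y powr (p - 1) * \<bar>b\<bar> \<le> \<eta> * Y powr p + (1 / \<eta>) powr (p - 1) * \<bar>b\<bar> powr p"
    proof (cases "\<bar>b\<bar> \<le> \<eta> * Y")
      case True
      then have "Y powr (p - 1) * \<bar>b\<bar> \<le> Y powr (p - 1) * (\<eta> * Y)" by (intro mult_left_mono) auto
      also have "\<dots> = \<eta> * (Y powr (p - 1) * Y powr 1)" using Y by simp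
      also have "\<dots> = \<eta> * Y powr p" unfolding powr_add[symmetric] by simp
      finally show ?thesis by (simp add: add_increasing2)
    next
      case False
      then have "Y \<le> (1 / \<eta>) * \<bar>b\<bar>" using \<eta> by (simp add: field_simps)
      then have "Y powr (p - 1) \<le> ((1 / \<eta>) * \<bar>b\<bar>) powr (p - 1)" using Y p by (intro powr_mono2) auto
      then have "Y powr (p - 1) * \<bar>b\<bar> \<le> ((1 / \<eta>) * \<bar>b\<bar>) powr (p - 1) * \<bar>b\<bar>" by (intro mult_right_mono) auto
      also have "\<dots> = (1 / \<eta>) powr (p - 1) * (\<bar>b\<bar> powr (p - 1) * \<bar>b\<bar> powr 1)"
        by (subst powr_mult) (simp add: mult.assoc)
      also have "\<dots> = (1 / \<eta>) powr (p - 1) * \<bar>b\<bar> powr p" unfolding powr_add[symmetric] by simp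
      finally show ?thesis using \<eta> by (simp add: add_increasing)
    qed
    also have "(p - 1) * (\<eta> * Y powr p + (1 / \<eta>) powr (p - 1) * \<bar>b\<bar> powr p)
        \<le> (p - 1) * (\<eta> * (2 powr p * (\<bar>a\<bar> powr p + \<bar>b\<bar> powr p)) + (1 / \<eta>) powr (p - 1) * \<bar>b\<bar> powr p)"
      unfolding Y_def using p \<eta> by (intro mult_left_mono add_right_mono powr_add_le) auto
    also have "\<dots> = ((p - 1) * 2 powr p * \<eta>) * \<bar>a\<bar> powr p + ((p - 1) * 2 powr p * \<eta> +
        (p - 1) * (1 / \<eta>) powr (p - 1)) * \<bar>b\<bar> powr p"
      by (simp add: algebra_simps)
    also have "(p - 1) * 2 powr p * \<eta> = \<epsilon>" using p by (simp add: \<eta>_def)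
    finally show ?thesis using p by (simp add: K_def)
  qed
  with K show thesis using that by blast
qed

section \<open>Two integral estimates for the critical term\<close>

text \<open>The dominated convergence argument of the Brezis--Lieb lemma.\<close>

lemma vanishing_integral:
  fixes F G :: "nat \<Rightarrow> 'x \<Rightarrow> real"
  assumes F: "\<And>n. integrable M (F n)" and G: "\<And>n. integrable M (G n)" and G0: "\<And>n x. 0 \<le> G n x"
    and GB: "\<And>n. (LINT x|M. G n x) \<le> B" and lim: "AE x in M. (\<lambda>n. F n x) \<longlonglongrightarrow> 0"
    and dom: "\<And>\<epsilon>. 0 < \<epsilon> \<Longrightarrow> \<exists>H. integrable M H \<and> (\<forall>n x. \<bar>F n x\<bar> \<le> \<epsilon> * G n x + H x)"
  shows "(\<lambda>n. LINT x|M. F n x) \<longlonglongrightarrow> 0"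
proof (rule LIMSEQ_I)
  fix e :: real assume e: "0 < e"
  have B0: "0 \<le> B" by (rule order_trans[OF Bochner_Integration.integral_nonneg GB[of 0]]) (rule G0)
  define \<epsilon> where "\<epsilon> = e / (2 * (B + 1))"
  have \<epsilon>: "0 < \<epsilon>" using e B0 by (simp add: \<epsilon>_def)
  have \<epsilon>B: "\<epsilon> * B \<le> e / 2" using e B0 by (simp add: \<epsilon>_def field_simps)
  obtain H where H: "integrable M H" "\<And>n x. \<bar>F n x\<bar> \<le> \<epsilon> * G n x + H x" using dom[OF \<epsilon>] by blast
  have [measurable]: "F n \<in> borel_measurable M" "G n \<in> borel_measurable M" for n using F G by auto
  \<comment> \<open>The part of \<open>\<bar>F n\<bar>\<close> that exceeds
    \<open>\<epsilon> * G n\<close> is dominated by \<open>\<bar>H\<bar>\<close> and still tends to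
    zero; the remainder has integral at most \<open>\<epsilon> * B\<close>.\<close>
  define W where "W n x = max 0 (\<bar>F n x\<bar> - \<epsilon> * G n x)" for n x
  have Wm[measurable]: "W n \<in> borel_measurable M" for n unfolding W_def[abs_def] by measurable
  have WH: "norm (W n x) \<le> \<bar>H x\<bar>" for n x using H(2)[of n x] by (auto simp: W_def max_def)
  have Wi: "integrable M (W n)" for n
    by (rule Bochner_Integration.integrable_bound[OF integrable_abs[OF H(1)]]) (use WH in auto)
  have "(\<lambda>n. LINT x|M. W n x) \<longlonglongrightarrow> (LINT x|M. 0)"
  proof (rule integral_dominated_convergence[OF _ _ integrable_abs[OF H(1)]])
    show "AE x in M. (\<lambda>n. W n x) \<longlonglongrightarrow> 0"
      using lim
    proof eventually_elim
      case (elim x)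
      have W: "norm (W n x) \<le> norm (F n x)" for n using mult_nonneg_nonneg[OF less_imp_le[OF \<epsilon>] G0[of n x]]
        by (auto simp: W_def max_def)
      show ?case by (rule Lim_null_comparison[OF always_eventually tendsto_norm_zero[OF elim]]) (use W in
          blast)
    qed
  qed (use WH in simp_all)
  then obtain N where N: "\<And>n. n \<ge> N \<Longrightarrow> norm ((LINT x|M. W n x) - (LINT x|M. 0)) < e / 2"
    using e LIMSEQ_D[of _ _ "e/2"] by (metis half_gt_zero)
  have "norm ((LINT x|M. F n x) - 0) < e" if "n \<ge> N" for n
  proof -
    have "\<bar>LINT x|M. F n x\<bar> \<le> (LINT x|M. \<bar>F n x\<bar>)" by (rule integral_abs_bound)
    also have "\<dots> \<le> (LINT x|M. W n x + \<epsilon> * G n x)"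
      using F[of n] G[of n] Wi[of n] by (intro Bochner_Integration.integral_mono) (auto simp: W_def)
    also have "\<dots> = (LINT x|M. W n x) + \<epsilon> * (LINT x|M. G n x)" using G[of n] Wi[of n] by simp
    also have "\<dots> \<le> (LINT x|M. W n x) + \<epsilon> * B" using GB \<epsilon> by (intro add_left_mono mult_left_mono) auto
    finally show ?thesis using N[OF that] \<epsilon>B by simp
  qed
  then show "\<exists>no. \<forall>n\<ge>no. norm ((LINT x|M. F n x) - 0) < e" by blast
qed

text \<open>A substitute for Hoelder's inequality: after normalisation it is the trivial bound of a
  geometric mean by a maximum.\<close>

lemma triple_product_integral_bound:
  fixes x y z :: "'x \<Rightarrow> real"
  assumes p: "2 < p" and nn: "\<And>t. 0 \<le> x t" "\<And>t. 0 \<le> y t" "\<And>t. 0 \<le> z t"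
    and m[measurable]: "x \<in> borel_measurable M" "y \<in> borel_measurable M" "z \<in> borel_measurable M"
    and i: "integrable M (\<lambda>t. x t powr p)" "integrable M (\<lambda>t. y t powr p)" "integrable M (\<lambda>t. z t powr p)"
    and A: "(LINT t|M. x t powr p) \<le> A powr p" "0 \<le> A"
    and B: "(LINT t|M. y t powr p) \<le> B powr p" "0 \<le> B"
    and C: "(LINT t|M. z t powr p) \<le> C powr p" "0 \<le> C"
  shows "integrable M (\<lambda>t. x t powr (p - 2) * y t * z t)"
    "(LINT t|M. x t powr (p - 2) * y t * z t) \<le> 3 * A powr (p - 2) * B * C"
proof -
  have pt: "a powr (p - 2) * b * c \<le> a powr p + b powr p + c powr p"
      if "0 \<le> a" "0 \<le> b" "0 \<le> c" for a b c :: real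
  proof -
    define m where "m = max a (max b c)"
    have m: "0 \<le> m" "a \<le> m" "b \<le> m" "c \<le> m" using that by (auto simp: m_def)
    have "a powr (p - 2) * b * c \<le> m powr (p - 2) * m * m"
      using m that p by (intro mult_mono powr_mono2) auto
    also have "\<dots> = m powr (p - 2) * m powr 2" using m by (simp add: power2_eq_square powr_numeral)
    also have "\<dots> = m powr p" unfolding powr_add[symmetric] by simp
    also have "\<dots> \<le> a powr p + b powr p + c powr p" unfolding m_def by (auto simp: max_def)
    finally show ?thesis .
  qed
  show int: "integrable M (\<lambda>t. x t powr (p - 2) * y t * z t)"
  proof (rule Bochner_Integration.integrable_bound)
    show "integrable M (\<lambda>t. x t powr p + y t powr p + z t powr p)" using i by simp
    show "AE t in M. norm (x t powr (p - 2) * y t * z t) \<le> norm (x t powr p + y t powr p + z t powr p)"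
      using nn pt by (intro AE_I2) simp
  qed measurable
  \<comment> \<open>The bounds may be zero, so division is by strictly larger numbers, which are
    then lowered to \<open>A\<close>, \<open>B\<close> and \<open>C\<close>.\<close>
  have pos: "(LINT t|M. x t powr (p - 2) * y t * z t) \<le> 3 * A' powr (p - 2) * B' * C'"
    if "A < A'" "B < B'" "C < C'" for A' B' C'
  proof -
    have p0: "0 < A'" "0 < B'" "0 < C'" using that A B C by linarith+
    have scale: "(LINT t|M. (w t / D') powr p) \<le> 1" "integrable M (\<lambda>t. (w t / D') powr p)"
      if "(LINT t|M. w t powr p) \<le> D powr p" "0 \<le> D" "D < D'" "integrable M (\<lambda>t. w t powr p)" "\<And>t. 0 \<le> w t"
          for w D D'
    proof -
      have D': "0 < D'" using that by linarith
      have e: "(w t / D') powr p = w t powr p / D' powr p" for t using that(5) D' by (simp add: powr_divide)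
      show "integrable M (\<lambda>t. (w t / D') powr p)" unfolding e using that(4) by simp
      have "(LINT t|M. w t powr p) \<le> D' powr p" using that p
          by (intro order_trans[OF that(1)] powr_mono2) auto
      then show "(LINT t|M. (w t / D') powr p) \<le> 1" unfolding e using D' by simp
    qed
    note sx = scale[OF A \<open>A < A'\<close> i(1) nn(1)] and sy = scale[OF B \<open>B < B'\<close> i(2) nn(2)]
      and sz = scale[OF C \<open>C < C'\<close> i(3) nn(3)]
    have "(LINT t|M. x t powr (p - 2) * y t * z t) \<le>
      (LINT t|M. A' powr (p - 2) * B' * C' * ((x t / A') powr p + (y t / B') powr p + (z t / C') powr p))"
    proof (rule Bochner_Integration.integral_mono[OF int])
      show "integrable M (\<lambda>t. A' powr (p - 2) * B' * C' * ((x t / A') powr p + (y t / B') powr p +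
          (z t / C') powr p))"
        using sx(2) sy(2) sz(2) by simp
      fix t
      have "x t powr (p - 2) * y t * z t = A' powr (p - 2) * B' * C' * ((x t / A') powr (p -
          2) * (y t / B') * (z t / C'))"
        using p0 nn by (simp add: powr_divide)
      also have "\<dots> \<le> A' powr (p - 2) * B' * C' * ((x t / A') powr p + (y t / B') powr p + (z t / C') powr p)"
        using p0 nn by (intro mult_left_mono pt) auto
      finally show "x t powr (p - 2) * y t * z t \<le> A' powr (p - 2) * B' * C' * ((x t / A') powr p +
          (y t / B') powr p + (z t / C') powr p)" .
    qed
    also have "\<dots> = A' powr (p - 2) * B' * C' * ((LINT t|M. (x t / A') powr p) +
        (LINT t|M. (y t / B') powr p) + (LINT t|M. (z t / C') powr p))"
      using sx(2) sy(2) sz(2) by simp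
    also have "\<dots> \<le> A' powr (p - 2) * B' * C' * (1 + 1 + 1)"
      using sx(1) sy(1) sz(1) p0 by (intro mult_left_mono add_mono) auto
    finally show ?thesis by simp
  qed
  have "(\<lambda>n. 3 * (A + inverse (real (Suc n))) powr (p - 2) * (B + inverse (real (Suc n))) * (C +
      inverse (real (Suc n))))
      \<longlonglongrightarrow> 3 * (A + 0) powr (p - 2) * (B + 0) * (C + 0)"
    using p A by (intro tendsto_mult tendsto_const tendsto_add LIMSEQ_inverse_real_of_nat tendsto_powr')
      (auto intro!: always_eventually)
  then have "(LINT t|M. x t powr (p - 2) * y t * z t) \<le> 3 * (A + 0) powr (p - 2) * (B + 0) * (C + 0)"
    by (rule LIMSEQ_le_const) (auto intro!: pos)
  then show "(LINT t|M. x t powr (p - 2) * y t * z t) \<le> 3 * A powr (p - 2) * B * C" by simp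
qed


section \<open>Differentiability of the functional\<close>

context bounded_domain
begin

section \<open>Linear structure and dual norm\<close>

lemma H10_add: "u \<in> H10 \<Omega> \<Longrightarrow> v \<in> H10 \<Omega> \<Longrightarrow> (\<lambda>x. u x + v x) \<in> H10 \<Omega>"
  and H10_diff: "u \<in> H10 \<Omega> \<Longrightarrow> v \<in> H10 \<Omega> \<Longrightarrow> (\<lambda>x. u x - v x) \<in> H10 \<Omega>"
  and H10_scale: "u \<in> H10 \<Omega> \<Longrightarrow> (\<lambda>x. c * u x) \<in> H10 \<Omega>"
  using H10_lincomb[of u v 1 1] H10_lincomb[of u v 1 "-1"] H10_lincomb[of u u c 0] by simp_all

lemma H10_class_add:
  assumes "u \<in> H10 \<Omega>" "v \<in> H10 \<Omega>"
  shows "l2_class \<Omega> (\<lambda>x. u x + v x) = l2_class \<Omega> u + l2_class \<Omega> v"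
    "grad_class \<Omega> (\<lambda>x. u x + v x) = grad_class \<Omega> u + grad_class \<Omega> v"
    "l2_class \<Omega> (\<lambda>x. u x - v x) = l2_class \<Omega> u - l2_class \<Omega> v"
    "grad_class \<Omega> (\<lambda>x. u x - v x) = grad_class \<Omega> u - grad_class \<Omega> v"
    "l2_class \<Omega> (\<lambda>x. c * u x) = c *\<^sub>R l2_class \<Omega> u"
    "grad_class \<Omega> (\<lambda>x. c * u x) = c *\<^sub>R grad_class \<Omega> u"
  using H10_fst_snd_lincomb[OF assms, of 1 1] H10_fst_snd_lincomb[OF assms, of 1 "-1"]
    H10_fst_snd_lincomb[OF assms, of c 0] by simp_all

lemma H10_norm_grad: "u \<in> H10 \<Omega> \<Longrightarrow> H10_norm \<Omega> u = norm (grad_class \<Omega> u)"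
  by (simp add: H10_norm_eq H10_imp_H1)

lemma zero_H10: "(\<lambda>x. 0) \<in> H10 \<Omega>"
  using H10_scale[of _ 0] H10_nonzero_nonempty by (auto simp: H10_nonzero_iff)

lemma H10_dualD:
  assumes "L \<in> H10_dual \<Omega>"
  shows "v \<in> H10 \<Omega> \<Longrightarrow> L (\<lambda>x. r * v x) = r * L v"
    "\<exists>C. \<forall>v\<in>H10 \<Omega>. \<bar>L v\<bar> \<le> C * norm (grad_class \<Omega> v)"
  using assms by (auto simp: H10_dual_def H10_norm_grad)

text \<open>A real supremum bounds its members only if they are bounded above, which the continuity
  constant in \<open>H10_dual\<close> ensures. A function with zero gradient cannot be normalised;
  there the same constant gives the value 0.\<close>

lemma H10_dual_norm_bound:
  assumes L: "L \<in> H10_dual \<Omega>" and v: "v \<in> H10 \<Omega>"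
  shows "\<bar>L v\<bar> \<le> H10_dual_norm \<Omega> L * norm (grad_class \<Omega> v)"
proof -
  obtain C where C: "\<And>v. v \<in> H10 \<Omega> \<Longrightarrow> \<bar>L v\<bar> \<le> C * norm (grad_class \<Omega> v)" using H10_dualD(2)[OF L] by blast
  have bdd: "bdd_above ((\<lambda>v. \<bar>L v\<bar>) ` {v \<in> H10 \<Omega>. H10_norm \<Omega> v \<le> 1})"
  proof (rule bdd_aboveI2)
    fix w assume w: "w \<in> {v \<in> H10 \<Omega>. H10_norm \<Omega> v \<le> 1}"
    then have "\<bar>L w\<bar> \<le> C * norm (grad_class \<Omega> w)" "norm (grad_class \<Omega> w) \<le> 1"
        using C by (auto simp: H10_norm_grad)
    moreover have "C * norm (grad_class \<Omega> w) \<le> \<bar>C\<bar> * 1"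
      using calculation(2) by (intro mult_mono) auto
    ultimately show "\<bar>L w\<bar> \<le> \<bar>C\<bar>" by simp
  qed
  show ?thesis
  proof (cases "grad_class \<Omega> v = 0")
    case True
    then show ?thesis using C[OF v] by simp
  next
    case False
    define c where "c = 1 / norm (grad_class \<Omega> v)"
    have c: "c > 0" using False by (simp add: c_def)
    have "H10_norm \<Omega> (\<lambda>x. c * v x) = norm (c *\<^sub>R grad_class \<Omega> v)"
      using H10_norm_grad[OF H10_scale[OF v]] H10_class_add(6)[OF v v] by simp
    also have "\<dots> = 1" using False by (simp add: c_def)
    finally have "H10_norm \<Omega> (\<lambda>x. c * v x) = 1" .
    then have "\<bar>L (\<lambda>x. c * v x)\<bar> \<le> H10_dual_norm \<Omega> L"
      unfolding H10_dual_norm_def by (intro cSUP_upper[OF _ bdd]) (simp add: H10_scale v)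
    then have "c * \<bar>L v\<bar> \<le> H10_dual_norm \<Omega> L" using c by (simp add: H10_dualD(1)[OF L v] abs_mult)
    then show ?thesis using False by (simp add: c_def field_simps)
  qed
qed

text \<open>Evaluation at small multiples of \<open>v\<close>, with homogeneity of both candidates.
  As \<open>H10_deriv\<close> is a \<open>SOME\<close> choice, this is what identifies it on $H^1_0$
  with an explicit formula.\<close>

lemma has_H10_derivative_unique:
  assumes L: "has_H10_derivative \<Omega> J u L" and L': "has_H10_derivative \<Omega> J u L'" and v: "v \<in> H10 \<Omega>"
  shows "L v = L' v"
proof -
  have d: "L \<in> H10_dual \<Omega>" "L' \<in> H10_dual \<Omega>" using L L' by (auto simp: has_H10_derivative_def)
  have "\<bar>L v - L' v\<bar> \<le> \<epsilon>" if \<epsilon>: "\<epsilon> > 0" for \<epsilon>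
  proof -
    define k where "k = norm (grad_class \<Omega> v) + 1"
    have k: "k > 0" "norm (grad_class \<Omega> v) \<le> k" by (auto simp: k_def add_nonneg_pos)
    define e where "e = \<epsilon> / (2 * k)"
    have e: "e > 0" using \<epsilon> k by (simp add: e_def)
    obtain d1 where d1: "d1 > 0" "\<And>v. v \<in> H10 \<Omega> \<Longrightarrow> H10_norm \<Omega> v < d1 \<Longrightarrow>
        \<bar>J (\<lambda>x. u x + v x) - J u - L v\<bar> \<le> e * H10_norm \<Omega> v"
      using L e unfolding has_H10_derivative_def by blast
    obtain d2 where d2: "d2 > 0" "\<And>v. v \<in> H10 \<Omega> \<Longrightarrow> H10_norm \<Omega> v < d2 \<Longrightarrow>
        \<bar>J (\<lambda>x. u x + v x) - J u - L' v\<bar> \<le> e * H10_norm \<Omega> v"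
      using L' e unfolding has_H10_derivative_def by blast
    define t where "t = min d1 d2 / (2 * k)"
    have t: "t > 0" using d1 d2 k by (simp add: t_def)
    have tk: "t * k < d1" "t * k < d2" using d1(1) d2(1) k by (auto simp: t_def)
    define w where "w x = t * v x" for x
    have w: "w \<in> H10 \<Omega>" unfolding w_def by (rule H10_scale[OF v])
    have nw: "H10_norm \<Omega> w = t * norm (grad_class \<Omega> v)"
      using t unfolding H10_norm_grad[OF w] unfolding w_def H10_class_add(6)[OF v v] by simp
    have "t * norm (grad_class \<Omega> v) \<le> t * k" using t k by (intro mult_left_mono) auto
    with tk nw have "H10_norm \<Omega> w < d1" "H10_norm \<Omega> w < d2" by linarith+
    then have "\<bar>L w - L' w\<bar> \<le> 2 * (e * H10_norm \<Omega> w)"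
      using d1(2)[OF w] d2(2)[OF w] by linarith
    then have "t * \<bar>L v - L' v\<bar> \<le> t * (2 * e * norm (grad_class \<Omega> v))"
      using t unfolding nw w_def H10_dualD(1)[OF d(1) v] H10_dualD(1)[OF d(2) v]
      by (simp add: right_diff_distrib[symmetric] abs_mult mult_ac)
    then have "\<bar>L v - L' v\<bar> \<le> 2 * e * norm (grad_class \<Omega> v)" using t by simp
    also have "\<dots> \<le> 2 * e * k" using e k by (intro mult_left_mono) auto
    also have "\<dots> = \<epsilon>" using k by (simp add: e_def)
    finally show ?thesis .
  qed
  then have "\<bar>L v - L' v\<bar> \<le> 0" by (rule dense_ge)
  then show ?thesis by simp
qed

end

section \<open>The terms of the functional and its derivative\<close>

locale kirchhoff = bounded_domain \<Omega> for \<Omega> :: "'a::euclidean_space set" +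
  fixes a b \<gamma> lam p :: real
  assumes dim: "3 \<le> DIM('a)" and p_eq: "p = two_star DIM('a)" and \<gamma>: "1 < \<gamma>" "\<gamma> < p / 2"
    and ab: "0 < a" "0 < b" and lam: "0 < lam" "lam \<le> a * first_dirichlet_eigenvalue \<Omega>"
begin

abbreviation "U \<equiv> l2_class \<Omega> :: ('a \<Rightarrow> real) \<Rightarrow> ('a, real) l2"
abbreviation "G \<equiv> grad_class \<Omega>"
abbreviation "J \<equiv> kirchhoff_functional \<Omega> a b \<gamma> lam"

text \<open>The embedding constant for norms rather than squares: the critical norm of
  \<open>u\<close> is at most \<open>K\<close> times its gradient norm, as \<open>crit_le\<close>
  states for powers.\<close>

definition K where "K = sobolev_const \<Omega> powr (- (1/2))"
definition crit :: "('a \<Rightarrow> real) \<Rightarrow> real" where "crit u = (LINT x|lebesgue_on \<Omega>. \<bar>u x\<bar> powr p)"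
definition nonlin :: "('a \<Rightarrow> real) \<Rightarrow> ('a \<Rightarrow> real) \<Rightarrow> real" where
  "nonlin u v = (LINT x|lebesgue_on \<Omega>. spow (u x) (p - 1) * v x)"
text \<open>The nonlocal coefficient of the Kirchhoff equation, as a function on the Hilbert space
  of gradients so that differentiation and continuity there can be used.\<close>

definition kcoeff :: "('a, 'a) l2 \<Rightarrow> real" where "kcoeff g = a + b * (norm g)\<^sup>2 powr (\<gamma> - 1)"
definition J' :: "('a \<Rightarrow> real) \<Rightarrow> ('a \<Rightarrow> real) \<Rightarrow> real" where
  "J' u v = kcoeff (G u) * (G u \<bullet> G v) - lam * (U u \<bullet> U v) - nonlin u v"

lemma p_gt_2: "2 < p" using dim by (simp add: p_eq two_star_def field_simps)

lemma K_pos: "0 < K" using sobolev_const_inequality(1)[OF dim] by (simp add: K_def)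

lemma H10_measurable [measurable_dest]: "u \<in> H10 \<Omega> \<Longrightarrow> u \<in> borel_measurable (lebesgue_on \<Omega>)"
  using H1_D(1)[OF H10_imp_H1] by (simp add: L2_def)

lemma crit_integrable: "u \<in> H10 \<Omega> \<Longrightarrow> integrable (lebesgue_on \<Omega>) (\<lambda>x. \<bar>u x\<bar> powr p)"
  unfolding p_eq by (rule H10_sobolev[OF dim]) blast

lemma crit_le: "u \<in> H10 \<Omega> \<Longrightarrow> crit u \<le> (K * norm (G u)) powr p"
  using sobolev_const_inequality(2)[OF dim, of u, folded p_eq]
  by (simp add: crit_def K_def powr_mult powr_powr)

text \<open>The first-order and second-order estimates of the critical term both reduce to this
  integral. The constant 4 arises from \<open>(x + y)^p \<le> 2^p (x^p + y^p)\<close> and from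
  bounding the resulting 2 by another \<open>2^p\<close>.\<close>

lemma triple_bound:
  assumes u: "u \<in> H10 \<Omega>" and z: "z \<in> H10 \<Omega>" and v: "v \<in> H10 \<Omega>" and w: "w \<in> H10 \<Omega>"
    and R: "norm (G u) \<le> R" "norm (G z) \<le> R"
  shows "integrable (lebesgue_on \<Omega>) (\<lambda>x. (\<bar>u x\<bar> + \<bar>z x\<bar>) powr (p - 2) * \<bar>v x\<bar> * \<bar>w x\<bar>)"
    "(LINT x|lebesgue_on \<Omega>. (\<bar>u x\<bar> + \<bar>z x\<bar>) powr (p - 2) * \<bar>v x\<bar> * \<bar>w x\<bar>)
      \<le> 3 * (4 * K * R) powr (p - 2) * (K * norm (G v)) * (K * norm (G w))"
proof -
  let ?M = "lebesgue_on \<Omega>"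
  note p = p_gt_2 and [measurable] = H10_measurable[OF u] H10_measurable[OF z] H10_measurable[OF v]
      H10_measurable[OF w]
  have R0: "0 \<le> R" using R(1) norm_ge_zero order_trans by blast
  have pt: "(\<bar>u x\<bar> + \<bar>z x\<bar>) powr p \<le> 2 powr p * (\<bar>u x\<bar> powr p + \<bar>z x\<bar> powr p)" for x
    using p by (intro powr_add_le) auto
  have i2: "integrable ?M (\<lambda>x. 2 powr p * (\<bar>u x\<bar> powr p + \<bar>z x\<bar> powr p))"
    using crit_integrable[OF u] crit_integrable[OF z] by simp
  have i1: "integrable ?M (\<lambda>x. (\<bar>u x\<bar> + \<bar>z x\<bar>) powr p)"
    by (rule Bochner_Integration.integrable_bound[OF i2]) (use pt in auto)
  have le: "crit y \<le> (K * R) powr p" if "y \<in> H10 \<Omega>" "norm (G y) \<le> R" for y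
    using K_pos p that by (intro order_trans[OF crit_le[OF that(1)] powr_mono2]) auto
  have "(LINT x|?M. (\<bar>u x\<bar> + \<bar>z x\<bar>) powr p) \<le> (LINT x|?M. 2 powr p * (\<bar>u x\<bar> powr p + \<bar>z x\<bar> powr p))"
    by (rule Bochner_Integration.integral_mono[OF i1 i2 pt])
  also have "\<dots> = 2 powr p * (crit u + crit z)"
    using crit_integrable[OF u] crit_integrable[OF z] by (simp add: crit_def)
  also have "\<dots> \<le> 2 powr p * ((K * R) powr p + (K * R) powr p)"
    using le[OF u R(1)] le[OF z R(2)] by (intro mult_left_mono add_mono) auto
  also have "\<dots> = 2 powr p * (2 powr 1 * (K * R) powr p)" by simp
  also have "\<dots> \<le> 2 powr p * (2 powr p * (K * R) powr p)"
    using p by (intro mult_left_mono mult_right_mono powr_mono) auto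
  also have "\<dots> = (4 * K * R) powr p" unfolding powr_mult[symmetric] by (simp add: mult_ac)
  finally have A: "(LINT x|?M. (\<bar>u x\<bar> + \<bar>z x\<bar>) powr p) \<le> (4 * K * R) powr p" .
  note T = triple_product_integral_bound[OF p _ _ _ _ _ _ i1 crit_integrable[OF v] crit_integrable[OF w] A _
    crit_le[OF v, unfolded crit_def] _ crit_le[OF w, unfolded crit_def]]
  show "integrable (lebesgue_on \<Omega>) (\<lambda>x. (\<bar>u x\<bar> + \<bar>z x\<bar>) powr (p - 2) * \<bar>v x\<bar> * \<bar>w x\<bar>)"
    using K_pos R0 by (intro T(1)) auto
  show "(LINT x|lebesgue_on \<Omega>. (\<bar>u x\<bar> + \<bar>z x\<bar>) powr (p - 2) * \<bar>v x\<bar> * \<bar>w x\<bar>)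
      \<le> 3 * (4 * K * R) powr (p - 2) * (K * norm (G v)) * (K * norm (G w))"
    using K_pos R0 by (intro T(2)) auto
qed

lemma spow_measurable [measurable]: "(\<lambda>s. spow s (p - 1)) \<in> borel_measurable borel"
  using p_gt_2 by (intro borel_measurable_continuous_onI continuous_on_spow) auto

lemma nonlin_integrable:
  assumes u: "u \<in> H10 \<Omega>" and v: "v \<in> H10 \<Omega>"
  shows "integrable (lebesgue_on \<Omega>) (\<lambda>x. spow (u x) (p - 1) * v x)"
proof (rule Bochner_Integration.integrable_bound[OF triple_bound(1)[OF u u u v order_refl order_refl]])
  note [measurable] = H10_measurable[OF u] H10_measurable[OF v]
  show "(\<lambda>x. spow (u x) (p - 1) * v x) \<in> borel_measurable (lebesgue_on \<Omega>)" by measurable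
  have "norm (spow (u x) (p - 1) * v x) \<le> norm ((\<bar>u x\<bar> + \<bar>u x\<bar>) powr (p - 2) * \<bar>u x\<bar> * \<bar>v x\<bar>)" for x
  proof -
    have "\<bar>u x\<bar> powr (p - 1) = \<bar>u x\<bar> powr (p - 2) * \<bar>u x\<bar> powr 1" unfolding powr_add[symmetric] by simp
    also have "\<dots> \<le> (\<bar>u x\<bar> + \<bar>u x\<bar>) powr (p - 2) * \<bar>u x\<bar>"
      using p_gt_2 by (simp add: mult_right_mono powr_mono2)
    finally show ?thesis by (simp add: abs_mult abs_spow mult_right_mono)
  qed
  then show "AE x in lebesgue_on \<Omega>. norm (spow (u x) (p - 1) * v x)
      \<le> norm ((\<bar>u x\<bar> + \<bar>u x\<bar>) powr (p - 2) * \<bar>u x\<bar> * \<bar>v x\<bar>)"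
    by simp
qed

lemma nonlin_diff_bound:
  assumes u: "u \<in> H10 \<Omega>" and z: "z \<in> H10 \<Omega>" and v: "v \<in> H10 \<Omega>" and R: "norm (G u) \<le> R" "norm (G z) \<le> R"
  shows "\<bar>nonlin (\<lambda>x. u x + z x) v - nonlin u v\<bar>
      \<le> 3 * (p - 1) * (4 * K * R) powr (p - 2) * K\<^sup>2 * norm (G z) * norm (G v)"
proof -
  let ?M = "lebesgue_on \<Omega>"
  note T = triple_bound[OF u z z v R]
  have i: "integrable ?M (\<lambda>x. (spow (u x + z x) (p - 1) - spow (u x) (p - 1)) * v x)"
    using nonlin_integrable[OF H10_add[OF u z] v] nonlin_integrable[OF u v] by (simp add: left_diff_distrib)
  have "\<bar>nonlin (\<lambda>x. u x + z x) v - nonlin u v\<bar> =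
      \<bar>LINT x|?M. (spow (u x + z x) (p - 1) - spow (u x) (p - 1)) * v x\<bar>"
    using nonlin_integrable[OF H10_add[OF u z] v] nonlin_integrable[OF u v]
        by (simp add: nonlin_def left_diff_distrib)
  also have "\<dots> \<le> (LINT x|?M. \<bar>(spow (u x + z x) (p - 1) - spow (u x) (p - 1)) * v x\<bar>)"
    by (rule integral_abs_bound)
  also have "\<dots> \<le> (LINT x|?M. (p - 1) * ((\<bar>u x\<bar> + \<bar>z x\<bar>) powr (p - 2) * \<bar>z x\<bar> * \<bar>v x\<bar>))"
  proof (rule Bochner_Integration.integral_mono)
    show "integrable ?M (\<lambda>x. \<bar>(spow (u x + z x) (p - 1) - spow (u x) (p - 1)) * v x\<bar>)"
        using i by (rule integrable_abs)
    show "integrable ?M (\<lambda>x. (p - 1) * ((\<bar>u x\<bar> + \<bar>z x\<bar>) powr (p - 2) * \<bar>z x\<bar> * \<bar>v x\<bar>))" using T(1) by simp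
    fix x
    have "\<bar>spow (u x + z x) (p - 1) - spow (u x) (p - 1)\<bar>
        \<le> (p - 1) * (\<bar>u x\<bar> + \<bar>z x\<bar>) powr (p - 1 - 1) * \<bar>z x\<bar>"
      using p_gt_2 by (intro spow_diff_bound) simp
    from mult_right_mono[OF this, of "\<bar>v x\<bar>"]
    show "\<bar>(spow (u x + z x) (p - 1) - spow (u x) (p - 1)) * v x\<bar>
        \<le> (p - 1) * ((\<bar>u x\<bar> + \<bar>z x\<bar>) powr (p - 2) * \<bar>z x\<bar> * \<bar>v x\<bar>)"
      by (simp add: abs_mult mult.assoc)
  qed
  also have "\<dots> \<le> (p - 1) * (3 * (4 * K * R) powr (p - 2) * (K * norm (G z)) * (K * norm (G v)))"
    using T(2) p_gt_2 by (simp add: mult_left_mono)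
  finally show ?thesis by (simp only: power2_eq_square mult_ac)
qed

lemma crit_expansion:
  assumes u: "u \<in> H10 \<Omega>" and v: "v \<in> H10 \<Omega>" and R: "norm (G u) \<le> R" "norm (G v) \<le> R"
  shows "\<bar>crit (\<lambda>x. u x + v x) - crit u - p * nonlin u v\<bar>
      \<le> 3 * p * (p - 1) * (4 * K * R) powr (p - 2) * K\<^sup>2 * (norm (G v))\<^sup>2"
proof -
  let ?M = "lebesgue_on \<Omega>"
  let ?f = "\<lambda>x. \<bar>u x + v x\<bar> powr p - \<bar>u x\<bar> powr p - p * (spow (u x) (p - 1) * v x)"
  note T = triple_bound[OF u v v v R]
  note i = crit_integrable[OF H10_add[OF u v]] crit_integrable[OF u] nonlin_integrable[OF u v]
  have "\<bar>crit (\<lambda>x. u x + v x) - crit u - p * nonlin u v\<bar> = \<bar>LINT x|?M. ?f x\<bar>"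
    using i by (simp add: crit_def nonlin_def)
  also have "\<dots> \<le> (LINT x|?M. \<bar>?f x\<bar>)" by (rule integral_abs_bound)
  also have "\<dots> \<le> (LINT x|?M. p * (p - 1) * ((\<bar>u x\<bar> + \<bar>v x\<bar>) powr (p - 2) * \<bar>v x\<bar> * \<bar>v x\<bar>))"
  proof (rule Bochner_Integration.integral_mono)
    show "integrable ?M (\<lambda>x. \<bar>?f x\<bar>)" using i by (intro integrable_abs Bochner_Integration.integrable_diff)
        auto
    show "integrable ?M (\<lambda>x. p * (p - 1) * ((\<bar>u x\<bar> + \<bar>v x\<bar>) powr (p - 2) * \<bar>v x\<bar> * \<bar>v x\<bar>))" using T(1) by simp
    show "\<bar>?f x\<bar> \<le> p * (p - 1) * ((\<bar>u x\<bar> + \<bar>v x\<bar>) powr (p - 2) * \<bar>v x\<bar> * \<bar>v x\<bar>)" for x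
      using abs_powr_second_order_bound[OF p_gt_2, of "u x" "v x"]
      by (simp add: power2_eq_square mult.assoc abs_mult_self_eq)
  qed
  also have "\<dots> \<le> p * (p - 1) * (3 * (4 * K * R) powr (p - 2) * (K * norm (G v)) * (K * norm (G v)))"
    using T(2) p_gt_2 by (simp add: mult_left_mono)
  finally show ?thesis by (simp only: power2_eq_square mult_ac)
qed

lemma J_eq:
  "u \<in> H10 \<Omega> \<Longrightarrow> J u = a / 2 * (norm (G u))\<^sup>2 + b / (2 * \<gamma>) * (norm (G u))\<^sup>2 powr \<gamma>
     - lam / 2 * (norm (U u))\<^sup>2 - 1 / p * crit u"
  using norm_l2_class[OF H1_D(1)[OF H10_imp_H1], of u]
  by (simp add: kirchhoff_functional_def dirichlet_integral_eq H10_imp_H1 crit_def p_eq[symmetric])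

lemma J'_dual:
  assumes u: "u \<in> H10 \<Omega>"
  shows "J' u \<in> H10_dual \<Omega>"
proof -
  obtain P where P: "P > 0" "\<And>u. u \<in> H10 \<Omega> \<Longrightarrow> norm (U u) \<le> P * norm (G u)" using H10_poincare by blast
  define C where "C = \<bar>kcoeff (G u)\<bar> * norm (G u) + lam * norm (U u) * P +
      3 * (p - 1) * (4 * K * norm (G u)) powr (p - 2) * K\<^sup>2 * norm (G u)"
  have "\<bar>J' u v\<bar> \<le> C * norm (G v)" if v: "v \<in> H10 \<Omega>" for v
  proof -
    have "\<bar>kcoeff (G u) * (G u \<bullet> G v)\<bar> \<le> \<bar>kcoeff (G u)\<bar> * (norm (G u) * norm (G v))"
      unfolding abs_mult by (intro mult_left_mono Cauchy_Schwarz_ineq2) simp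
    moreover have "\<bar>lam * (U u \<bullet> U v)\<bar> \<le> lam * (norm (U u) * (P * norm (G v)))"
      unfolding abs_mult using lam(1)
      by (auto intro!: mult_left_mono order_trans[OF Cauchy_Schwarz_ineq2 mult_left_mono[OF P(2)[OF v]]])
    \<comment> \<open>The difference estimate with the zero function as base point, where
      \<open>nonlin\<close> vanishes.\<close>
    moreover have "\<bar>nonlin u v\<bar> \<le> 3 * (p - 1) * (4 * K * norm (G u)) powr (p -
        2) * K\<^sup>2 * norm (G u) * norm (G v)"
      using nonlin_diff_bound[OF zero_H10 u v, of "norm (G u)"] H10_class_add(6)[OF u u, of 0]
      by (simp add: nonlin_def spow_def)
    ultimately have "\<bar>J' u v\<bar> \<le> \<bar>kcoeff (G u)\<bar> * (norm (G u) * norm (G v)) +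
        lam * (norm (U u) * (P * norm (G v)))
        + 3 * (p - 1) * (4 * K * norm (G u)) powr (p - 2) * K\<^sup>2 * norm (G u) * norm (G v)"
      unfolding J'_def by linarith
    then show ?thesis by (simp add: C_def algebra_simps)
  qed
  then have "\<exists>C. \<forall>v\<in>H10 \<Omega>. \<bar>J' u v\<bar> \<le> C * H10_norm \<Omega> v" by (auto simp: H10_norm_grad)
  moreover have "J' u (\<lambda>x. v x + w x) = J' u v + J' u w" if v: "v \<in> H10 \<Omega>" and w: "w \<in> H10 \<Omega>" for v w
    using nonlin_integrable[OF u v] nonlin_integrable[OF u w]
    by (simp add: J'_def nonlin_def H10_class_add[OF v w] inner_add_right distrib_left)
  moreover have "J' u (\<lambda>x. r * v x) = r * J' u v" if v: "v \<in> H10 \<Omega>" for v r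
  proof -
    have "nonlin u (\<lambda>x. r * v x) = r * nonlin u v"
      unfolding nonlin_def by (subst integral_mult_right_zero[symmetric]) (simp add: mult_ac)
    then show ?thesis by (simp add: J'_def H10_class_add[OF v v] algebra_simps)
  qed
  ultimately show ?thesis unfolding H10_dual_def by blast
qed

text \<open>Written through \<open>g \<bullet> g\<close> and
  \<open>\<bar>s\<bar> powr \<gamma>\<close>, the expression is differentiable at
  \<open>g = 0\<close> as well, since \<open>\<gamma> > 1\<close>.\<close>

lemma quadratic_part_derivative:
  "((\<lambda>g. a / 2 * (norm g)\<^sup>2 + b / (2 * \<gamma>) * (norm g)\<^sup>2 powr \<gamma>) has_derivative (\<lambda>h. kcoeff g *
      (g \<bullet> h))) (at g)"
proof -
  have 1: "((\<lambda>g::('a,'a) l2. g \<bullet> g) has_derivative (\<lambda>h. 2 * (g \<bullet> h))) (at g)"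
    by (auto intro!: derivative_eq_intros simp: inner_commute)
  have "((\<lambda>s. \<bar>s\<bar> powr \<gamma>) has_derivative (*) (\<gamma> * spow (g \<bullet> g) (\<gamma> - 1))) (at (g \<bullet> g))"
    using DERIV_abs_powr(1)[OF \<gamma>(1)] unfolding has_field_derivative_def .
  from has_derivative_compose[OF 1 this]
  have "((\<lambda>g::('a,'a) l2. \<bar>g \<bullet> g\<bar> powr \<gamma>) has_derivative (\<lambda>h. \<gamma> * spow (g \<bullet> g) (\<gamma> -
      1) * (2 * (g \<bullet> h)))) (at g)" .
  then have "((\<lambda>g::('a,'a) l2. a / 2 * (g \<bullet> g) + b / (2 * \<gamma>) * \<bar>g \<bullet> g\<bar> powr \<gamma>) has_derivative
     (\<lambda>h. a / 2 * (2 * (g \<bullet> h)) + b / (2 * \<gamma>) * (\<gamma> * spow (g \<bullet> g) (\<gamma> - 1) * (2 * (g \<bullet> h))))) (at g)"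
    by (intro has_derivative_add has_derivative_mult_right 1)
  moreover have "spow (g \<bullet> g) (\<gamma> - 1) = (norm g)\<^sup>2 powr (\<gamma> - 1)"
    by (cases "g = 0") (auto simp: spow_def power2_norm_eq_inner)
  ultimately show ?thesis using \<gamma>
    by (simp add: power2_norm_eq_inner[symmetric] kcoeff_def algebra_simps)
qed

lemma J_has_derivative:
  assumes u: "u \<in> H10 \<Omega>"
  shows "has_H10_derivative \<Omega> J u (J' u)"
  unfolding has_H10_derivative_def
proof (intro conjI J'_dual[OF u] allI impI)
  fix \<epsilon> :: real assume \<epsilon>: "0 < \<epsilon>"
  obtain P where P: "P > 0" "\<And>u. u \<in> H10 \<Omega> \<Longrightarrow> norm (U u) \<le> P * norm (G u)" using H10_poincare by blast
  define Q where "Q g = a / 2 * (norm g)\<^sup>2 + b / (2 * \<gamma>) * (norm g)\<^sup>2 powr \<gamma>" for g :: "('a,'a) l2"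
  have "0 < \<epsilon> / 2" using \<epsilon> by simp
  then obtain d where d: "d > 0"
    "\<And>y. norm (y - G u) < d \<Longrightarrow> norm (Q y - Q (G u) - kcoeff (G u) * (G u \<bullet> (y - G u)))
        \<le> \<epsilon> / 2 * norm (y - G u)"
    using quadratic_part_derivative[of "G u"] unfolding has_derivative_at_alt Q_def by blast
  define R where "R = norm (G u) + 1"
  define C where "C = lam / 2 * P\<^sup>2 + 3 * (p - 1) * (4 * K * R) powr (p - 2) * K\<^sup>2"
  have C: "0 \<le> C" using lam(1) p_gt_2 by (simp add: C_def)
  define D where "D = C + 1"
  have D: "0 < D" "C \<le> D" using C by (auto simp: D_def)
  \<comment> \<open>The gradient part takes half of \<epsilon> within radius \<open>d\<close>; the
    other remainders are quadratic with constant \<open>C\<close>, and the last bound on \<delta>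
    gives them the other half. \<open>D\<close> exceeds \<open>C\<close> by 1 so that it can be a
    denominator, and the bound 1 keeps \<open>R\<close> valid.\<close>
  define \<delta> where "\<delta> = min d (min 1 (\<epsilon> / (2 * D)))"
  have \<delta>: "\<delta> > 0" using d \<epsilon> D by (simp add: \<delta>_def)
  show "\<exists>\<delta>>0. \<forall>v\<in>H10 \<Omega>. H10_norm \<Omega> v < \<delta> \<longrightarrow> \<bar>J (\<lambda>x. u x + v x) - J u - J' u v\<bar> \<le> \<epsilon> * H10_norm \<Omega> v"
  proof (intro exI conjI ballI impI)
    show "\<delta> > 0" by (rule \<delta>)
    fix v assume v: "v \<in> H10 \<Omega>" and "H10_norm \<Omega> v < \<delta>"
    then have n: "norm (G v) < d" "norm (G v) \<le> 1" "norm (G v) \<le> \<epsilon> / (2 * D)"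
      by (auto simp: H10_norm_grad \<delta>_def)
    note cl = H10_class_add[OF u v]
    have q: "\<bar>Q (G u + G v) - Q (G u) - kcoeff (G u) * (G u \<bullet> G v)\<bar> \<le> \<epsilon> / 2 * norm (G v)"
      using d(2)[of "G u + G v"] n(1) by simp
    have l: "\<bar>lam / 2 * (norm (U u + U v))\<^sup>2 - lam / 2 * (norm (U u))\<^sup>2 - lam * (U u \<bullet> U v)\<bar>
        \<le> lam / 2 * P\<^sup>2 * (norm (G v))\<^sup>2"
    proof -
      have e: "lam / 2 * (norm (U u + U v))\<^sup>2 - lam / 2 * (norm (U u))\<^sup>2 - lam * (U u \<bullet> U v) =
          lam / 2 * (norm (U v))\<^sup>2"
        by (simp add: power2_norm_eq_inner inner_add_left inner_add_right inner_commute algebra_simps)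
      have "(norm (U v))\<^sup>2 \<le> (P * norm (G v))\<^sup>2" using P(2)[OF v] by (intro power_mono) auto
      then have "lam / 2 * (norm (U v))\<^sup>2 \<le> lam / 2 * (P * norm (G v))\<^sup>2"
          using lam(1) by (intro mult_left_mono) auto
      then show ?thesis unfolding e using lam(1) by (simp add: power_mult_distrib)
    qed
    have c: "\<bar>1 / p * crit (\<lambda>x. u x + v x) - 1 / p * crit u - nonlin u v\<bar>
        \<le> 3 * (p - 1) * (4 * K * R) powr (p - 2) * K\<^sup>2 * (norm (G v))\<^sup>2"
    proof -
      have "\<bar>crit (\<lambda>x. u x + v x) - crit u - p * nonlin u v\<bar>
          \<le> 3 * p * (p - 1) * (4 * K * R) powr (p - 2) * K\<^sup>2 * (norm (G v))\<^sup>2"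
        by (rule crit_expansion[OF u v]) (use n(2) norm_ge_zero[of "G u"] in \<open>unfold R_def, linarith+\<close>)
      moreover have p0: "\<bar>p\<bar> = p" using p_gt_2 by simp
      moreover have "crit (\<lambda>x. u x + v x) - crit u - p * nonlin u v =
          p * (1 / p * crit (\<lambda>x. u x + v x) - 1 / p * crit u - nonlin u v)"
        using p_gt_2 by (simp add: right_diff_distrib)
      ultimately have "p * \<bar>1 / p * crit (\<lambda>x. u x + v x) - 1 / p * crit u - nonlin u v\<bar>
          \<le> p * (3 * (p - 1) * (4 * K * R) powr (p - 2) * K\<^sup>2 * (norm (G v))\<^sup>2)"
        using p0 by (simp only: abs_mult mult_ac)
      then show ?thesis using p_gt_2 by simp
    qed
    have "J (\<lambda>x. u x + v x) - J u - J' u v = (Q (G u + G v) - Q (G u) - kcoeff (G u) * (G u \<bullet> G v))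
       - (lam / 2 * (norm (U u + U v))\<^sup>2 - lam / 2 * (norm (U u))\<^sup>2 - lam * (U u \<bullet> U v))
       - (1 / p * crit (\<lambda>x. u x + v x) - 1 / p * crit u - nonlin u v)"
      by (simp add: J_eq u H10_add[OF u v] cl J'_def Q_def)
    then have "\<bar>J (\<lambda>x. u x + v x) - J u - J' u v\<bar> \<le> \<epsilon> / 2 * norm (G v) + (lam / 2 * P\<^sup>2 * (norm (G v))\<^sup>2
        + 3 * (p - 1) * (4 * K * R) powr (p - 2) * K\<^sup>2 * (norm (G v))\<^sup>2)"
      using q l c by linarith
    also have "\<dots> = \<epsilon> / 2 * norm (G v) + C * norm (G v) * norm (G v)"
      by (simp add: C_def power2_eq_square algebra_simps)
    also have "C * norm (G v) * norm (G v) \<le> \<epsilon> / 2 * norm (G v)"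
    proof (rule mult_right_mono)
      have "C * norm (G v) \<le> D * (\<epsilon> / (2 * D))" using C D n(3) by (intro mult_mono) auto
      also have "\<dots> = \<epsilon> / 2" using D by simp
      finally show "C * norm (G v) \<le> \<epsilon> / 2" .
    qed simp
    finally show "\<bar>J (\<lambda>x. u x + v x) - J u - J' u v\<bar> \<le> \<epsilon> * H10_norm \<Omega> v" by (simp add: H10_norm_grad v)
  qed
qed

lemma H10_deriv_J:
  assumes u: "u \<in> H10 \<Omega>"
  shows "has_H10_derivative \<Omega> J u (H10_deriv \<Omega> J u)" "\<And>v. v \<in> H10 \<Omega> \<Longrightarrow> H10_deriv \<Omega> J u v = J' u v"
proof -
  show 1: "has_H10_derivative \<Omega> J u (H10_deriv \<Omega> J u)"
    unfolding H10_deriv_def by (rule someI[of "has_H10_derivative \<Omega> J u"]) (rule J_has_derivative[OF u])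
  show "\<And>v. v \<in> H10 \<Omega> \<Longrightarrow> H10_deriv \<Omega> J u v = J' u v"
    using has_H10_derivative_unique[OF 1 J_has_derivative[OF u]] .
qed

lemma J_C1: "C1_functional \<Omega> J"
  unfolding C1_functional_def
proof (intro conjI ballI allI impI)
  show "\<exists>L. has_H10_derivative \<Omega> J u L" if "u \<in> H10 \<Omega>" for u using J_has_derivative[OF that] by blast
  fix u and \<epsilon> :: real assume u: "u \<in> H10 \<Omega>" and \<epsilon>: "0 < \<epsilon>"
  obtain P where P: "P > 0" "\<And>u. u \<in> H10 \<Omega> \<Longrightarrow> norm (U u) \<le> P * norm (G u)" using H10_poincare by blast
  \<comment> \<open>The Kirchhoff part of the derivative is represented by the continuous vector
    field \<open>kcoeff g *\<^sub>R g\<close>; the two remaining parts are Lipschitz near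
    \<open>u\<close> with the constant \<open>C\<close> below.\<close>
  have "((\<lambda>g::('a,'a) l2. kcoeff g *\<^sub>R g) \<longlongrightarrow> kcoeff (G u) *\<^sub>R G u) (at (G u))"
    unfolding kcoeff_def using \<gamma> by (intro tendsto_intros tendsto_powr') (auto intro!: tendsto_intros
        always_eventually)
  then have "\<forall>\<^sub>F g in at (G u). dist (kcoeff g *\<^sub>R g) (kcoeff (G u) *\<^sub>R G u) < \<epsilon> / 4"
    using \<epsilon> by (intro tendstoD) auto
  then obtain d where d: "d > 0" "\<And>g. g \<noteq> G u \<Longrightarrow> dist g (G u) < d \<Longrightarrow>
      dist (kcoeff g *\<^sub>R g) (kcoeff (G u) *\<^sub>R G u) < \<epsilon> / 4"
    unfolding eventually_at by blast
  have d': "norm (kcoeff g *\<^sub>R g - kcoeff (G u) *\<^sub>R G u) \<le> \<epsilon> / 4" if "norm (g - G u) < d" for g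
    using d(2)[of g] that \<epsilon> by (cases "g = G u") (auto simp: dist_norm)
  define R where "R = norm (G u) + 1"
  define C where "C = lam * P\<^sup>2 + 3 * (p - 1) * (4 * K * R) powr (p - 2) * K\<^sup>2"
  have C: "0 \<le> C" using lam(1) p_gt_2 by (simp add: C_def)
  define D where "D = C + 1"
  have D: "0 < D" "C \<le> D" using C by (auto simp: D_def)
  define \<delta> where "\<delta> = min d (min 1 (\<epsilon> / (4 * D)))"
  have \<delta>: "\<delta> > 0" using d \<epsilon> D by (simp add: \<delta>_def)
  show "\<exists>\<delta>>0. \<forall>w\<in>H10 \<Omega>. H10_norm \<Omega> (\<lambda>x. w x - u x) < \<delta> \<longrightarrow>
      H10_dual_norm \<Omega> (\<lambda>v. H10_deriv \<Omega> J w v - H10_deriv \<Omega> J u v) < \<epsilon>"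
  proof (intro exI conjI ballI impI)
    show "\<delta> > 0" by (rule \<delta>)
    fix w assume w: "w \<in> H10 \<Omega>" and "H10_norm \<Omega> (\<lambda>x. w x - u x) < \<delta>"
    define z where "z x = w x - u x" for x
    have z: "z \<in> H10 \<Omega>" unfolding z_def by (rule H10_diff[OF w u])
    have zG: "G z = G w - G u" "U z = U w - U u" unfolding z_def by (simp_all add: H10_class_add[OF w u])
    have wz: "w = (\<lambda>x. u x + z x)" by (auto simp: z_def)
    have n: "norm (G z) < d" "norm (G z) \<le> 1" "norm (G z) \<le> \<epsilon> / (4 * D)"
      using \<open>H10_norm \<Omega> (\<lambda>x. w x - u x) < \<delta>\<close> z unfolding z_def[symmetric] by (auto simp: H10_norm_grad \<delta>_def)
    have Cz: "C * norm (G z) \<le> \<epsilon> / 4"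
    proof -
      have "C * norm (G z) \<le> D * (\<epsilon> / (4 * D))" using C D n(3) by (intro mult_mono) auto
      also have "\<dots> = \<epsilon> / 4" using D by simp
      finally show ?thesis .
    qed
    have est: "\<bar>H10_deriv \<Omega> J w v - H10_deriv \<Omega> J u v\<bar> \<le> \<epsilon> / 2"
        if v: "v \<in> H10 \<Omega>" and v1: "H10_norm \<Omega> v \<le> 1" for v
    proof -
      have v1: "norm (G v) \<le> 1" using v v1 by (simp add: H10_norm_grad)
      have e: "J' w v - J' u v = (kcoeff (G w) *\<^sub>R G w - kcoeff (G u) *\<^sub>R G u) \<bullet> G v - lam * (U z \<bullet> U v) -
          (nonlin w v - nonlin u v)"
        by (simp add: J'_def zG inner_diff_left right_diff_distrib)
      have "\<bar>(kcoeff (G w) *\<^sub>R G w - kcoeff (G u) *\<^sub>R G u) \<bullet> G v\<bar> \<le> \<epsilon> / 4 * norm (G v)"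
        using n(1) by (intro order_trans[OF Cauchy_Schwarz_ineq2] mult_right_mono d') (auto simp: zG)
      moreover have "\<bar>lam * (U z \<bullet> U v)\<bar> \<le> lam * ((P * norm (G z)) * (P * norm (G v)))"
      proof -
        have "\<bar>U z \<bullet> U v\<bar> \<le> norm (U z) * norm (U v)" by (rule Cauchy_Schwarz_ineq2)
        also have "\<dots> \<le> (P * norm (G z)) * (P * norm (G v))"
          by (intro mult_mono P(2) z v) (use P(1) in auto)
        finally show ?thesis unfolding abs_mult using lam(1) by (simp add: mult_left_mono)
      qed
      moreover have "\<bar>nonlin w v - nonlin u v\<bar> \<le> 3 * (p - 1) * (4 * K * R) powr (p -
          2) * K\<^sup>2 * norm (G z) * norm (G v)"
        unfolding wz by (rule nonlin_diff_bound[OF u z v]) (use n(2) norm_ge_zero[of "G u"] in \<open>unfold R_def,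
            linarith+\<close>)
      ultimately have "\<bar>J' w v - J' u v\<bar> \<le> \<epsilon> / 4 * norm (G v) + lam * ((P * norm (G z)) * (P * norm (G v)))
          + 3 * (p - 1) * (4 * K * R) powr (p - 2) * K\<^sup>2 * norm (G z) * norm (G v)"
        unfolding e by linarith
      also have "\<dots> = (\<epsilon> / 4 + C * norm (G z)) * norm (G v)"
          by (simp add: C_def power2_eq_square algebra_simps)
      also have "\<dots> \<le> (\<epsilon> / 4 + \<epsilon> / 4) * 1" using Cz v1 \<epsilon> C by (intro mult_mono) auto
      finally show ?thesis by (simp add: H10_deriv_J(2)[OF w v] H10_deriv_J(2)[OF u v])
    qed
    \<comment> \<open>A supremum does not preserve strict inequalities, hence the bound
      \<open>\<epsilon> / 2\<close>.\<close>
    have "H10_dual_norm \<Omega> (\<lambda>v. H10_deriv \<Omega> J w v - H10_deriv \<Omega> J u v) \<le> \<epsilon> / 2"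
      unfolding H10_dual_norm_def
    proof (rule cSUP_least)
      have "G (\<lambda>x. 0) = 0" using H10_class_add(6)[OF u u, of 0] by simp
      then show "{v \<in> H10 \<Omega>. H10_norm \<Omega> v \<le> 1} \<noteq> {}"
          using zero_H10 by (auto simp: H10_norm_grad intro!: exI[of _ "\<lambda>x. 0"])
    qed (use est in auto)
    then show "H10_dual_norm \<Omega> (\<lambda>v. H10_deriv \<Omega> J w v - H10_deriv \<Omega> J u v) < \<epsilon>" using \<epsilon> by simp
  qed
qed

end


section \<open>The Palais-Smale condition below the critical level\<close>

context kirchhoff
begin

section \<open>The energy identity and bounded Palais-Smale sequences\<close>

definition \<kappa> where "\<kappa> = (1 / (2 * \<gamma>) - 1 / p) * b"

lemma kappa_pos: "0 < \<kappa>"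
proof -
  have "1 / p < 1 / (2 * \<gamma>)" using \<gamma> by (intro divide_strict_left_mono) auto
  then show ?thesis using ab by (simp add: \<kappa>_def)
qed

lemma half_minus_inverse_p: "1 / 2 - 1 / p = 1 / real DIM('a)"
proof -
  have "1 / p = (real DIM('a) - 2) / (2 * real DIM('a))" using dim by (simp add: p_eq two_star_def)
  also have "\<dots> = 1 / 2 - 1 / real DIM('a)" using dim by (simp add: field_simps)
  finally show ?thesis by simp
qed

text \<open>The multiple \<open>1/p\<close> of \<open>J' u u\<close> is the one that removes the
  critical integral. The quadratic terms keep the factor \<open>1/2 - 1/p\<close>, which is
  \<open>1/N\<close>, and the Kirchhoff term keeps \<kappa>, positive because
  \<open>2 \<gamma> < p\<close>.\<close>

lemma energy_identity:
  assumes u: "u \<in> H10 \<Omega>"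
  shows "J u - 1 / p * J' u u = 1 / real DIM('a) * (a * (norm (G u))\<^sup>2 - lam * (norm (U u))\<^sup>2) +
      \<kappa> * (norm (G u))\<^sup>2 powr \<gamma>"
proof -
  have n: "nonlin u u = crit u" by (simp add: nonlin_def crit_def spow_mult_self)
  define D where "D = (norm (G u))\<^sup>2"
  have "D powr (\<gamma> - 1) * D = D powr \<gamma>"
  proof (cases "D = 0")
    case False
    then have "D powr (\<gamma> - 1) * D = D powr (\<gamma> - 1) * D powr 1" by (simp add: D_def)
    then show ?thesis unfolding powr_add[symmetric] by simp
  qed simp
  then have jp: "J' u u = a * D + b * D powr \<gamma> - lam * (norm (U u))\<^sup>2 - crit u"
    by (simp add: J'_def kcoeff_def n power2_norm_eq_inner[symmetric] D_def[symmetric] distrib_right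
        mult.assoc)
  have "J u - 1 / p * J' u u = (1 / 2 - 1 / p) * (a * D - lam * (norm (U u))\<^sup>2) + \<kappa> * D powr \<gamma>"
    unfolding jp J_eq[OF u] D_def[symmetric] \<kappa>_def
    by (simp add: algebra_simps diff_divide_distrib add_divide_distrib)
  then show ?thesis unfolding half_minus_inverse_p D_def .
qed

lemma lam_mass_le: "u \<in> H10 \<Omega> \<Longrightarrow> lam * (norm (U u))\<^sup>2 \<le> a * (norm (G u))\<^sup>2"
proof -
  assume u: "u \<in> H10 \<Omega>"
  have "lam * (norm (U u))\<^sup>2 \<le> (a * first_dirichlet_eigenvalue \<Omega>) * (norm (U u))\<^sup>2"
    using lam(2) by (intro mult_right_mono) auto
  also have "\<dots> \<le> a * (norm (G u))\<^sup>2"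
    using first_eigenvalue_poincare[OF u] ab(1) by (simp add: mult.assoc)
  finally show ?thesis .
qed

lemma deriv_bound:
  assumes "u \<in> H10 \<Omega>" "v \<in> H10 \<Omega>"
  shows "\<bar>J' u v\<bar> \<le> H10_dual_norm \<Omega> (H10_deriv \<Omega> J u) * norm (G v)"
  using H10_dual_norm_bound[OF _ assms(2), of "H10_deriv \<Omega> J u"] H10_deriv_J[OF assms(1)] assms(2)
  by (simp add: has_H10_derivative_def)

text \<open>The quadratic bracket of the energy identity is only nonnegative, so the bound comes
  from the term with \<kappa>: once the gradient norm is at least 1,
  \<open>\<kappa> * D powr \<gamma>\<close> is at most a constant times \<open>D\<close>, and
  \<open>\<gamma> > 1\<close>.\<close>

lemma palais_smale_bounded:
  assumes u: "\<And>j::nat. u j \<in> H10 \<Omega>" and Jc: "(\<lambda>j. J (u j)) \<longlonglongrightarrow> c"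
    and d0: "(\<lambda>j. H10_dual_norm \<Omega> (H10_deriv \<Omega> J (u j))) \<longlonglongrightarrow> 0"
  obtains B where "\<And>j. norm (G (u j)) \<le> B"
proof -
  obtain M0 where M0: "\<And>j. \<bar>J (u j)\<bar> \<le> M0" using convergent_imp_bounded[OF Jc] by (auto simp: bounded_iff)
  obtain M1 where M1: "\<And>j. \<bar>H10_dual_norm \<Omega> (H10_deriv \<Omega> J (u j))\<bar> \<le> M1"
    using convergent_imp_bounded[OF d0] by (auto simp: bounded_iff)
  have M: "0 \<le> M0" "0 \<le> M1" using M0[of 0] M1[of 0] by linarith+
  define B where "B = ((M0 + M1) / \<kappa>) powr (1 / (\<gamma> - 1))"
  have "norm (G (u j)) \<le> max 1 B" for j
  proof (cases "norm (G (u j)) \<le> 1")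
    case False
    define D where "D = (norm (G (u j)))\<^sup>2"
    have n: "1 \<le> norm (G (u j))" using False by simp
    have D: "1 \<le> D" "norm (G (u j)) \<le> D"
      using n one_le_power[OF n, of 2] mult_left_mono[OF n, of "norm (G (u j))"]
          by (auto simp: D_def power2_eq_square)
    have "\<kappa> * D powr \<gamma> \<le> J (u j) - 1 / p * J' (u j) (u j)"
      using lam_mass_le[OF u[of j]] unfolding energy_identity[OF u] D_def by simp
    also have "\<dots> \<le> M0 + 1 / p * (M1 * norm (G (u j)))"
    proof -
      have "\<bar>J' (u j) (u j)\<bar> \<le> M1 * norm (G (u j))"
        using M1[of j] by (intro order_trans[OF deriv_bound[OF u u] mult_right_mono]) auto
      then have "1 / p * - J' (u j) (u j) \<le> 1 / p * (M1 * norm (G (u j)))"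
        using p_gt_2 by (intro mult_left_mono) auto
      then show ?thesis using M0[of j] by linarith
    qed
    also have "1 / p * (M1 * norm (G (u j))) \<le> 1 * (M1 * D)"
      using p_gt_2 M D by (intro mult_mono) auto
    also have "M0 + 1 * (M1 * D) \<le> (M0 + M1) * D" using M D mult_left_mono[OF D(1) M(1)]
        by (simp add: distrib_right)
    finally have "\<kappa> * D powr \<gamma> \<le> (M0 + M1) * D" by simp
    moreover have "D powr \<gamma> = D powr (\<gamma> - 1) * D"
    proof -
      have "D powr (\<gamma> - 1) * D = D powr (\<gamma> - 1) * D powr 1" using D by simp
      then show ?thesis unfolding powr_add[symmetric] by simp
    qed
    ultimately have "(\<kappa> * D powr (\<gamma> - 1)) * D \<le> (M0 + M1) * D" by simp
    then have "\<kappa> * D powr (\<gamma> - 1) \<le> M0 + M1" using D by (subst (asm) mult_le_cancel_right) auto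
    then have "D powr (\<gamma> - 1) \<le> (M0 + M1) / \<kappa>" using kappa_pos by (simp add: field_simps)
    then have "(D powr (\<gamma> - 1)) powr (1 / (\<gamma> - 1)) \<le> B" unfolding B_def using \<gamma> by (intro powr_mono2) auto
    then have "D \<le> B" using \<gamma> D by (simp add: powr_powr)
    then show ?thesis using D by simp
  qed simp
  then show thesis using that by blast
qed

section \<open>Strong convergence below the critical level\<close>

theorem palais_smale_below_level:
  assumes t0: "0 < t0"
    and root: "\<And>s. 0 < s \<Longrightarrow> a + b * s powr (\<gamma> - 1) \<le> sobolev_const \<Omega> powr (- (p / 2)) * s powr (p / 2 - 1) \<Longrightarrow>
        t0 \<le> s"
    and c: "c < 1 / real DIM('a) * a * t0 + \<kappa> * t0 powr \<gamma>"
  shows "palais_smale \<Omega> J c"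
  unfolding palais_smale_def
proof (intro conjI J_C1 allI impI, elim conjE)
  fix u :: "nat \<Rightarrow> 'a \<Rightarrow> real"
  assume "\<forall>j. u j \<in> H10 \<Omega>" and Jc: "(\<lambda>j. J (u j)) \<longlonglongrightarrow> c"
    and d0: "(\<lambda>j. H10_dual_norm \<Omega> (H10_deriv \<Omega> J (u j))) \<longlonglongrightarrow> 0"
  then have u: "u j \<in> H10 \<Omega>" for j by blast
  obtain B where B: "\<And>j. norm (G (u j)) \<le> B" using palais_smale_bounded[OF u Jc d0] by blast
  have B0: "0 \<le> B" using B[of 0] norm_ge_zero order_trans by blast
  obtain r w where r: "strict_mono (r::nat\<Rightarrow>nat)" and w: "w \<in> H10 \<Omega>"
    and wk: "\<And>v. (\<lambda>n. G (u (r n)) \<bullet> v) \<longlonglongrightarrow> G w \<bullet> v"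
    and st: "(\<lambda>n. U (u (r n))) \<longlonglongrightarrow> U w"
    and ae: "AE x in lebesgue_on \<Omega>. (\<lambda>n. u (r n) x) \<longlonglongrightarrow> w x"
    by (rule H10_compactness[of u, OF u B]) blast
  have "bounded (range (\<lambda>n. (norm (G (u (r n))))\<^sup>2))"
  proof (rule boundedI)
    fix s assume "s \<in> range (\<lambda>n. (norm (G (u (r n))))\<^sup>2)"
    then obtain n where "s = (norm (G (u (r n))))\<^sup>2" by blast
    then show "norm s \<le> B\<^sup>2" using power_mono[OF B[of "r n"], of 2] by simp
  qed
  \<comment> \<open>Weak convergence does not determine the limit of the norms, on which the
    nonlocal coefficient depends; a further subsequence fixes it.\<close>
  then obtain t q where q: "strict_mono (q::nat\<Rightarrow>nat)" and "((\<lambda>n. (norm (G (u (r n))))\<^sup>2) \<circ> q) \<longlonglongrightarrow> t"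
    using bounded_imp_convergent_subsequence by metis
  define y where "y n = u (r (q n))" for n
  have y: "y n \<in> H10 \<Omega>" for n by (simp add: y_def u)
  have yB: "norm (G (y n)) \<le> B" for n by (simp add: y_def B)
  have rq: "strict_mono (\<lambda>n. r (q n))" using strict_mono_o[OF r q] by (simp add: o_def)
  have yt: "(\<lambda>n. (norm (G (y n)))\<^sup>2) \<longlonglongrightarrow> t"
    using \<open>((\<lambda>n. (norm (G (u (r n))))\<^sup>2) \<circ> q) \<longlonglongrightarrow> t\<close> by (simp add: o_def y_def)
  have yw: "(\<lambda>n. G (y n) \<bullet> v) \<longlonglongrightarrow> G w \<bullet> v" for v
    using LIMSEQ_subseq_LIMSEQ[OF wk q] by (simp add: o_def y_def)
  have yU: "(\<lambda>n. U (y n)) \<longlonglongrightarrow> U w" using LIMSEQ_subseq_LIMSEQ[OF st q] by (simp add: o_def y_def)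
  have yae: "AE x in lebesgue_on \<Omega>. (\<lambda>n. y n x) \<longlonglongrightarrow> w x"
    using ae by eventually_elim (use LIMSEQ_subseq_LIMSEQ q in \<open>fastforce simp: o_def y_def\<close>)
  have yJ: "(\<lambda>n. J (y n)) \<longlonglongrightarrow> c" using LIMSEQ_subseq_LIMSEQ[OF Jc rq] by (simp add: o_def y_def)
  define \<delta> where "\<delta> n = H10_dual_norm \<Omega> (H10_deriv \<Omega> J (y n))" for n
  have \<delta>: "\<delta> \<longlonglongrightarrow> 0" using LIMSEQ_subseq_LIMSEQ[OF d0 rq] by (simp add: o_def y_def \<delta>_def[abs_def])
  \<comment> \<open>Smallness in the dual norm controls bounded sequences of test directions, not
    just fixed ones; it is used for \<open>v n\<close> and for \<open>y n\<close> itself.\<close>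
  have J'0: "(\<lambda>n. J' (y n) (z n)) \<longlonglongrightarrow> 0" if z: "\<And>n. z n \<in> H10 \<Omega>" "\<And>n. norm (G (z n)) \<le> C" for z C
  proof (rule Lim_null_comparison)
    have "norm (J' (y n) (z n)) \<le> \<bar>\<delta> n\<bar> * C" for n
    proof -
      have "norm (J' (y n) (z n)) \<le> \<delta> n * norm (G (z n))"
          using deriv_bound[OF y z(1), of n n] by (simp add: \<delta>_def)
      also have "\<dots> \<le> \<bar>\<delta> n\<bar> * C" using z(2) by (intro mult_mono) auto
      finally show ?thesis .
    qed
    then show "\<forall>\<^sub>F n in sequentially. norm (J' (y n) (z n)) \<le> \<bar>\<delta> n\<bar> * C" by simp
    show "(\<lambda>n. \<bar>\<delta> n\<bar> * C) \<longlonglongrightarrow> 0" using tendsto_mult_left_zero[OF tendsto_rabs_zero[OF \<delta>]] .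
  qed
  define v where "v n = (\<lambda>x. y n x - w x)" for n
  have v: "v n \<in> H10 \<Omega>" for n unfolding v_def by (rule H10_diff[OF y w])
  have vG: "G (v n) = G (y n) - G w" "U (v n) = U (y n) - U w" for n
    unfolding v_def by (simp_all add: H10_class_add[OF y w])
  have vB: "norm (G (v n)) \<le> B + norm (G w)" for n
    unfolding vG using norm_triangle_ineq4[of "G (y n)" "G w"] yB[of n] by linarith
  define s where "s = t - (norm (G w))\<^sup>2"
  have vs: "(\<lambda>n. (norm (G (v n)))\<^sup>2) \<longlonglongrightarrow> s"
  proof -
    have "(\<lambda>n. (norm (G (y n)))\<^sup>2 - 2 * (G (y n) \<bullet> G w) + (norm (G w))\<^sup>2)
        \<longlonglongrightarrow> t - 2 * (G w \<bullet> G w) + (norm (G w))\<^sup>2"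
      by (intro tendsto_intros yt yw)
    moreover have "(norm (G (v n)))\<^sup>2 = (norm (G (y n)))\<^sup>2 - 2 * (G (y n) \<bullet> G w) + (norm (G w))\<^sup>2" for n
      unfolding vG power2_norm_eq_inner by (simp add: inner_diff_left inner_diff_right inner_commute)
    ultimately show ?thesis by (simp add: s_def power2_norm_eq_inner)
  qed
  have s0: "0 \<le> s" by (rule LIMSEQ_le_const[OF vs]) auto
  have "s = 0"
  proof (rule ccontr)
    assume "s \<noteq> 0"
    with s0 have s: "0 < s" by simp
    have st: "s \<le> t" by (simp add: s_def)
    define \<sigma> where "\<sigma> = sobolev_const \<Omega> powr (- (p / 2))"
    have k: "(\<lambda>n. kcoeff (G (y n)) * (G (y n) \<bullet> G (v n))) \<longlonglongrightarrow> (a + b * t powr (\<gamma> - 1)) * s"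
    proof (rule tendsto_mult)
      show "(\<lambda>n. kcoeff (G (y n))) \<longlonglongrightarrow> a + b * t powr (\<gamma> - 1)"
        unfolding kcoeff_def using \<gamma> by (intro tendsto_add tendsto_mult tendsto_const tendsto_powr' yt) (auto
            intro: always_eventually)
      have "(\<lambda>n. (norm (G (y n)))\<^sup>2 - G (y n) \<bullet> G w) \<longlonglongrightarrow> t - G w \<bullet> G w" by (intro tendsto_intros yt yw)
      then show "(\<lambda>n. G (y n) \<bullet> G (v n)) \<longlonglongrightarrow> s" by (simp add: vG inner_diff_right s_def power2_norm_eq_inner)
    qed
    have m: "(\<lambda>n. lam * (U (y n) \<bullet> U (v n))) \<longlonglongrightarrow> lam * (U w \<bullet> (U w - U w))"
      unfolding vG by (intro tendsto_intros yU)
    \<comment> \<open>All other terms of \<open>J' (y n) (v n)\<close> have known limits; the one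
      with \<open>lam\<close> vanishes by strong convergence in the mean square.\<close>
    have nl: "(\<lambda>n. nonlin (y n) (v n)) \<longlonglongrightarrow> (a + b * t powr (\<gamma> - 1)) * s"
    proof -
      have "(\<lambda>n. kcoeff (G (y n)) * (G (y n) \<bullet> G (v n)) - lam * (U (y n) \<bullet> U (v n)) - J' (y n) (v n))
          \<longlonglongrightarrow> (a + b * t powr (\<gamma> - 1)) * s - lam * (U w \<bullet> (U w - U w)) - 0"
        using k m J'0[OF v vB] by (intro tendsto_diff)
      then show ?thesis by (simp add: J'_def)
    qed
    \<comment> \<open>With \<open>y n = v n + w\<close>, the splitting inequality bounds the
      integrand by a small multiple of \<open>\<bar>v n\<bar> powr p\<close>, whose integrals are
      bounded, plus a fixed multiple of \<open>\<bar>w\<bar> powr p\<close>.\<close>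
    have bl: "(\<lambda>n. nonlin (y n) (v n) - crit (v n)) \<longlonglongrightarrow> 0"
    proof -
      have "(\<lambda>n. LINT x|lebesgue_on \<Omega>. spow (y n x) (p - 1) * v n x - \<bar>v n x\<bar> powr p) \<longlonglongrightarrow> 0"
      proof (rule vanishing_integral)
        show "integrable (lebesgue_on \<Omega>) (\<lambda>x. spow (y n x) (p - 1) * v n x - \<bar>v n x\<bar> powr p)" for n
          using nonlin_integrable[OF y v] crit_integrable[OF v] by simp
        show "integrable (lebesgue_on \<Omega>) (\<lambda>x. \<bar>v n x\<bar> powr p)" for n by (rule crit_integrable[OF v])
        show "(LINT x|lebesgue_on \<Omega>. \<bar>v n x\<bar> powr p) \<le> (K * (B + norm (G w))) powr p" for n
          unfolding crit_def[symmetric] using vB K_pos p_gt_2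
          by (intro order_trans[OF crit_le[OF v] powr_mono2] mult_left_mono) auto
        show "AE x in lebesgue_on \<Omega>. (\<lambda>n. spow (y n x) (p - 1) * v n x - \<bar>v n x\<bar> powr p) \<longlonglongrightarrow> 0"
          using yae
        proof eventually_elim
          case (elim x)
          have "isCont (\<lambda>s. spow s (p - 1)) (w x)"
            using continuous_on_spow[of "p - 1"] p_gt_2 by (simp add: continuous_on_eq_continuous_at)
          then have 1: "(\<lambda>n. spow (y n x) (p - 1)) \<longlonglongrightarrow> spow (w x) (p - 1)"
              using elim by (rule isCont_tendsto_compose)
          have 2: "(\<lambda>n. v n x) \<longlonglongrightarrow> 0" using elim by (simp add: v_def LIM_zero_iff)
          have 3: "(\<lambda>n. \<bar>v n x\<bar> powr p) \<longlonglongrightarrow> 0 powr p"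
            using tendsto_rabs_zero[OF 2] p_gt_2 by (intro tendsto_powr' tendsto_const) auto
          from tendsto_diff[OF tendsto_mult[OF 1 2] 3] show ?case by simp
        qed
        fix \<epsilon> :: real assume "0 < \<epsilon>"
        then obtain K0 where K0: "0 \<le> K0"
          "\<And>a b. \<bar>spow (a + b) (p - 1) * a - \<bar>a\<bar> powr p\<bar> \<le> \<epsilon> * \<bar>a\<bar> powr p + K0 * \<bar>b\<bar> powr p"
          using spow_splitting_bound[OF p_gt_2] by metis
        show "\<exists>H. integrable (lebesgue_on \<Omega>) H \<and> (\<forall>n x. \<bar>spow (y n x) (p - 1) * v n x - \<bar>v n x\<bar> powr p\<bar>
            \<le> \<epsilon> * \<bar>v n x\<bar> powr p + H x)"
        proof (intro exI conjI allI)
          show "integrable (lebesgue_on \<Omega>) (\<lambda>x. K0 * \<bar>w x\<bar> powr p)" using crit_integrable[OF w] by simp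
          show "\<bar>spow (y n x) (p - 1) * v n x - \<bar>v n x\<bar> powr p\<bar> \<le> \<epsilon> * \<bar>v n x\<bar> powr p + K0 * \<bar>w x\<bar> powr p"
              for n x
            using K0(2)[of "v n x" "w x"] by (simp add: v_def)
        qed
      qed simp
      then show ?thesis using nonlin_integrable[OF y v] crit_integrable[OF v]
          by (simp add: nonlin_def crit_def)
    qed
    from tendsto_diff[OF nl bl] have cr: "(\<lambda>n. crit (v n)) \<longlonglongrightarrow> (a + b * t powr (\<gamma> - 1)) * s" by simp
    have "(\<lambda>n. \<sigma> * (norm (G (v n)))\<^sup>2 powr (p / 2)) \<longlonglongrightarrow> \<sigma> * s powr (p / 2)"
      using p_gt_2 by (intro tendsto_mult tendsto_const tendsto_powr' vs) (auto intro: always_eventually)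
    then have "(a + b * t powr (\<gamma> - 1)) * s \<le> \<sigma> * s powr (p / 2)"
    proof (rule LIMSEQ_le[OF cr], intro exI allI impI)
      fix n
      have "(norm (G (v n)))\<^sup>2 powr (p / 2) = norm (G (v n)) powr p"
        by (cases "G (v n) = 0") (auto simp: powr_powr simp flip: powr_numeral)
      then show "crit (v n) \<le> \<sigma> * (norm (G (v n)))\<^sup>2 powr (p / 2)"
        using sobolev_const_inequality(2)[OF dim v[of n], folded p_eq] by (simp add: crit_def \<sigma>_def)
    qed
    also have "s powr (p / 2) = s powr (p / 2 - 1) * s"
    proof -
      have "s powr (p / 2 - 1) * s = s powr (p / 2 - 1) * s powr 1" using s by simp
      then show ?thesis unfolding powr_add[symmetric] by simp
    qed
    finally have "(a + b * t powr (\<gamma> - 1)) * s \<le> (\<sigma> * s powr (p / 2 - 1)) * s" by simp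
    then have "a + b * t powr (\<gamma> - 1) \<le> \<sigma> * s powr (p / 2 - 1)"
        using s by (subst (asm) mult_le_cancel_right) auto
    \<comment> \<open>The coefficient involves the whole energy \<open>t\<close>, but the equation
      for \<open>t0\<close> involves a single variable; lowering \<open>t\<close> to
      \<open>s\<close> keeps the inequality.\<close>
    moreover have "b * s powr (\<gamma> - 1) \<le> b * t powr (\<gamma> - 1)"
      using s st ab \<gamma> by (intro mult_left_mono powr_mono2) auto
    ultimately have ts: "t0 \<le> s" using s by (intro root) (auto simp: \<sigma>_def)
    have "(\<lambda>n. J (y n) - 1 / p * J' (y n) (y n)) \<longlonglongrightarrow> c - 1 / p * 0"
      by (intro tendsto_intros yJ J'0[OF y yB])
    moreover have "(\<lambda>n. J (y n) - 1 / p * J' (y n) (y n)) \<longlonglongrightarrow>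
        1 / real DIM('a) * (a * t - lam * (norm (U w))\<^sup>2) + \<kappa> * t powr \<gamma>"
      unfolding energy_identity[OF y] using \<gamma>
      by (intro tendsto_add tendsto_mult tendsto_diff tendsto_const tendsto_powr' tendsto_power tendsto_norm
          yt yU)
        (auto intro: always_eventually)
    ultimately have "c = 1 / real DIM('a) * (a * t - lam * (norm (U w))\<^sup>2) + \<kappa> * t powr \<gamma>"
      using LIMSEQ_unique by fastforce
    \<comment> \<open>Splitting \<open>t\<close> into \<open>s\<close> and the energy of
      \<open>w\<close>, the latter pays for the term with \<open>lam\<close> by the eigenvalue
      inequality.\<close>
    moreover have "1 / real DIM('a) * (a * t0) \<le> 1 / real DIM('a) * (a * t - lam * (norm (U w))\<^sup>2)"
    proof (rule mult_left_mono)
      have "a * t0 \<le> a * s" using ts ab by simp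
      also have "\<dots> = a * t - a * (norm (G w))\<^sup>2" by (simp add: s_def right_diff_distrib)
      also have "\<dots> \<le> a * t - lam * (norm (U w))\<^sup>2" using lam_mass_le[OF w] by simp
      finally show "a * t0 \<le> a * t - lam * (norm (U w))\<^sup>2" .
    qed simp
    moreover have "\<kappa> * t0 powr \<gamma> \<le> \<kappa> * t powr \<gamma>"
      using kappa_pos ts st t0 \<gamma> by (intro mult_left_mono powr_mono2) auto
    ultimately show False using c by (simp only: mult.assoc)
  qed
  with vs have "(\<lambda>n. sqrt ((norm (G (v n)))\<^sup>2)) \<longlonglongrightarrow> sqrt 0" by (intro tendsto_real_sqrt) simp
  then have "(\<lambda>n. H10_norm \<Omega> (\<lambda>x. u (r (q n)) x - w x)) \<longlonglongrightarrow> 0"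
    using H10_norm_grad[OF v] by (simp add: v_def y_def)
  with rq w show "\<exists>r w. strict_mono (r :: nat \<Rightarrow> nat) \<and> w \<in> H10 \<Omega> \<and> (\<lambda>j. H10_norm \<Omega> (\<lambda>x. u (r j) x - w x)) \<longlonglongrightarrow> 0"
    by blast
qed

end

theorem theorem1p1:
  fixes \<Omega> :: "'a::euclidean_space set" and N :: nat and a b \<gamma> lam :: real
  assumes "N = DIM('a)" and "3 \<le> N"
    and "open \<Omega>" and "connected \<Omega>" and "\<Omega> \<noteq> {}" and "bounded \<Omega>"
    and "1 < \<gamma>" and "\<gamma> < two_star N / 2"
    and "0 < a" and "0 < b"
    and "0 < lam" and "lam \<le> a * first_dirichlet_eigenvalue \<Omega>"
  shows "\<exists>t0.
    (\<forall>t. (0 < t \<and> a + b * t powr (\<gamma> - 1)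
             = sobolev_const \<Omega> powr (- (two_star N / 2)) * t powr (two_star N / 2 - 1))
         \<longleftrightarrow> t = t0) \<and>
    (\<forall>c. c < 1 / real N * a * t0 + (1 / (2 * \<gamma>) - 1 / two_star N) * b * t0 powr \<gamma> \<longrightarrow>
         palais_smale \<Omega> (kirchhoff_functional \<Omega> a b \<gamma> lam) c)"
proof -
  define p where "p = two_star N"
  interpret kirchhoff \<Omega> a b \<gamma> lam p
    by unfold_locales (use assms in \<open>auto simp: p_def\<close>)
  have \<sigma>: "0 < sobolev_const \<Omega> powr (- (p / 2))"
    using sobolev_const_inequality(1)[OF dim] by simp
  have "0 < \<gamma> - 1" "\<gamma> - 1 < p / 2 - 1" using \<gamma> by auto
  \<comment> \<open>Besides existence and uniqueness, the root provides the lower bound on lost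
    energy that the compactness argument takes as \<open>root\<close>.\<close>
  from critical_level_root[OF ab \<sigma> this] obtain t0 where
    eq: "\<And>t. 0 < t \<and> a + b * t powr (\<gamma> - 1) = sobolev_const \<Omega> powr (- (p / 2)) * t powr (p / 2 - 1) \<longleftrightarrow> t = t0"
    and t0: "0 < t0"
    and root: "\<And>s. 0 < s \<Longrightarrow> a + b * s powr (\<gamma> - 1) \<le> sobolev_const \<Omega> powr (- (p / 2)) * s powr (p / 2 - 1) \<Longrightarrow>
        t0 \<le> s"
    by metis
  show ?thesis
  proof (intro exI conjI allI impI)
    show "(0 < t \<and> a + b * t powr (\<gamma> - 1) = sobolev_const \<Omega> powr (- (two_star N / 2)) *
        t powr (two_star N / 2 - 1))
        \<longleftrightarrow> t = t0" for t
      using eq[of t] by (simp only: p_def)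
    fix c assume c: "c < 1 / real N * a * t0 + (1 / (2 * \<gamma>) - 1 / two_star N) * b * t0 powr \<gamma>"
    have "c < 1 / real DIM('a) * a * t0 + \<kappa> * t0 powr \<gamma>"
      using c assms(1) unfolding \<kappa>_def unfolding p_def by simp
    then show "palais_smale \<Omega> (kirchhoff_functional \<Omega> a b \<gamma> lam) c"
      using palais_smale_below_level[OF t0 root] by blast
  qed
qed

end
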